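(* Let $M$ and $N$ be smooth closed manifolds with $\dim M=\dim N\ge 1$. Let $c:M\times N\to[0,\infty)$ be a cost function of class $C^2$ such that $$(\ast)\qquad \exists\,(\bar x,\bar y)\in M\times N\ \text{ such that }\ \frac{\partial^2 c}{\partial x\,\partial y}(\bar x,\bar y)\ \text{ is invertible}.$$ Then there is a pair $\mu,\nu$ of Borel probability measures on $M$ and $N$ respectively, both absolutely continuous with respect to Lebesgue measure, for which there is a unique optimal transport plan, i.e. a unique minimizer of $$\gamma\longmapsto \int_{M\times N}c(x,y)\,d\gamma(x,y)$$ over $\gamma\in\Pi(\mu,\nu)$, and such that this plan is not supported on a graph. Moreover, the set of costs $c$ satisfying $(\ast)$ is open and dense in $C^2(M\times N;\mathbb{R})$.
   Context: A closed manifold is a compact manifold without boundary. $\Pi(\mu,\nu)$ denotes the set of non-negative Borel measures on $M\times N$ with marginals $\mu$ on $M$ and $\nu$ on $N$ (transport plans). Absolute continuity with respect to Lebesgue measure is understood in local charts. A set $S\subset M\times N$ is a graph if for every $(x,y)\in S$ there is no $y'\ne y$ with $(x,y')\in S$; a plan is supported (concentrated) on a graph if it vanishes outside some graph. $\frac{\partial^2 c}{\partial x\partial y}(\bar x,\bar y)$ denotes the mixed second partial derivative, viewed in local coordinates as a square matrix. *)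

theory Defs
  imports "HOL-Probability.Probability"
begin

section \<open>Differentiability on open subsets of Euclidean spaces\<close>

definition dir_deriv ::
    "('a::real_normed_vector \<Rightarrow> 'b::real_normed_vector) \<Rightarrow> 'a \<Rightarrow> 'a \<Rightarrow> 'b"
  where "dir_deriv f v = (\<lambda>x. frechet_derivative f (at x) v)"

text \<open>Only meant for open \<open>S\<close> in a finite-dimensional space, where quantifying over all directions
  \<open>v\<close> is the same as requiring continuity of all iterated partial derivatives.\<close>

fun Ck_on :: "nat \<Rightarrow> 'a::real_normed_vector set \<Rightarrow> ('a \<Rightarrow> 'b::real_normed_vector) \<Rightarrow> bool"
  where
    "Ck_on 0 S f \<longleftrightarrow> continuous_on S f"
  | "Ck_on (Suc k) S f \<longleftrightarrow> (\<forall>x\<in>S. f differentiable (at x)) \<and> (\<forall>v. Ck_on k S (dir_deriv f v))"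

definition smooth_on :: "'a::real_normed_vector set \<Rightarrow> ('a \<Rightarrow> 'b::real_normed_vector) \<Rightarrow> bool"
  where "smooth_on S f \<longleftrightarrow> (\<forall>k. Ck_on k S f)"

section \<open>Manifolds\<close>

text \<open>The underlying topological space of a manifold is a whole type, and its smooth structure is
  the one generated by an atlas, which need not be maximal. A chart is a pair of an open domain and
  a map; the values of the map outside the domain are irrelevant.\<close>

type_synonym ('m, 'e) chart = "'m set \<times> ('m \<Rightarrow> 'e)"

definition chart_inv :: "('m, 'e) chart \<Rightarrow> 'e \<Rightarrow> 'm"
  where "chart_inv \<kappa> = inv_into (fst \<kappa>) (snd \<kappa>)"

definition is_chart :: "('m::topological_space, 'e::euclidean_space) chart \<Rightarrow> bool"
  where "is_chart \<kappa> \<longleftrightarrow> open (fst \<kappa>) \<and> open (snd \<kappa> ` fst \<kappa>) \<and>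
    homeomorphism (fst \<kappa>) (snd \<kappa> ` fst \<kappa>) (snd \<kappa>) (chart_inv \<kappa>)"

definition smooth_atlas :: "('m::topological_space, 'e::euclidean_space) chart set \<Rightarrow> bool"
  where "smooth_atlas A \<longleftrightarrow>
    (\<Union>\<kappa>\<in>A. fst \<kappa>) = UNIV \<and> (\<forall>\<kappa>\<in>A. is_chart \<kappa>) \<and>
    (\<forall>\<kappa>\<in>A. \<forall>\<eta>\<in>A. smooth_on (snd \<kappa> ` (fst \<kappa> \<inter> fst \<eta>)) (snd \<eta> \<circ> chart_inv \<kappa>))"

definition closed_manifold ::
    "('m::{t2_space,second_countable_topology}, 'e::euclidean_space) chart set \<Rightarrow> bool"
  where "closed_manifold A \<longleftrightarrow> compact (UNIV :: 'm set) \<and> smooth_atlas A"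

definition prod_chart :: "('m, 'e) chart \<Rightarrow> ('n, 'f) chart \<Rightarrow> ('m \<times> 'n, 'e \<times> 'f) chart"
  where "prod_chart \<kappa> \<eta> = (fst \<kappa> \<times> fst \<eta>, map_prod (snd \<kappa>) (snd \<eta>))"

definition prod_atlas ::
    "('m, 'e) chart set \<Rightarrow> ('n, 'f) chart set \<Rightarrow> ('m \<times> 'n, 'e \<times> 'f) chart set"
  where "prod_atlas A B = {prod_chart \<kappa> \<eta> | \<kappa> \<eta>. \<kappa> \<in> A \<and> \<eta> \<in> B}"

definition Ck_functions ::
    "nat \<Rightarrow> ('m::topological_space, 'e::euclidean_space) chart set \<Rightarrow> ('m \<Rightarrow> real) set"
  where "Ck_functions k A = {f. \<forall>\<kappa>\<in>A. Ck_on k (snd \<kappa> ` fst \<kappa>) (f \<circ> chart_inv \<kappa>)}"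

section \<open>The \<open>C\<^sup>k\<close> topology\<close>

text \<open>All partial derivatives of \<open>F\<close> of order at most \<open>k\<close> are smaller than \<open>\<epsilon>\<close> on \<open>K\<close>.\<close>

fun Ck_small :: "nat \<Rightarrow> 'a::euclidean_space set \<Rightarrow> real \<Rightarrow> ('a \<Rightarrow> real) \<Rightarrow> bool"
  where
    "Ck_small 0 K \<epsilon> F \<longleftrightarrow> (\<forall>x\<in>K. \<bar>F x\<bar> < \<epsilon>)"
  | "Ck_small (Suc k) K \<epsilon> F \<longleftrightarrow>
      (\<forall>x\<in>K. \<bar>F x\<bar> < \<epsilon>) \<and> (\<forall>b\<in>Basis. Ck_small k K \<epsilon> (dir_deriv F b))"

definition Ck_nbhd ::
    "nat \<Rightarrow> ('m::topological_space, 'e::euclidean_space) chart set \<Rightarrow>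
      ('m \<Rightarrow> real) \<Rightarrow> ('m, 'e) chart \<Rightarrow> 'm set \<Rightarrow> real \<Rightarrow> ('m \<Rightarrow> real) set"
  where "Ck_nbhd k A f \<kappa> K \<epsilon> =
    {g \<in> Ck_functions k A. Ck_small k (snd \<kappa> ` K) \<epsilon> ((\<lambda>x. g x - f x) \<circ> chart_inv \<kappa>)}"

text \<open>The topology of uniform convergence of all derivatives up to order \<open>k\<close> on compact subsets of
  charts. On a compact manifold it is the topology of the usual \<open>C\<^sup>k\<close> norm built from a finite
  cover by compact subsets of charts.\<close>

definition Ck_topology ::
    "nat \<Rightarrow> ('m::topological_space, 'e::euclidean_space) chart set \<Rightarrow> ('m \<Rightarrow> real) topology"
  where "Ck_topology k A = topology_generated_by
    {Ck_nbhd k A f \<kappa> K \<epsilon> | f \<kappa> K \<epsilon>.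
      f \<in> Ck_functions k A \<and> \<kappa> \<in> A \<and> compact K \<and> K \<subseteq> fst \<kappa> \<and> 0 < \<epsilon>}"

lemma Ck_small_empty: "Ck_small k {} \<epsilon> F"
  by (induction k arbitrary: F) auto

lemma topspace_Ck_topology:
  assumes "smooth_atlas A"
  shows "topspace (Ck_topology k A) = Ck_functions k A"
proof -
  obtain \<kappa> where \<kappa>: "\<kappa> \<in> A"
    using assms by (force simp: smooth_atlas_def)
  have "f \<in> topspace (Ck_topology k A)" if f: "f \<in> Ck_functions k A" for f
  proof -
    have "f \<in> Ck_nbhd k A f \<kappa> {} 1"
      using f by (simp add: Ck_nbhd_def Ck_small_empty)
    moreover have "Ck_nbhd k A f \<kappa> {} 1 \<in> {Ck_nbhd k A f \<kappa> K \<epsilon> | f \<kappa> K \<epsilon>.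
      f \<in> Ck_functions k A \<and> \<kappa> \<in> A \<and> compact K \<and> K \<subseteq> fst \<kappa> \<and> 0 < \<epsilon>}"
      using f \<kappa> by (intro CollectI exI conjI refl) auto
    ultimately show ?thesis
      unfolding Ck_topology_def topology_generated_by_topspace by (rule UnionI[rotated])
  qed
  moreover have "topspace (Ck_topology k A) \<subseteq> Ck_functions k A"
    unfolding Ck_topology_def topology_generated_by_topspace by (auto simp: Ck_nbhd_def)
  ultimately show ?thesis by blast
qed

section \<open>The non-degeneracy condition\<close>

text \<open>The entry in row \<open>i\<close> and column \<open>j\<close> is the derivative of \<open>F\<close> in the \<open>j\<close>-th coordinate of the
  second variable, then in the \<open>i\<close>-th coordinate of the first.\<close>

definition mixed_partials ::
    "((real^'d) \<times> (real^'d) \<Rightarrow> real) \<Rightarrow> (real^'d) \<times> (real^'d) \<Rightarrow> real^'d^'d"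
  where "mixed_partials F p =
    (\<chi> i j. dir_deriv (dir_deriv F (0, axis j 1)) (axis i 1, 0) p)"

text \<open>Invertibility of the mixed derivative of a \<open>C\<^sup>2\<close> function does not depend on the charts, since
  a change of charts multiplies the matrix by invertible matrices on both sides.\<close>

definition nondegenerate_at ::
    "('m, real^'d) chart set \<Rightarrow> ('n, real^'d) chart set \<Rightarrow> ('m \<times> 'n \<Rightarrow> real) \<Rightarrow> 'm \<Rightarrow> 'n \<Rightarrow> bool"
  where "nondegenerate_at A B c x y \<longleftrightarrow>
    (\<exists>\<kappa>\<in>A. \<exists>\<eta>\<in>B. x \<in> fst \<kappa> \<and> y \<in> fst \<eta> \<and>
      invertible (mixed_partials (c \<circ> chart_inv (prod_chart \<kappa> \<eta>)) (snd \<kappa> x, snd \<eta> y)))"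

section \<open>Optimal transport\<close>

text \<open>Borel probability measures that are absolutely continuous with respect to Lebesgue measure in
  every chart of the atlas.\<close>

definition ac_prob ::
    "('m::topological_space, 'e::euclidean_space) chart set \<Rightarrow> 'm measure \<Rightarrow> bool"
  where "ac_prob A \<mu> \<longleftrightarrow> sets \<mu> = sets borel \<and> prob_space \<mu> \<and>
    (\<forall>\<kappa>\<in>A. absolutely_continuous lborel (distr (restrict_space \<mu> (fst \<kappa>)) borel (snd \<kappa>)))"

definition transport_plans ::
    "'m::topological_space measure \<Rightarrow> 'n::topological_space measure \<Rightarrow> ('m \<times> 'n) measure set"
  where "transport_plans \<mu> \<nu> =
    {\<gamma>. sets \<gamma> = sets borel \<and> distr \<gamma> borel fst = \<mu> \<and> distr \<gamma> borel snd = \<nu>}"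

definition transport_cost :: "('m \<times> 'n \<Rightarrow> real) \<Rightarrow> ('m \<times> 'n) measure \<Rightarrow> ennreal"
  where "transport_cost c \<gamma> = (\<integral>\<^sup>+ z. ennreal (c z) \<partial>\<gamma>)"

definition optimal_plan ::
    "('m::topological_space \<times> 'n::topological_space \<Rightarrow> real) \<Rightarrow> 'm measure \<Rightarrow> 'n measure \<Rightarrow>
      ('m \<times> 'n) measure \<Rightarrow> bool"
  where "optimal_plan c \<mu> \<nu> \<gamma> \<longleftrightarrow> \<gamma> \<in> transport_plans \<mu> \<nu> \<and>
    (\<forall>\<gamma>'\<in>transport_plans \<mu> \<nu>. transport_cost c \<gamma> \<le> transport_cost c \<gamma>')"

text \<open>A graph is a \<^const>\<open>single_valued\<close> set of pairs. It need not be measurable; the plan vanishes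
  outside it if the complement is contained in a Borel set of measure zero.\<close>

definition supported_on_graph :: "('m \<times> 'n) measure \<Rightarrow> bool"
  where "supported_on_graph \<gamma> \<longleftrightarrow> (\<exists>S. single_valued S \<and> (AE z in \<gamma>. z \<in> S))"

end

theory Submission
  imports Defs
begin

text \<open>Fix a point \<open>x\<close> of \<open>M\<close> and a chart around it, and let \<open>G(y)\<close> be the differential of \<open>c(\<cdot>, y)\<close>
  at \<open>x\<close>, a \<open>C\<^sup>1\<close> map from \<open>N\<close> to \<open>\<real>\<^sup>d\<close> whose Jacobian is the mixed derivative of \<open>c\<close>. As \<open>N\<close> is
  closed, almost every value of \<open>G\<close> is taken an even number of times: multiplying \<open>G\<close> by \<open>1 - \<rho>\<close> for
  bump functions \<open>\<rho>\<close> deforms it to zero one chart at a time, and in a chart the signed number of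
  preimages of a compactly supported map is zero because the integral of its Jacobian determinant
  vanishes. Together with Sard's theorem, non-degeneracy at one point gives two points \<open>y1 \<noteq> y2\<close>
  with \<open>G(y1) = G(y2) = p\<close> and invertible mixed derivatives.

  For large \<open>L\<close> and \<open>\<phi>(u) = p \<bullet> (u - x) - L/2 |u - x|\<^sup>2\<close>, the function \<open>c(\<cdot>, y) - \<phi>\<close> has a unique
  minimiser \<open>T(y)\<close> near \<open>x\<close> for every \<open>y\<close> near \<open>y1\<close> or \<open>y2\<close>; the map \<open>T\<close> is bi-Lipschitz near both points
  and sends both to \<open>x\<close>. Let \<open>\<nu>\<close> be uniform in charts around \<open>y1\<close> and \<open>y2\<close> and \<open>\<mu> = T\<^sub>#\<nu>\<close>. By duality with
  the potential \<open>\<phi>\<close>, the only optimal plan is the one carried by \<open>{(T(y), y)}\<close>, and it splits the mass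
  at almost every point near \<open>x\<close>.

  For density, add \<open>t b\<close> where the mixed derivative of \<open>b\<close> at some point is the identity: the
  determinant is then a non-zero polynomial in \<open>t\<close>.\<close>

section \<open>Calculus of \<open>C\<^sup>k\<close> functions\<close>

text \<open>To split the mass at x, two targets y must touch the potential there:
  \<open>c(x, y) - \<phi>(x)\<close> must be critical in x for both, so the x-gradient of c takes
  the same value at both. This is why a double value of \<open>G\<close> is sought. Regularity at
  both targets makes the two images under \<open>T\<close> open; both contain x, so they overlap in
  a set of positive measure.

  The manifolds need not be orientable, so parity takes the place of an integral degree.
  \<open>G\<close> is only C^1, which is enough for Sard's theorem in equal dimensions and for the
  integral identity. The point given by non-degeneracy need not be \<open>y1\<close>: its value may
  be critical at another preimage, and a nearby generic value is used instead.

  The marginals are derived from the plan, not the plan from the marginals. Every competitor then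
  lives on a small product on which \<open>\<phi>\<close> is controlled, so a local comparison of
  \<open>c - \<phi>\<close> is enough. The concave quadratic in \<open>\<phi>\<close> makes up for
  the missing convexity of c in x.\<close>

lemma dir_deriv_eq: "(f has_derivative D) (at x) \<Longrightarrow> dir_deriv f v x = D v"
  by (simp add: dir_deriv_def frechet_derivative_at[symmetric])

lemma differentiable_has_derivative_dir:
  "f differentiable (at x) \<Longrightarrow> (f has_derivative (\<lambda>v. dir_deriv f v x)) (at x)"
  by (simp add: dir_deriv_def frechet_derivative_works[symmetric])

lemma Ck_on_differentiable: "Ck_on (Suc k) S f \<Longrightarrow> x \<in> S \<Longrightarrow> f differentiable (at x)"
  by simp

lemma Ck_on_has_derivative:
  "Ck_on (Suc k) S f \<Longrightarrow> x \<in> S \<Longrightarrow> (f has_derivative (\<lambda>v. dir_deriv f v x)) (at x)"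
  by (simp add: differentiable_has_derivative_dir)

lemma Ck_on_SucI:
  assumes "\<And>x. x \<in> S \<Longrightarrow> (f has_derivative (\<lambda>v. D v x)) (at x)"
    and "\<And>v. Ck_on k S (dir_deriv f v)"
  shows "Ck_on (Suc k) S f"
  using assms by (auto simp: differentiable_def)

text \<open>Openness matters: \<open>dir_deriv\<close> at a point of \<open>S\<close> depends on the
  values in a whole neighbourhood.\<close>

lemma Ck_on_cong:
  assumes "open S" "\<And>x. x \<in> S \<Longrightarrow> f x = g x" "Ck_on k S f"
  shows "Ck_on k S g"
  using assms(2,3)
proof (induction k arbitrary: f g)
  case 0
  then show ?case by (simp cong: continuous_on_cong)
next
  case (Suc k)
  have d: "(g has_derivative (\<lambda>v. dir_deriv f v x)) (at x)" if "x \<in> S" for x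
    using Ck_on_has_derivative[OF Suc.prems(2) that]
    by (rule has_derivative_transform_within_open[OF _ assms(1) that Suc.prems(1)])
  have "Ck_on k S (dir_deriv g v)" for v
    by (rule Suc.IH[where f = "dir_deriv f v"]) (use Suc.prems(2) in \<open>auto simp: dir_deriv_eq[OF d]\<close>)
  with d show ?case by (intro Ck_on_SucI)
qed

text \<open>The working rule of this section: the candidate \<open>D v\<close> need only be right on
  \<open>S\<close>, so product and chain rules can be entered as formulas.\<close>

lemma Ck_on_Suc_derivI:
  assumes "open S" "\<And>x. x \<in> S \<Longrightarrow> (f has_derivative (\<lambda>v. D v x)) (at x)" "\<And>v. Ck_on k S (D v)"
  shows "Ck_on (Suc k) S f"
proof (rule Ck_on_SucI[OF assms(2)])
  show "Ck_on k S (dir_deriv f v)" for v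
    by (rule Ck_on_cong[OF assms(1) _ assms(3)[of v]]) (simp add: dir_deriv_eq[OF assms(2)])
qed

lemma Ck_on_Suc_D: "Ck_on (Suc k) S f \<Longrightarrow> Ck_on k S f"
proof (induction k arbitrary: f)
  case 0
  then show ?case
    by (auto simp: continuous_on_eq_continuous_within differentiable_imp_continuous_within
        intro: continuous_at_imp_continuous_at_within)
next
  case (Suc k)
  then show ?case by (metis Ck_on.simps(2))
qed

lemma Ck_on_le: "Ck_on l S f \<Longrightarrow> k \<le> l \<Longrightarrow> Ck_on k S f"
  by (induction l) (auto simp del: Ck_on.simps simp: le_Suc_eq dest: Ck_on_Suc_D)

lemma Ck_on_continuous_on: "Ck_on k S f \<Longrightarrow> continuous_on S f"
  using Ck_on_le[of k S f 0] by simp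

lemma Ck_on_subset: "Ck_on k S f \<Longrightarrow> T \<subseteq> S \<Longrightarrow> Ck_on k T f"
  by (induction k arbitrary: f) (auto intro: continuous_on_subset)

text \<open>Serves to glue a formula valid in a chart to the zero function off a compact
  support.\<close>

lemma Ck_on_open_Union:
  assumes "open S" "\<And>x. x \<in> S \<Longrightarrow> \<exists>T. open T \<and> x \<in> T \<and> Ck_on k T f"
  shows "Ck_on k S f"
  using assms(2)
proof (induction k arbitrary: f)
  case 0
  then have "continuous (at x) f" if "x \<in> S" for x
    using that by (auto simp: continuous_on_eq_continuous_at dest!: 0)
  then show ?case
    using assms(1) by (simp add: continuous_on_eq_continuous_at)
next
  case (Suc k)
  have "f differentiable (at x)" if "x \<in> S" for x
    using Suc.prems[OF that] by auto
  moreover have "\<exists>T. open T \<and> x \<in> T \<and> Ck_on k T (dir_deriv f v)" if "x \<in> S" for x v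
    using Suc.prems[OF that] by auto
  ultimately show ?case using Suc.IH by simp
qed

section \<open>Closure properties of \<open>Ck_on\<close>\<close>

lemma Ck_on_const: "open S \<Longrightarrow> Ck_on k S (\<lambda>x. c)"
proof (induction k arbitrary: c)
  case (Suc k)
  then show ?case
    by (intro Ck_on_Suc_derivI[where D = "\<lambda>v x. 0"]) auto
qed simp

lemma Ck_on_linear_compose:
  assumes "open S" "bounded_linear L" "Ck_on k S f"
  shows "Ck_on k S (\<lambda>x. L (f x))"
  using assms(3)
proof (induction k arbitrary: f)
  case 0
  then show ?case
    using assms(2) by (simp add: bounded_linear.continuous_on)
next
  case (Suc k)
  show ?case
  proof (rule Ck_on_Suc_derivI[OF assms(1)])
    show "((\<lambda>x. L (f x)) has_derivative (\<lambda>v. L (dir_deriv f v x))) (at x)" if "x \<in> S" for x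
      by (rule bounded_linear.has_derivative[OF assms(2) Ck_on_has_derivative[OF Suc.prems that]])
    show "Ck_on k S (\<lambda>x. L (dir_deriv f v x))" for v
      by (rule Suc.IH) (use Suc.prems in simp)
  qed
qed

lemma Ck_on_id: "open S \<Longrightarrow> Ck_on k S (\<lambda>x. x)"
proof (cases k)
  case (Suc l)
  then show "open S \<Longrightarrow> ?thesis"
    by (auto intro!: Ck_on_Suc_derivI[where D = "\<lambda>v x. v"] Ck_on_const simp del: Ck_on.simps)
qed simp

lemma Ck_on_linear: "open S \<Longrightarrow> bounded_linear L \<Longrightarrow> Ck_on k S L"
  using Ck_on_linear_compose[OF _ _ Ck_on_id, of S L k] by simp

lemma Ck_on_add:
  assumes "open S" "Ck_on k S f" "Ck_on k S g"
  shows "Ck_on k S (\<lambda>x. f x + g x)"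
  using assms(2,3)
proof (induction k arbitrary: f g)
  case 0
  then show ?case by (simp add: continuous_on_add)
next
  case (Suc k)
  show ?case
  proof (rule Ck_on_Suc_derivI[OF assms(1)])
    show "((\<lambda>x. f x + g x) has_derivative (\<lambda>v. dir_deriv f v x + dir_deriv g v x)) (at x)"
      if "x \<in> S" for x
      by (rule has_derivative_add[OF Ck_on_has_derivative[OF Suc.prems(1) that]
            Ck_on_has_derivative[OF Suc.prems(2) that]])
    show "Ck_on k S (\<lambda>x. dir_deriv f v x + dir_deriv g v x)" for v
      by (rule Suc.IH) (use Suc.prems in simp_all)
  qed
qed

lemma Ck_on_diff:
  assumes "open S" "Ck_on k S f" "Ck_on k S g"
  shows "Ck_on k S (\<lambda>x. f x - g x)"
  using Ck_on_add[OF assms(1,2) Ck_on_linear_compose[OF assms(1) bounded_linear_minus[OF bounded_linear_ident] assms(3)]]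
  by simp

lemma Ck_on_sum:
  assumes "open S" "\<And>i. i \<in> I \<Longrightarrow> Ck_on k S (f i)"
  shows "Ck_on k S (\<lambda>x. \<Sum>i\<in>I. f i x)"
  using assms by (induction I rule: infinite_finite_induct) (auto intro: Ck_on_const Ck_on_add)

lemma Ck_on_scaleR:
  assumes "open S" "Ck_on k S f" "Ck_on k S g"
  shows "Ck_on k S (\<lambda>x. f x *\<^sub>R g x)"
  using assms(2,3)
proof (induction k arbitrary: f g)
  case 0
  then show ?case by (simp add: continuous_on_scaleR)
next
  case (Suc k)
  show ?case
  proof (rule Ck_on_Suc_derivI[OF assms(1)])
    show "((\<lambda>x. f x *\<^sub>R g x) has_derivative
        (\<lambda>v. f x *\<^sub>R dir_deriv g v x + dir_deriv f v x *\<^sub>R g x)) (at x)" if "x \<in> S" for x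
      by (rule has_derivative_scaleR[OF Ck_on_has_derivative[OF Suc.prems(1) that]
            Ck_on_has_derivative[OF Suc.prems(2) that]])
    show "Ck_on k S (\<lambda>x. f x *\<^sub>R dir_deriv g v x + dir_deriv f v x *\<^sub>R g x)" for v
      by (rule Ck_on_add[OF assms(1) Suc.IH Suc.IH])
        (use Suc.prems Ck_on_Suc_D[OF Suc.prems(1)] Ck_on_Suc_D[OF Suc.prems(2)] in simp_all)
  qed
qed

lemma Ck_on_mult:
  fixes f g :: "'a::real_normed_vector \<Rightarrow> real"
  assumes "open S" "Ck_on k S f" "Ck_on k S g"
  shows "Ck_on k S (\<lambda>x. f x * g x)"
  using Ck_on_scaleR[OF assms] by simp

text \<open>The direction in which \<open>g\<close> is differentiated varies with \<open>x\<close>.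
  Expanding it in the basis leaves \<open>dir_deriv g b\<close> with a fixed \<open>b\<close>
  composed with \<open>f\<close>, to which the induction hypothesis applies.\<close>

lemma Ck_on_compose:
  fixes f :: "'a::real_normed_vector \<Rightarrow> 'c::euclidean_space"
  assumes "open S" "open T" "Ck_on k S f" "Ck_on k T g" "\<And>x. x \<in> S \<Longrightarrow> f x \<in> T"
  shows "Ck_on k S (\<lambda>x. g (f x))"
  using assms(3,4)
proof (induction k arbitrary: g)
  case 0
  then show ?case using assms(5)
    by (auto intro: continuous_on_compose2)
next
  case (Suc k)
  have d: "((\<lambda>x. g (f x)) has_derivative
        (\<lambda>v. \<Sum>b\<in>Basis. (dir_deriv f v x \<bullet> b) *\<^sub>R dir_deriv g b (f x))) (at x)" if "x \<in> S" for x
  proof -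
    have g: "(g has_derivative (\<lambda>v. dir_deriv g v (f x))) (at (f x))"
      using Suc.prems(2) assms(5)[OF that] by (rule Ck_on_has_derivative)
    then have l: "linear (\<lambda>v. dir_deriv g v (f x))"
      by (rule has_derivative_linear)
    have eq: "dir_deriv g w (f x) = (\<Sum>b\<in>Basis. (w \<bullet> b) *\<^sub>R dir_deriv g b (f x))" for w
      using linear_sum[OF l, of "\<lambda>b. (w \<bullet> b) *\<^sub>R b" Basis] linear_scale[OF l]
      by (simp add: euclidean_representation)
    show ?thesis
      using has_derivative_compose[OF Ck_on_has_derivative[OF Suc.prems(1) that] g]
      by (simp only: eq[symmetric])
  qed
  have "Ck_on k S (\<lambda>x. \<Sum>b\<in>Basis. (dir_deriv f v x \<bullet> b) *\<^sub>R dir_deriv g b (f x))" for v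
    by (rule Ck_on_sum[OF assms(1)], rule Ck_on_scaleR[OF assms(1)],
        rule Ck_on_linear_compose[OF assms(1) bounded_linear_inner_left], use Suc.prems in simp,
        rule Suc.IH[OF Ck_on_Suc_D[OF Suc.prems(1)]], use Suc.prems in simp)
  with d show ?case by (intro Ck_on_Suc_derivI assms(1))
qed

lemma Ck_on_componentwise:
  fixes f :: "'a::real_normed_vector \<Rightarrow> 'c::euclidean_space"
  assumes "open S" "\<And>b. b \<in> Basis \<Longrightarrow> Ck_on k S (\<lambda>x. f x \<bullet> b)"
  shows "Ck_on k S f"
proof -
  have "Ck_on k S (\<lambda>x. \<Sum>b\<in>Basis. (f x \<bullet> b) *\<^sub>R b)"
    by (intro Ck_on_sum Ck_on_linear_compose[OF _ bounded_linear_scaleR_left] assms)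
  then show ?thesis by (simp add: euclidean_representation)
qed

lemma Ck_on_vec:
  fixes f :: "'a::real_normed_vector \<Rightarrow> real^'n"
  assumes "open S" "\<And>i. Ck_on k S (\<lambda>x. f x $ i)"
  shows "Ck_on k S f"
  by (rule Ck_on_componentwise[OF assms(1)]) (use assms(2) in \<open>auto simp: Basis_vec_def inner_axis\<close>)

lemma Ck_on_Pair:
  assumes "open S" "Ck_on k S f" "Ck_on k S g"
  shows "Ck_on k S (\<lambda>x. (f x, g x))"
proof -
  have "bounded_linear (\<lambda>x::'b. (x, 0::'c))" "bounded_linear (\<lambda>x::'c. (0::'b, x))"
    by (auto intro: bounded_linear_Pair bounded_linear_ident bounded_linear_zero)
  from Ck_on_add[OF assms(1) Ck_on_linear_compose[OF assms(1) this(1) assms(2)]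
      Ck_on_linear_compose[OF assms(1) this(2) assms(3)]]
  show ?thesis by simp
qed

lemma dir_deriv_linear_compose:
  assumes "f differentiable (at x)" "bounded_linear L"
  shows "dir_deriv (\<lambda>x. L (f x)) v x = L (dir_deriv f v x)"
  by (rule dir_deriv_eq)
    (rule bounded_linear.has_derivative[OF assms(2) differentiable_has_derivative_dir[OF assms(1)]])

text \<open>The mean value inequality for \<open>f\<close> minus its linearisation at
  \<open>z\<close>, whose derivative is small near \<open>z\<close> by continuity of the partials.
  Both points may move, which differentiability at \<open>z\<close> alone does not give; local
  injectivity and the contact estimates rest on this.\<close>

lemma Ck_on_strict_derivative:
  fixes f :: "'a::euclidean_space \<Rightarrow> 'b::real_normed_vector"
  assumes "open S" "Ck_on (Suc 0) S f" "z \<in> S" "0 < e"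
  obtains d where "0 < d" "ball z d \<subseteq> S"
    "\<And>x y. x \<in> ball z d \<Longrightarrow> y \<in> ball z d \<Longrightarrow>
       norm (f x - f y - dir_deriv f (x - y) z) \<le> e * norm (x - y)"
proof -
  \<comment> \<open>Each of the \<open>DIM('a)\<close> coordinates of a direction is at most its
    norm, so these shares add up to \<open>e\<close>.\<close>
  let ?e = "e / DIM('a)"
  have cont: "continuous (at z) (dir_deriv f b)" for b
    using assms by (auto simp: continuous_on_eq_continuous_at)
  have "\<exists>d>0. \<forall>x. dist x z < d \<longrightarrow> norm (dir_deriv f b x - dir_deriv f b z) < ?e" for b
    using cont[of b] \<open>0 < e\<close> unfolding continuous_at_eps_delta dist_norm by simp
  then obtain \<delta> where \<delta>: "\<And>b. 0 < \<delta> b"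
      "\<And>b x. dist x z < \<delta> b \<Longrightarrow> norm (dir_deriv f b x - dir_deriv f b z) < ?e"
    by metis
  obtain d0 where d0: "0 < d0" "ball z d0 \<subseteq> S"
    using assms openE by blast
  define d where "d = Min (insert d0 (\<delta> ` Basis))"
  have d: "0 < d" "d \<le> d0" "\<And>b. b \<in> Basis \<Longrightarrow> d \<le> \<delta> b"
    using d0 \<delta>(1) by (auto simp: d_def intro: min.coboundedI2)
  have sub: "ball z d \<subseteq> S"
    using d0(2) d(2) by force
  have lin: "linear (\<lambda>v. dir_deriv f v x)" if "x \<in> S" for x
    using Ck_on_has_derivative[OF assms(2) that] by (rule has_derivative_linear)
  have bound: "norm (dir_deriv f v x - dir_deriv f v z) \<le> e * norm v" if "x \<in> ball z d" for x v
  proof -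
    have l: "linear (\<lambda>v. dir_deriv f v x - dir_deriv f v z)"
      using that sub assms(3) by (intro linear_compose_sub lin) auto
    have "dir_deriv f v x - dir_deriv f v z =
        (\<lambda>v. dir_deriv f v x - dir_deriv f v z) (\<Sum>b\<in>Basis. (v \<bullet> b) *\<^sub>R b)"
      by (simp add: euclidean_representation)
    also have "\<dots> = (\<Sum>b\<in>Basis. (v \<bullet> b) *\<^sub>R (dir_deriv f b x - dir_deriv f b z))"
      by (subst linear_sum[OF l]) (simp add: linear_scale[OF l])
    also have "norm \<dots> \<le> (\<Sum>b\<in>(Basis::'a set). norm v * ?e)"
    proof (rule sum_norm_le)
      fix b :: 'a assume b: "b \<in> Basis"
      have "dist x z < \<delta> b"
        using that d(3)[OF b] by (simp add: dist_commute)
      then have "norm (dir_deriv f b x - dir_deriv f b z) \<le> ?e"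
        using \<delta>(2) by (simp add: less_imp_le)
      then show "norm ((v \<bullet> b) *\<^sub>R (dir_deriv f b x - dir_deriv f b z)) \<le> norm v * ?e"
        unfolding norm_scaleR by (intro mult_mono) (use Basis_le_norm[OF b, of v] in auto)
    qed
    also have "\<dots> = e * norm v" by simp
    finally show ?thesis .
  qed
  show ?thesis
  proof (rule that[OF d(1) sub])
    fix x y assume xy: "x \<in> ball z d" "y \<in> ball z d"
    let ?g = "\<lambda>x. f x - dir_deriv f x z"
    have linz: "bounded_linear (\<lambda>v. dir_deriv f v z)"
      using Ck_on_has_derivative[OF assms(2,3)] by (rule has_derivative_bounded_linear)
    have "norm (?g x - ?g y) \<le> e * norm (x - y)"
    proof (rule differentiable_bound[OF convex_ball _ _ xy])
      show "(?g has_derivative (\<lambda>v. dir_deriv f v w - dir_deriv f v z)) (at w within ball z d)"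
        if "w \<in> ball z d" for w
        by (rule has_derivative_at_withinI[OF has_derivative_diff[OF
                Ck_on_has_derivative[OF assms(2)] bounded_linear_imp_has_derivative[OF linz]]])
          (use that sub in auto)
      show "onorm (\<lambda>v. dir_deriv f v w - dir_deriv f v z) \<le> e" if "w \<in> ball z d" for w
        by (rule onorm_bound) (use bound[OF that] \<open>0 < e\<close> in auto)
    qed
    moreover have "dir_deriv f (x - y) z = dir_deriv f x z - dir_deriv f y z"
      by (rule linear_diff[OF bounded_linear.linear[OF linz]])
    then have "f x - f y - dir_deriv f (x - y) z = ?g x - ?g y"
      by simp
    ultimately show "norm (f x - f y - dir_deriv f (x - y) z) \<le> e * norm (x - y)"
      by (simp only:)
  qed
qed

section \<open>Symmetry of second derivatives\<close>

lemma dir_deriv_real_line: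
  assumes "f differentiable (at (x + t *\<^sub>R v))"
  shows "((\<lambda>t. f (x + t *\<^sub>R v)) has_real_derivative dir_deriv f v (x + t *\<^sub>R v)) (at t)"
proof -
  let ?D = "\<lambda>w. dir_deriv f w (x + t *\<^sub>R v)"
  have f: "(f has_derivative ?D) (at (x + t *\<^sub>R v))"
    using assms by (rule differentiable_has_derivative_dir)
  have "((\<lambda>t. f (x + t *\<^sub>R v)) has_derivative (\<lambda>s. ?D (s *\<^sub>R v))) (at t)"
    by (rule has_derivative_compose[where f = "\<lambda>t. x + t *\<^sub>R v" and g = f, OF _ f])
      (auto intro!: derivative_eq_intros)
  moreover have "?D (s *\<^sub>R v) = ?D v * s" for s
    using linear_scale[OF has_derivative_linear[OF f]] by simp
  ultimately show ?thesis
    by (simp add: has_field_derivative_def)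
qed

text \<open>The mean value theorem twice: along \<open>u\<close> for the difference of
  \<open>f\<close> on two parallel segments, then along \<open>v\<close> for
  \<open>dir_deriv f u\<close>.\<close>

lemma dir_deriv_second_difference:
  fixes f :: "'a::euclidean_space \<Rightarrow> real"
  assumes f: "Ck_on (Suc (Suc 0)) (ball x r) f" and "0 < s" "s * (norm u + norm v) < r"
  obtains a b where "0 \<le> a" "a \<le> s" "0 \<le> b" "b \<le> s"
    "f (x + s *\<^sub>R u + s *\<^sub>R v) - f (x + s *\<^sub>R u) - (f (x + s *\<^sub>R v) - f x) =
      s\<^sup>2 * dir_deriv (dir_deriv f u) v (x + a *\<^sub>R u + b *\<^sub>R v)"
proof -
  have mem: "x + a *\<^sub>R u + b *\<^sub>R v \<in> ball x r" if "0 \<le> a" "a \<le> s" "0 \<le> b" "b \<le> s" for a b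
  proof -
    have "norm (a *\<^sub>R u + b *\<^sub>R v) \<le> s * norm u + s * norm v"
      using that by (intro norm_triangle_le add_mono) (auto intro: mult_right_mono)
    also have "\<dots> < r" using assms(3) by (simp add: distrib_left)
    finally have "norm (a *\<^sub>R u + b *\<^sub>R v) < r" .
    moreover have "dist x (x + a *\<^sub>R u + b *\<^sub>R v) = norm (a *\<^sub>R u + b *\<^sub>R v)"
      by (metis add.assoc dist_commute dist_norm add_diff_cancel_left')
    ultimately show ?thesis by simp
  qed
  let ?\<phi> = "\<lambda>a. f (x + s *\<^sub>R v + a *\<^sub>R u) - f (x + a *\<^sub>R u)"
  have "\<exists>a. 0 < a \<and> a < s \<and> ?\<phi> s - ?\<phi> 0 =
      (s - 0) * (dir_deriv f u (x + s *\<^sub>R v + a *\<^sub>R u) - dir_deriv f u (x + a *\<^sub>R u))"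
  proof (rule MVT2[OF assms(2)])
    fix a assume a: "0 \<le> a" "a \<le> s"
    show "(?\<phi> has_real_derivative dir_deriv f u (x + s *\<^sub>R v + a *\<^sub>R u) - dir_deriv f u (x + a *\<^sub>R u)) (at a)"
      using mem[OF a, of s] mem[OF a, of 0] assms(2) f
      by (intro DERIV_diff dir_deriv_real_line Ck_on_differentiable[OF f]) (auto simp: algebra_simps)
  qed
  then obtain a where a: "0 < a" "a < s" "?\<phi> s - ?\<phi> 0 =
      s * (dir_deriv f u (x + s *\<^sub>R v + a *\<^sub>R u) - dir_deriv f u (x + a *\<^sub>R u))"
    by auto
  have "\<exists>b. 0 < b \<and> b < s \<and> dir_deriv f u (x + a *\<^sub>R u + s *\<^sub>R v) - dir_deriv f u (x + a *\<^sub>R u + 0 *\<^sub>R v)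
      = (s - 0) * dir_deriv (dir_deriv f u) v (x + a *\<^sub>R u + b *\<^sub>R v)"
  proof (rule MVT2[OF assms(2)])
    fix b assume b: "0 \<le> b" "b \<le> s"
    have "Ck_on (Suc 0) (ball x r) (dir_deriv f u)"
      using f by (metis Ck_on.simps(2))
    then show "((\<lambda>b. dir_deriv f u (x + a *\<^sub>R u + b *\<^sub>R v)) has_real_derivative
        dir_deriv (dir_deriv f u) v (x + a *\<^sub>R u + b *\<^sub>R v)) (at b)"
      by (rule dir_deriv_real_line[OF Ck_on_differentiable]) (use a b mem[of a b] in simp)
  qed
  then obtain b where b: "0 < b" "b < s"
      "dir_deriv f u (x + a *\<^sub>R u + s *\<^sub>R v) - dir_deriv f u (x + a *\<^sub>R u)
      = s * dir_deriv (dir_deriv f u) v (x + a *\<^sub>R u + b *\<^sub>R v)"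
    by auto
  have "?\<phi> s - ?\<phi> 0 = s * (s * dir_deriv (dir_deriv f u) v (x + a *\<^sub>R u + b *\<^sub>R v))"
    unfolding a(3) b(3)[symmetric] by (simp add: algebra_simps)
  then show ?thesis
    using a b by (intro that[of a b]) (auto simp: power2_eq_square algebra_simps)
qed

text \<open>The second difference over a parallelogram is symmetric in \<open>u\<close> and
  \<open>v\<close>, so the two mixed derivatives agree at two points close to \<open>x\<close>;
  continuity does the rest. Needed because \<open>mixed_partials\<close> differentiates in the
  second variable first, whereas the Jacobian of the gradient map takes that derivative
  last.\<close>

lemma dir_deriv_commute:
  fixes f :: "'a::euclidean_space \<Rightarrow> real"
  assumes "open S" "Ck_on (Suc (Suc 0)) S f" "x \<in> S"
  shows "dir_deriv (dir_deriv f u) v x = dir_deriv (dir_deriv f v) u x"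
proof (rule ccontr)
  let ?p = "dir_deriv (dir_deriv f u) v" and ?q = "dir_deriv (dir_deriv f v) u"
  assume "?p x \<noteq> ?q x"
  then have e: "0 < \<bar>?p x - ?q x\<bar> / 2" (is "0 < ?e") by simp
  obtain r where r: "0 < r" "ball x r \<subseteq> S"
    using assms openE by blast
  have "continuous (at x) ?p" "continuous (at x) ?q"
    using assms by (auto simp: continuous_on_eq_continuous_at)
  then obtain d1 d2 where d: "0 < d1" "0 < d2"
    "\<And>y. dist y x < d1 \<Longrightarrow> \<bar>?p y - ?p x\<bar> < ?e" "\<And>y. dist y x < d2 \<Longrightarrow> \<bar>?q y - ?q x\<bar> < ?e"
    unfolding continuous_at_eps_delta dist_real_def using e by metis
  define R where "R = min r (min d1 d2)"
  \<comment> \<open>The parallelogram must fit into the ball of radius \<open>R\<close>; the added 1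
    keeps the denominator positive when \<open>u = v = 0\<close>.\<close>
  define s where "s = R / (2 * (norm u + norm v + 1))"
  have R: "0 < R" using r d by (simp add: R_def)
  have nn: "0 < 2 * (norm u + norm v + 1)"
    by (simp add: add_nonneg_pos)
  have s: "0 < s"
    unfolding s_def using R nn by (rule divide_pos_pos)
  have "s * (2 * (norm u + norm v + 1)) = R"
    unfolding s_def using nn by simp
  then have sR: "s * (norm u + norm v) < R"
    using s mult_nonneg_nonneg[OF less_imp_le[OF s] norm_ge_zero[of u]]
      mult_nonneg_nonneg[OF less_imp_le[OF s] norm_ge_zero[of v]]
    unfolding distrib_left mult.left_commute[of s 2] by linarith
  have f: "Ck_on (Suc (Suc 0)) (ball x R) f"
    by (rule Ck_on_subset[OF assms(2)]) (use r in \<open>auto simp: R_def\<close>)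
  obtain a b where ab: "0 \<le> a" "a \<le> s" "0 \<le> b" "b \<le> s"
    "f (x + s *\<^sub>R u + s *\<^sub>R v) - f (x + s *\<^sub>R u) - (f (x + s *\<^sub>R v) - f x) =
      s\<^sup>2 * ?p (x + a *\<^sub>R u + b *\<^sub>R v)"
    by (rule dir_deriv_second_difference[OF f s sR])
  obtain a' b' where ab': "0 \<le> a'" "a' \<le> s" "0 \<le> b'" "b' \<le> s"
    "f (x + s *\<^sub>R v + s *\<^sub>R u) - f (x + s *\<^sub>R v) - (f (x + s *\<^sub>R u) - f x) =
      s\<^sup>2 * ?q (x + a' *\<^sub>R v + b' *\<^sub>R u)"
    by (rule dir_deriv_second_difference[OF f s, of v u]) (use sR in \<open>simp add: add.commute\<close>)
  have "x + s *\<^sub>R v + s *\<^sub>R u = x + s *\<^sub>R u + s *\<^sub>R v" by simp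
  then have "s\<^sup>2 * ?p (x + a *\<^sub>R u + b *\<^sub>R v) = s\<^sup>2 * ?q (x + a' *\<^sub>R v + b' *\<^sub>R u)"
    using ab(5) ab'(5) by (simp add: algebra_simps)
  then have eq: "?p (x + a *\<^sub>R u + b *\<^sub>R v) = ?q (x + a' *\<^sub>R v + b' *\<^sub>R u)"
    using s by simp
  have near: "dist (x + a *\<^sub>R w + b *\<^sub>R w') x < R"
    if "0 \<le> a" "a \<le> s" "0 \<le> b" "b \<le> s" "norm w + norm w' = norm u + norm v" for a b w w'
  proof -
    have "norm (a *\<^sub>R w + b *\<^sub>R w') \<le> s * norm w + s * norm w'"
      using that by (intro norm_triangle_le add_mono) (auto intro: mult_right_mono)
    also have "\<dots> = s * (norm u + norm v)" using that(5) by (metis distrib_left)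
    finally have "norm (a *\<^sub>R w + b *\<^sub>R w') < R" using sR by simp
    then show ?thesis by (metis add.assoc dist_norm add_diff_cancel_left')
  qed
  have "\<bar>?p (x + a *\<^sub>R u + b *\<^sub>R v) - ?p x\<bar> < ?e"
    by (rule d(3)) (use near[OF ab(1-4), of u v] in \<open>simp add: R_def\<close>)
  moreover have "\<bar>?q (x + a' *\<^sub>R v + b' *\<^sub>R u) - ?q x\<bar> < ?e"
    by (rule d(4)) (use near[OF ab'(1-4), of v u] in \<open>simp add: R_def\<close>)
  ultimately show False
    using eq e by (smt (verit) field_sum_of_halves)
qed

section \<open>Bump functions\<close>

lemma DERIV_max_power:
  "((\<lambda>t::real. (max 0 t) ^ Suc (Suc n)) has_real_derivative real (Suc (Suc n)) * (max 0 t) ^ Suc n) (at t)"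
proof -
  consider "t < 0" | "0 < t" | "t = 0" by linarith
  then show ?thesis
  proof cases
    case 1
    have "((\<lambda>t::real. 0) has_real_derivative 0) (at t)" by simp
    then have "((\<lambda>t::real. (max 0 t) ^ Suc (Suc n)) has_real_derivative 0) (at t)"
      by (rule has_field_derivative_transform_within_open[where S = "{..<0}"]) (use 1 in \<open>auto simp: max_def\<close>)
    then show ?thesis using 1 by (simp add: max_def)
  next
    case 2
    have "((\<lambda>t::real. t ^ Suc (Suc n)) has_real_derivative real (Suc (Suc n)) * t ^ Suc n) (at t)"
      by (auto intro!: derivative_eq_intros simp del: power_Suc)
    then have "((\<lambda>t::real. (max 0 t) ^ Suc (Suc n)) has_real_derivative real (Suc (Suc n)) * t ^ Suc n) (at t)"
      by (rule has_field_derivative_transform_within_open[where S = "{0<..}"]) (use 2 in \<open>auto simp: max_def\<close>)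
    then show ?thesis using 2 by (simp add: max_def)
  next
    case 3
    have "((\<lambda>h::real. (max 0 h) ^ Suc n) \<longlongrightarrow> (max 0 0) ^ Suc n) (at 0)"
      by (intro tendsto_intros)
    then have "((\<lambda>h::real. (max 0 h) ^ Suc n) \<longlongrightarrow> 0) (at 0)" by simp
    moreover have "(max 0 h) ^ Suc (Suc n) / h = (max 0 h) ^ Suc n" for h :: real
      by (cases "h \<le> 0") (auto simp: max_def)
    ultimately show ?thesis
      using 3 unfolding DERIV_def by simp
  qed
qed

text \<open>Costs are only C^2, so cutoffs built from truncated cubes are smooth enough.\<close>

lemma Ck_on_max_cube: "Ck_on (Suc (Suc 0)) UNIV (\<lambda>t::real. (max 0 t) ^ 3)"
proof -
  have D: "((\<lambda>t::real. (max 0 t) ^ Suc (Suc n)) has_derivative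
      (\<lambda>v. v * (real (Suc (Suc n)) * (max 0 t) ^ Suc n))) (at t)" for n t
    using DERIV_max_power[of n t] unfolding has_field_derivative_def
    by (rule has_derivative_eq_rhs) (simp add: fun_eq_iff)
  have "Ck_on (Suc 0) UNIV (\<lambda>t::real. (max 0 t) ^ Suc (Suc 0))"
    by (rule Ck_on_Suc_derivI[OF open_UNIV D]) (auto intro!: continuous_intros)
  then have "Ck_on (Suc (Suc 0)) UNIV (\<lambda>t::real. (max 0 t) ^ Suc (Suc (Suc 0)))"
    by (intro Ck_on_Suc_derivI[where k = "Suc 0", OF open_UNIV D] Ck_on_mult Ck_on_const open_UNIV)
  then show ?thesis by (simp add: numeral_3_eq_3)
qed

lemma bump_function:
  fixes a :: "'a::euclidean_space"
  assumes "0 < r" "r < R"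
  obtains \<beta> :: "'a \<Rightarrow> real" where "Ck_on (Suc (Suc 0)) UNIV \<beta>"
    "\<And>x. x \<in> cball a r \<Longrightarrow> \<beta> x = 1" "\<And>x. x \<notin> ball a R \<Longrightarrow> \<beta> x = 0"
proof -
  let ?P = "\<lambda>t::real. (max 0 t) ^ 3"
  let ?m = "1 / ?P (R\<^sup>2 - r\<^sup>2)"
  \<comment> \<open>The inner term \<open>?m * ?P (...)\<close> is at least 1 on
    \<open>cball a r\<close>, by the choice of \<open>?m\<close>, and vanishes off
    \<open>ball a R\<close>. The outer \<open>1 - ?P (1 - s)\<close> sends 0 to 0 and every
    \<open>s \<ge> 1\<close> to 1, which flattens the top.\<close>
  let ?\<beta> = "\<lambda>x. 1 - ?P (1 - ?m * ?P (R\<^sup>2 - (\<Sum>b\<in>Basis. ((x - a) \<bullet> b) * ((x - a) \<bullet> b))))"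
  have sq: "(\<Sum>b\<in>Basis. ((x - a) \<bullet> b) * ((x - a) \<bullet> b)) = (dist a x)\<^sup>2" for x
    by (simp add: dist_norm norm_minus_commute[of a] power2_norm_eq_inner euclidean_inner[of "x - a" "x - a", symmetric])
  have lt: "r\<^sup>2 < R\<^sup>2" using assms by (simp add: power_strict_mono)
  show ?thesis
  proof (rule that[of ?\<beta>])
    have P: "Ck_on (Suc (Suc 0)) UNIV (\<lambda>x. ?P (f x))"
      if "Ck_on (Suc (Suc 0)) UNIV f" for f :: "'a \<Rightarrow> real"
      by (rule Ck_on_compose[OF open_UNIV open_UNIV that Ck_on_max_cube]) simp
    show "Ck_on (Suc (Suc 0)) UNIV ?\<beta>"
      by (intro Ck_on_diff Ck_on_mult Ck_on_const Ck_on_sum open_UNIV P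
          Ck_on_linear_compose[OF open_UNIV bounded_linear_inner_left] Ck_on_id)
    show "?\<beta> x = 1" if "x \<in> cball a r" for x
    proof -
      have "(dist a x)\<^sup>2 \<le> r\<^sup>2" using that by (intro power_mono) auto
      then have "?P (R\<^sup>2 - r\<^sup>2) \<le> ?P (R\<^sup>2 - (dist a x)\<^sup>2)"
        by (intro power_mono) auto
      moreover have "0 < ?P (R\<^sup>2 - r\<^sup>2)" using lt by simp
      ultimately have "1 \<le> ?m * ?P (R\<^sup>2 - (dist a x)\<^sup>2)"
        by (simp add: field_simps)
      then show ?thesis unfolding sq by simp
    qed
    show "?\<beta> x = 0" if "x \<notin> ball a R" for x
    proof -
      have "R\<^sup>2 \<le> (dist a x)\<^sup>2" using that assms by (intro power_mono) auto
      then show ?thesis unfolding sq by simp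
    qed
  qed
qed

section \<open>The integral of a Jacobian determinant\<close>

definition jacobian :: "(real^'n \<Rightarrow> real^'n) \<Rightarrow> real^'n \<Rightarrow> real^'n^'n"
  where "jacobian f x = matrix (\<lambda>v. dir_deriv f v x)"

lemma jacobian_component: "jacobian f x $ i $ j = dir_deriv f (axis j 1) x $ i"
  by (simp add: jacobian_def matrix_def)

lemma jacobian_has_derivative:
  "f differentiable (at x) \<Longrightarrow> (f has_derivative (\<lambda>v. jacobian f x *v v)) (at x)"
  using differentiable_has_derivative_dir[of f x] has_derivative_linear
  by (fastforce simp: jacobian_def matrix_works)

lemma jacobian_eq: "(f has_derivative D) (at x) \<Longrightarrow> jacobian f x = matrix D"
  using dir_deriv_eq[of f D x] by (simp add: jacobian_def)

lemma jacobian_compose: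
  assumes "f differentiable (at x)" "g differentiable (at (f x))"
  shows "jacobian (\<lambda>x. g (f x)) x = jacobian g (f x) ** jacobian f x"
  using has_derivative_compose[OF jacobian_has_derivative[OF assms(1)] jacobian_has_derivative[OF assms(2)]]
  by (simp add: jacobian_eq matrix_vector_mul_assoc)

section \<open>Determinants depending on a parameter\<close>

lemma Ck_on_continuous_jacobian_component:
  "Ck_on (Suc 0) S f \<Longrightarrow> continuous_on S (\<lambda>x. jacobian f x $ i $ j)"
  unfolding jacobian_component by (intro continuous_on_component) simp

lemma continuous_on_det:
  fixes A :: "'a::topological_space \<Rightarrow> real^'n^'n"
  assumes "\<And>i j. continuous_on S (\<lambda>x. A x $ i $ j)"
  shows "continuous_on S (\<lambda>x. det (A x))"
  unfolding det_def by (intro continuous_intros assms)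

text \<open>\<open>S\<close> collects the rows taken from \<open>t A\<close>; the other rows come
  from the identity. The coefficient of \<open>t ^ card S\<close> is a polynomial in the entries of
  \<open>A\<close>, so it can be integrated when \<open>A\<close> is a Jacobian; for
  \<open>S = UNIV\<close> it is \<open>det A\<close>.\<close>

lemma det_one_plus_scaled:
  fixes A :: "real^'n^'n"
  shows "det (mat 1 + t *\<^sub>R A) = (\<Sum>S\<in>UNIV. t ^ card S *
    (\<Sum>p | p permutes UNIV. of_int (sign p) * ((\<Prod>i\<in>-S. mat 1 $ i $ p i) * (\<Prod>i\<in>S. A $ i $ p i))))"
proof -
  have "(\<Prod>i\<in>UNIV. (mat 1 + t *\<^sub>R A) $ i $ p i) =
     (\<Sum>S\<in>UNIV. t ^ card S * ((\<Prod>i\<in>-S. (mat 1 :: real^'n^'n) $ i $ p i) * (\<Prod>i\<in>S. A $ i $ p i)))" for p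
  proof -
    have "(\<Prod>i\<in>UNIV. t * A $ i $ p i + (mat 1 :: real^'n^'n) $ i $ p i) =
      (\<Sum>S\<in>Pow UNIV. (\<Prod>i\<in>S. t * A $ i $ p i) * (\<Prod>i\<in>UNIV - S. (mat 1 :: real^'n^'n) $ i $ p i))"
      by (rule prod_add) simp
    then show ?thesis
      by (simp add: prod.distrib Compl_eq_Diff_UNIV[symmetric] add.commute mult_ac)
  qed
  then have "det (mat 1 + t *\<^sub>R A) = (\<Sum>p | p permutes UNIV. \<Sum>S\<in>UNIV. t ^ card S *
     (of_int (sign p) * ((\<Prod>i\<in>-S. mat 1 $ i $ p i) * (\<Prod>i\<in>S. A $ i $ p i))))"
    unfolding det_def by (simp add: sum_distrib_left mult_ac)
  also have "\<dots> = (\<Sum>S\<in>UNIV. \<Sum>p | p permutes UNIV. t ^ card S *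
     (of_int (sign p) * ((\<Prod>i\<in>-S. mat 1 $ i $ p i) * (\<Prod>i\<in>S. A $ i $ p i))))"
    by (rule sum.swap)
  finally show ?thesis
    by (simp add: sum_distrib_left)
qed

text \<open>Brings the expansion into the form in which one non-zero coefficient forces finitely
  many roots.\<close>

lemma sum_power_card:
  fixes c :: "'n::finite set \<Rightarrow> real"
  shows "(\<Sum>S\<in>UNIV. t ^ card S * c S) = (\<Sum>k\<le>CARD('n). (\<Sum>S | card S = k. c S) * t ^ k)"
proof -
  have "(\<Sum>S\<in>UNIV. t ^ card S * c S) = (\<Sum>k\<le>CARD('n). \<Sum>S | S \<in> UNIV \<and> card S = k. t ^ card S * c S)"
    by (rule sum.group[symmetric]) (auto intro: card_mono)
  also have "\<dots> = (\<Sum>k\<le>CARD('n). (\<Sum>S | card S = k. c S) * t ^ k)"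
    by (auto simp: sum_distrib_left mult.commute intro!: sum.cong)
  finally show ?thesis .
qed

text \<open>Off the closed ball \<open>g\<close> vanishes on an open set, so its partials are zero
  there; on the ball they are bounded by compactness.\<close>

lemma compact_support_derivative_bound:
  fixes g :: "'a::euclidean_space \<Rightarrow> 'b::real_normed_vector"
  assumes g: "Ck_on (Suc 0) UNIV g" and supp: "\<And>x. x \<notin> cball 0 R \<Longrightarrow> g x = 0"
  obtains C where "0 < C" "\<And>x v. norm (dir_deriv g v x) \<le> C * norm v"
    "\<And>x y. norm (g x - g y) \<le> C * norm (x - y)"
proof -
  have zero: "dir_deriv g v x = 0" if "x \<notin> cball 0 R" for x v
  proof (rule dir_deriv_eq)
    have "((\<lambda>x. 0) has_derivative (\<lambda>v. 0)) (at x)" by simp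
    then show "(g has_derivative (\<lambda>v. 0)) (at x)"
      by (rule has_derivative_transform_within_open[OF _ open_Compl[OF closed_cball[of 0 R]]])
        (use that supp in auto)
  qed
  have "\<exists>K>0. \<forall>x. norm (dir_deriv g b x) \<le> K" for b
  proof -
    have "continuous_on (cball 0 R) (dir_deriv g b)"
      using g by (auto intro: continuous_on_subset)
    then have "bounded (dir_deriv g b ` cball 0 R)"
      by (intro compact_imp_bounded compact_continuous_image) auto
    then obtain K where "0 < K" "\<And>x. x \<in> cball 0 R \<Longrightarrow> norm (dir_deriv g b x) \<le> K"
      unfolding bounded_pos by auto
    then show ?thesis using zero by (metis less_imp_le norm_zero)
  qed
  then obtain K where K: "\<And>b. 0 < K b" "\<And>b x. norm (dir_deriv g b x) \<le> K b" by metis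
  define C where "C = (\<Sum>b\<in>(Basis::'a set). K b)"
  have C: "0 < C" unfolding C_def by (rule sum_pos) (auto simp: K)
  have D: "(g has_derivative (\<lambda>v. dir_deriv g v x)) (at x)" for x
    using Ck_on_has_derivative[OF g] by simp
  have bound: "norm (dir_deriv g v x) \<le> C * norm v" for x v
  proof -
    note l = has_derivative_linear[OF D[of x]]
    have "dir_deriv g v x = (\<Sum>b\<in>Basis. (v \<bullet> b) *\<^sub>R dir_deriv g b x)"
      using linear_sum[OF l, of "\<lambda>b. (v \<bullet> b) *\<^sub>R b" Basis] linear_scale[OF l]
      by (simp add: euclidean_representation)
    also have "norm \<dots> \<le> (\<Sum>b\<in>(Basis::'a set). norm v * K b)"
      by (rule sum_norm_le, unfold norm_scaleR, rule mult_mono)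
        (auto simp: K Basis_le_norm)
    also have "\<dots> = C * norm v" by (simp add: C_def sum_distrib_left mult.commute)
    finally show ?thesis .
  qed
  show ?thesis
  proof (rule that[OF C bound])
    fix x y :: 'a
    show "norm (g x - g y) \<le> C * norm (x - y)"
      by (rule differentiable_bound[where S = UNIV, OF _ D])
        (use C bound in \<open>auto intro!: onorm_bound\<close>)
  qed
qed

lemma perturbed_identity_bij:
  fixes g :: "'a::{real_normed_vector,complete_space} \<Rightarrow> 'a"
  assumes lip: "\<And>x y. norm (g x - g y) \<le> c * norm (x - y)" and c: "c < 1"
  shows "bij (\<lambda>x. x + g x)"
proof (rule bijI)
  have c0: "0 \<le> c" if "x \<noteq> y" for x y :: 'a
    using order_trans[OF norm_ge_zero lip[of x y]] that by (simp add: zero_le_mult_iff)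
  show "inj (\<lambda>x. x + g x)"
  proof (rule injI, rule ccontr)
    fix x y assume eq: "x + g x = y + g y" and "x \<noteq> y"
    have "x - y = - (g x - g y)"
      using eq by (simp add: algebra_simps)
    then have "norm (x - y) \<le> c * norm (x - y)"
      using lip[of x y] by (metis norm_minus_cancel)
    then show False using c \<open>x \<noteq> y\<close> by simp
  qed
  show "surj (\<lambda>x. x + g x)"
  proof (unfold surj_def, rule allI)
    fix y
    show "\<exists>x. y = x + g x"
    \<comment> \<open>On a one-point space \<open>c\<close> may be negative, while Banach's theorem
      asks for \<open>0 \<le> c\<close>; two distinct points exclude this.\<close>
    proof (cases "\<exists>a b::'a. a \<noteq> b")
      case True
      then have "0 \<le> c" using c0 by blast
      moreover have "dist (y - g a) (y - g b) \<le> c * dist a b" for a b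
        using lip[of b a] by (simp add: dist_norm norm_minus_commute)
      ultimately have "\<exists>!x. y - g x = x"
        by (intro banach_fix_type[of c]) (use c in auto)
      then show ?thesis by (metis diff_add_cancel)
    next
      case False
      then show ?thesis by blast
    qed
  qed
qed

text \<open>A kernel vector of \<open>mat 1 + s *\<^sub>R A\<close> with \<open>0 \<le> s\<close>
  and \<open>s \<le> t\<close> would be shorter than itself, so the determinant cannot vanish on the
  way from its value 1 at \<open>s = 0\<close>.\<close>

lemma det_one_plus_scaled_pos:
  fixes A :: "real^'n^'n"
  assumes "\<And>v. norm (A *v v) \<le> C * norm v" "0 \<le> t" "t * C < 1" "0 < C"
  shows "0 < det (mat 1 + t *\<^sub>R A)"
proof (rule ccontr)
  assume "\<not> 0 < det (mat 1 + t *\<^sub>R A)"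
  moreover have "continuous_on {0..t} (\<lambda>s. det (mat 1 + s *\<^sub>R A))"
    by (rule continuous_on_det) (auto intro!: continuous_intros)
  ultimately obtain s where s: "0 \<le> s" "s \<le> t" "det (mat 1 + s *\<^sub>R A) = 0"
    using IVT2'[of "\<lambda>s. det (mat 1 + s *\<^sub>R A)" t 0 0] assms(2) by (auto simp: det_I)
  then obtain v where v: "v \<noteq> 0" "(mat 1 + s *\<^sub>R A) *v v = 0"
    by (metis invertible_det_nz invertible_left_inverse matrix_left_invertible_ker)
  then have "v + s *\<^sub>R (A *v v) = 0"
    by (simp add: matrix_vector_mult_add_rdistrib scaleR_matrix_vector_assoc)
  then have "v = - (s *\<^sub>R (A *v v))" by (simp add: eq_neg_iff_add_eq_0)
  then have "norm v = s * norm (A *v v)"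
    using s by (metis abs_of_nonneg norm_minus_cancel norm_scaleR)
  also have "\<dots> \<le> s * (C * norm v)" using assms(1) s by (intro mult_left_mono) auto
  also have "\<dots> \<le> t * (C * norm v)" using s assms(4) by (intro mult_right_mono) auto
  also have "\<dots> < 1 * norm v" unfolding mult.assoc[symmetric]
    using assms(3) v by (intro mult_strict_right_mono) auto
  finally show False by simp
qed

text \<open>For small \<open>t\<close> the map \<open>x \<mapsto> x + t g(x)\<close> permutes the ball, so the polynomial
  \<open>\<integral> det (I + t Dg)\<close> is constant near \<open>t = 0\<close>; its leading coefficient is \<open>\<integral> det Dg\<close>.\<close>

lemma integral_det_jacobian_compact_support:
  fixes g :: "real^'n::{finite,wellorder} \<Rightarrow> real^'n::_"
  assumes g: "Ck_on (Suc 0) UNIV g" and supp: "\<And>x. x \<notin> cball 0 R \<Longrightarrow> g x = 0"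
  shows "((\<lambda>x. det (jacobian g x)) has_integral 0) (cball 0 R)"
proof -
  let ?B = "cball (0::real^'n::_) R"
  obtain C where C: "0 < C" "\<And>x v. norm (dir_deriv g v x) \<le> C * norm v"
    "\<And>x y. norm (g x - g y) \<le> C * norm (x - y)"
    using compact_support_derivative_bound[OF g supp] by metis
  have D: "(g has_derivative (\<lambda>v. jacobian g x *v v)) (at x)" for x
    using g by (intro jacobian_has_derivative) simp
  have JC: "norm (jacobian g x *v v) \<le> C * norm v" for x v
    using C(2)[of v x] dir_deriv_eq[OF D[of x]] by simp
  define m where "m S A = (\<Sum>p | p permutes UNIV. of_int (sign p) *
      ((\<Prod>i\<in>-S. (mat 1 :: real^'n::_^'n::_) $ i $ p i) * (\<Prod>i\<in>S. A $ i $ p i)))"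
    for S :: "'n set" and A :: "real^'n::_^'n::_"
  have det: "det (mat 1 + t *\<^sub>R A) = (\<Sum>S\<in>UNIV. t ^ card S * m S A)" for t A
    unfolding m_def by (rule det_one_plus_scaled)
  have mU: "m UNIV A = det A" for A
    by (simp add: m_def det_def)
  have "continuous_on ?B (\<lambda>x. m S (jacobian g x))" for S
    unfolding m_def
    by (intro continuous_intros continuous_on_subset[OF Ck_on_continuous_jacobian_component[OF g]]) auto
  then have int: "(\<lambda>x. m S (jacobian g x)) integrable_on ?B" for S
    using borel_integrable_compact[of ?B] set_borel_integral_eq_integral(1)
    by (metis set_integrable_def compact_cball)
  define c where "c S = integral ?B (\<lambda>x. m S (jacobian g x))" for S
  have c: "((\<lambda>x. m S (jacobian g x)) has_integral c S) ?B" for S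
    unfolding c_def using int by (rule integrable_integral)
  have poly: "(\<Sum>S\<in>UNIV. t ^ card S * c S) = measure lebesgue ?B" if t: "0 < t" "t * C < 1" for t
  proof -
    let ?h = "\<lambda>x. x + t *\<^sub>R g x"
    have bij: "bij ?h"
    proof (rule perturbed_identity_bij)
      show "norm (t *\<^sub>R g x - t *\<^sub>R g y) \<le> (t * C) * norm (x - y)" for x y
        using mult_left_mono[OF C(3)[of x y], of t] t
        by (simp add: scaleR_diff_right[symmetric] mult.assoc)
    qed (use t in simp)
    have out: "?h x = x" if "x \<notin> ?B" for x using supp[OF that] by simp
    \<comment> \<open>\<open>?h\<close> is a bijection and fixes every point off the ball, so the
      ball is mapped onto itself.\<close>
    have image: "?h ` ?B = ?B"
    proof -
      have "?h ` (- ?B) = - ?B" using out by (force simp: image_iff)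
      moreover have "?h ` ?B = UNIV - ?h ` (- ?B)"
        using bij image_set_diff[of ?h UNIV "- ?B"] unfolding bij_def by (simp add: double_diff)
      ultimately show ?thesis by simp
    qed
    have "(?h has_derivative (\<lambda>v. (mat 1 + t *\<^sub>R jacobian g x) *v v)) (at x within ?B)" for x
      using has_derivative_at_withinI[OF has_derivative_add[OF has_derivative_ident has_derivative_scaleR_right[OF D[of x], of t]]]
      by (simp add: matrix_vector_mult_add_rdistrib scaleR_matrix_vector_assoc)
    then have "(?h ` ?B \<in> lmeasurable \<and> measure lebesgue (?h ` ?B) = measure lebesgue ?B) \<longleftrightarrow>
        ((\<lambda>x. \<bar>det (matrix (\<lambda>v. (mat 1 + t *\<^sub>R jacobian g x) *v v))\<bar>) has_integral measure lebesgue ?B) ?B"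
      by (intro has_measure_differentiable_image) (use bij in \<open>auto simp: bij_def intro: inj_on_subset\<close>)
    then have "((\<lambda>x. \<bar>det (mat 1 + t *\<^sub>R jacobian g x)\<bar>) has_integral measure lebesgue ?B) ?B"
      by (simp add: image)
    \<comment> \<open>Here \<open>t\<close> must be small: once the absolute value is gone, the
      integrand is a polynomial in \<open>t\<close>.\<close>
    moreover have "0 < det (mat 1 + t *\<^sub>R jacobian g x)" for x
      by (rule det_one_plus_scaled_pos[OF JC]) (use t C in auto)
    ultimately have "((\<lambda>x. det (mat 1 + t *\<^sub>R jacobian g x)) has_integral measure lebesgue ?B) ?B"
      by (simp add: abs_of_pos)
    moreover have "((\<lambda>x. det (mat 1 + t *\<^sub>R jacobian g x)) has_integral (\<Sum>S\<in>UNIV. t ^ card S * c S)) ?B"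
      unfolding det by (intro has_integral_sum has_integral_mult_right c) auto
    ultimately show ?thesis by (rule has_integral_unique[rotated])
  qed
  \<comment> \<open>The coefficients of the polynomial minus the volume of the ball. As
    \<open>CARD('n) > 0\<close>, the subtraction leaves the top one alone, which is
    \<open>c UNIV\<close>, the integral of \<open>det (jacobian g x)\<close>.\<close>
  define e where "e k = (\<Sum>S | card S = k. c S) - (if k = 0 then measure lebesgue ?B else 0)" for k
  let ?n = "CARD('n)"
  have e: "(\<Sum>k\<le>?n. e k * t ^ k) = (\<Sum>S\<in>UNIV. t ^ card S * c S) - measure lebesgue ?B" for t
    unfolding sum_power_card
    by (simp add: e_def left_diff_distrib sum_subtractf if_distrib[of "\<lambda>x. x * _"] cong: if_cong)
  have "e ?n = 0"
  proof (rule ccontr)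
    assume "e ?n \<noteq> 0"
    then have "finite {t. (\<Sum>k\<le>?n. e k * t ^ k) = 0}"
      using Transcendental.polyfun_rootbound[of e ?n ?n] by auto
    moreover have "{0<..<1 / C} \<subseteq> {t. (\<Sum>k\<le>?n. e k * t ^ k) = 0}"
    proof
      fix t assume "t \<in> {0<..<1 / C}"
      then have "0 < t" "t * C < 1" using C(1) by (auto simp: field_simps)
      then show "t \<in> {t. (\<Sum>k\<le>?n. e k * t ^ k) = 0}" by (simp only: mem_Collect_eq e poly)
    qed
    ultimately have "finite {0<..<1 / C}" by (rule finite_subset[rotated])
    then show False using C(1) infinite_Ioo[of 0 "1 / C"] by simp
  qed
  moreover have "{S::'n set. card S = ?n} = {UNIV}"
    using card_subset_eq[of "UNIV::'n set"] by auto
  ultimately have "c UNIV = 0" by (simp add: e_def)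
  then show ?thesis using c[of UNIV] by (simp add: mU)
qed

section \<open>Parity of the fibres of a compactly supported map\<close>

text \<open>The derivative at \<open>z\<close> is bounded below by some \<open>b\<close>, and strict
  differentiability with error \<open>b / 2\<close> leaves half of it. With invariance of domain
  this does the work of the inverse function theorem.\<close>

lemma Ck_on_local_lower_bound:
  fixes f :: "real^'n \<Rightarrow> real^'n"
  assumes "open S" "Ck_on (Suc 0) S f" "z \<in> S" "det (jacobian f z) \<noteq> 0"
  obtains d e where "0 < d" "0 < e" "ball z d \<subseteq> S"
    "\<And>x y. x \<in> ball z d \<Longrightarrow> y \<in> ball z d \<Longrightarrow> e * norm (x - y) \<le> norm (f x - f y)"
proof -
  have D: "(f has_derivative (\<lambda>v. jacobian f z *v v)) (at z)"
    using assms by (intro jacobian_has_derivative) simp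
  have "inj (\<lambda>v. jacobian f z *v v)"
    using assms(4) det_nz_iff_inj[OF has_derivative_linear[OF D]] by simp
  then obtain b where b: "0 < b" "\<And>v. b * norm v \<le> norm (jacobian f z *v v)"
    using linear_inj_bounded_below_pos[OF has_derivative_linear[OF D]] by blast
  then have b2: "0 < b / 2" by simp
  obtain d where d: "0 < d" "ball z d \<subseteq> S"
    "\<And>x y. x \<in> ball z d \<Longrightarrow> y \<in> ball z d \<Longrightarrow>
       norm (f x - f y - dir_deriv f (x - y) z) \<le> b / 2 * norm (x - y)"
    using Ck_on_strict_derivative[OF assms(1-3) b2] by blast
  show ?thesis
  proof (rule that[OF d(1) b2 d(2)])
    fix x y assume xy: "x \<in> ball z d" "y \<in> ball z d"
    have "b * norm (x - y) \<le> norm (dir_deriv f (x - y) z)"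
      using b(2) by (simp add: dir_deriv_eq[OF D])
    also have "\<dots> \<le> norm (f x - f y - dir_deriv f (x - y) z) + norm (f x - f y)"
      using norm_triangle_sub[of "dir_deriv f (x - y) z" "f x - f y"] by (simp add: norm_minus_commute)
    finally show "b / 2 * norm (x - y) \<le> norm (f x - f y)"
      using d(3)[OF xy] by simp
  qed
qed

text \<open>The fibre is closed and, as \<open>p \<noteq> 0\<close>, inside the support ball, hence
  compact; regularity makes its points isolated.\<close>

lemma finite_fibre_compact:
  fixes f :: "real^'n \<Rightarrow> real^'n"
  assumes f: "Ck_on (Suc 0) UNIV f" and supp: "\<And>x. x \<notin> cball 0 R \<Longrightarrow> f x = 0"
    and "p \<noteq> 0" and reg: "\<And>x. f x = p \<Longrightarrow> det (jacobian f x) \<noteq> 0"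
  shows "finite (f -` {p})"
proof -
  have sub: "f -` {p} \<subseteq> cball 0 R" using supp \<open>p \<noteq> 0\<close> by force
  have "closed (f -` {p})"
    using Ck_on_continuous_on[OF f] by (intro continuous_closed_vimage) (auto simp: continuous_on_eq_continuous_at)
  with sub have comp: "compact (f -` {p})"
    using compact_Int_closed[OF compact_cball, of "f -` {p}" 0 R] by (simp add: Int_absorb1)
  have "\<exists>d>0. \<forall>y\<in>ball x d. f y = p \<longrightarrow> y = x" if x: "f x = p" for x
  proof -
    obtain d e where "0 < d" "0 < e"
      "\<And>y z. y \<in> ball x d \<Longrightarrow> z \<in> ball x d \<Longrightarrow> e * norm (y - z) \<le> norm (f y - f z)"
      using Ck_on_local_lower_bound[OF open_UNIV f _ reg[OF x]] by auto
    then have "\<forall>y\<in>ball x d. f y = p \<longrightarrow> y = x"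
      using x by (metis centre_in_ball diff_self eq_iff_diff_eq_0 mult_le_0_iff norm_le_zero_iff norm_zero not_le)
    then show ?thesis using \<open>0 < d\<close> by blast
  qed
  then obtain d where d: "\<And>x. f x = p \<Longrightarrow> 0 < d x" "\<And>x y. f x = p \<Longrightarrow> y \<in> ball x (d x) \<Longrightarrow> f y = p \<Longrightarrow> y = x"
    by metis
  have "f -` {p} \<subseteq> (\<Union>x\<in>f -` {p}. ball x (d x))"
    using d(1) by auto
  then obtain D where D: "D \<subseteq> f -` {p}" "finite D" "f -` {p} \<subseteq> (\<Union>x\<in>D. ball x (d x))"
    using compactE_image[OF comp, of "f -` {p}" "\<lambda>x. ball x (d x)"] by blast
  have "f -` {p} \<subseteq> D"
  proof
    fix x assume x: "x \<in> f -` {p}"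
    then obtain y where y: "y \<in> D" "x \<in> ball y (d y)" using D(3) by blast
    then have "x = y" using d(2)[of y x] D(1) x by blast
    then show "x \<in> D" using y(1) by simp
  qed
  with D(2) show ?thesis by (rule finite_subset[rotated])
qed

lemma smooth_step:
  obtains \<beta> \<beta>' :: "real \<Rightarrow> real" where "Ck_on (Suc 0) UNIV \<beta>"
    "\<And>t. (\<beta> has_real_derivative \<beta>' t) (at t)"
    "\<And>t. \<bar>t\<bar> < 1 \<Longrightarrow> 0 < \<beta>' t" "\<And>t. 1 \<le> \<bar>t\<bar> \<Longrightarrow> \<beta>' t = 0"
proof -
  let ?P = "\<lambda>n t::real. (max 0 t) ^ Suc n"
  \<comment> \<open>A C^1 spline that is constant for \<open>t \<le> -1\<close> and for
    \<open>t \<ge> 1\<close> and has derivative \<open>3 * (1 + t) * (1 - t)\<close> in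
    between.\<close>
  let ?\<beta> = "\<lambda>t. 3 * ?P 1 (t + 1) - ?P 2 (t + 1) + (?P 2 (t + -1) + 3 * ?P 1 (t + -1))"
  let ?\<beta>' = "\<lambda>t. 3 * (2 * ?P 0 (t + 1)) - 3 * ?P 1 (t + 1) + (3 * ?P 1 (t + -1) + 3 * (2 * ?P 0 (t + -1)))"
  have P: "(?P 1 has_real_derivative 2 * ?P 0 t) (at t)" "(?P 2 has_real_derivative 3 * ?P 1 t) (at t)" for t
    using DERIV_max_power[of 0 t] DERIV_max_power[of 1 t] by (simp_all add: numeral_2_eq_2)
  have D: "(?\<beta> has_real_derivative ?\<beta>' t) (at t)" for t
    by (intro DERIV_add DERIV_diff DERIV_cmult DERIV_shift[THEN iffD1, OF P(1)] DERIV_shift[THEN iffD1, OF P(2)])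
  show ?thesis
  proof (rule that[OF _ D])
    show "Ck_on (Suc 0) UNIV ?\<beta>"
    proof (rule Ck_on_Suc_derivI[OF open_UNIV])
      show "(?\<beta> has_derivative (\<lambda>v. ?\<beta>' t * v)) (at t)" for t
        using D unfolding has_field_derivative_def .
      show "Ck_on 0 UNIV (\<lambda>t. ?\<beta>' t * v)" for v
        by (auto intro!: continuous_intros)
    qed
    show "0 < ?\<beta>' t" if "\<bar>t\<bar> < 1" for t
    proof -
      have "-1 < t" "t < 1" using that by auto
      then have "?\<beta>' t = 3 * (1 + t) * (1 - t)" by (simp add: max_def power2_eq_square algebra_simps)
      then show ?thesis using that by (simp add: abs_less_iff)
    qed
    show "?\<beta>' t = 0" if "1 \<le> \<bar>t\<bar>" for t
    proof (cases "1 \<le> t")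
      case True
      then show ?thesis by (simp add: max_def power2_eq_square algebra_simps)
    next
      case False
      then have "t \<le> -1" using that by linarith
      then show ?thesis by (simp add: max_def)
    qed
  qed
qed

text \<open>Composing a map with \<open>\<theta>\<close> localises the computation of its degree at \<open>p\<close>.\<close>

lemma cube_localisation:
  fixes p :: "real^'n"
  assumes r: "0 < r"
  obtains \<theta> :: "real^'n \<Rightarrow> real^'n" where "Ck_on (Suc 0) UNIV \<theta>"
    "inj_on \<theta> {z. \<forall>i. \<bar>z $ i - p $ i\<bar> < r}"
    "\<And>z. (\<And>i. \<bar>z $ i - p $ i\<bar> < r) \<Longrightarrow> 0 < det (jacobian \<theta> z)"
    "\<And>z i. r \<le> \<bar>z $ i - p $ i\<bar> \<Longrightarrow> det (jacobian \<theta> z) = 0"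
proof -
  obtain \<beta> \<beta>' :: "real \<Rightarrow> real" where \<beta>: "Ck_on (Suc 0) UNIV \<beta>"
    "\<And>t. (\<beta> has_real_derivative \<beta>' t) (at t)"
    "\<And>t. \<bar>t\<bar> < 1 \<Longrightarrow> 0 < \<beta>' t" "\<And>t. 1 \<le> \<bar>t\<bar> \<Longrightarrow> \<beta>' t = 0"
    using smooth_step by blast
  let ?u = "\<lambda>(z::real^'n) i. (z $ i - p $ i) / r"
  \<comment> \<open>Since \<open>\<beta>\<close> acts coordinatewise, the Jacobian is diagonal with
    non-negative entries, and its determinant vanishes as soon as one coordinate leaves the
    cube.\<close>
  define \<theta> :: "real^'n \<Rightarrow> real^'n" where "\<theta> z = (\<chi> i. \<beta> (?u z i))" for z
  have u: "Ck_on (Suc 0) UNIV (\<lambda>z. ?u z i)" for i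
    by (rule Ck_on_linear_compose[OF open_UNIV bounded_linear_divide],
        rule Ck_on_diff[OF open_UNIV Ck_on_linear[OF open_UNIV bounded_linear_vec_nth] Ck_on_const[OF open_UNIV]])
  have C1: "Ck_on (Suc 0) UNIV \<theta>"
  proof (rule Ck_on_vec[OF open_UNIV])
    show "Ck_on (Suc 0) UNIV (\<lambda>z. \<theta> z $ i)" for i
      unfolding \<theta>_def vec_lambda_beta by (rule Ck_on_compose[OF open_UNIV open_UNIV u \<beta>(1)]) simp
  qed
  have D: "((\<lambda>z. \<theta> z $ i) has_derivative (\<lambda>v. \<beta>' (?u z i) * (v $ i / r))) (at z)" for z i
  proof -
    have "((\<lambda>z. ?u z i) has_derivative (\<lambda>v. v $ i / r)) (at z)"
      using r by (auto intro!: derivative_eq_intros bounded_linear_imp_has_derivative[OF bounded_linear_vec_nth])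
    from has_derivative_compose[OF this \<beta>(2)[unfolded has_field_derivative_def]]
    show ?thesis by (simp add: \<theta>_def)
  qed
  have J: "jacobian \<theta> z $ i $ j = (if i = j then \<beta>' (?u z i) / r else 0)" for z i j
  proof -
    have "dir_deriv (\<lambda>z. \<theta> z $ i) v z = dir_deriv \<theta> v z $ i" for v
      by (rule dir_deriv_linear_compose) (use C1 in auto)
    then have "dir_deriv \<theta> (axis j 1) z $ i = \<beta>' (?u z i) * (axis j 1 $ i / r)"
      using dir_deriv_eq[OF D] by simp
    then show ?thesis by (simp add: jacobian_component axis_def)
  qed
  then have detJ: "det (jacobian \<theta> z) = (\<Prod>i\<in>UNIV. \<beta>' (?u z i) / r)" for z
    by (subst det_diagonal) (simp_all add: J)
  have iff: "\<bar>?u z i\<bar> < 1 \<longleftrightarrow> \<bar>z $ i - p $ i\<bar> < r" for z i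
    using r by (simp add: abs_divide)
  show ?thesis
  proof (rule that[OF C1])
    have mono: "\<beta> s < \<beta> t" if "s < t" "-1 < s" "t < 1" for s t
      using \<open>s < t\<close>
    proof (rule DERIV_pos_imp_increasing)
      show "\<exists>y. (\<beta> has_real_derivative y) (at x) \<and> 0 < y" if "s \<le> x" "x \<le> t" for x
        using \<beta>(2)[of x] \<beta>(3)[of x] that \<open>-1 < s\<close> \<open>t < 1\<close> by (intro exI[of _ "\<beta>' x"]) (auto simp: abs_less_iff)
    qed
    have inj: "s = t" if "\<beta> s = \<beta> t" "\<bar>s\<bar> < 1" "\<bar>t\<bar> < 1" for s t
      using mono[of s t] mono[of t s] that by (cases s t rule: linorder_cases) (auto simp: abs_less_iff)
    show "inj_on \<theta> {z. \<forall>i. \<bar>z $ i - p $ i\<bar> < r}"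
    proof (rule inj_onI)
      fix z w assume zw: "z \<in> {z. \<forall>i. \<bar>z $ i - p $ i\<bar> < r}" "w \<in> {z. \<forall>i. \<bar>z $ i - p $ i\<bar> < r}" "\<theta> z = \<theta> w"
      have "?u z i = ?u w i" for i
      proof (rule inj)
        show "\<beta> (?u z i) = \<beta> (?u w i)"
          using arg_cong[OF zw(3), of "\<lambda>x. x $ i"] by (simp add: \<theta>_def)
        show "\<bar>?u z i\<bar> < 1" "\<bar>?u w i\<bar> < 1" using zw(1,2) unfolding iff by auto
      qed
      then show "z = w" using r by (simp add: vec_eq_iff)
    qed
    show "0 < det (jacobian \<theta> z)" if "\<And>i. \<bar>z $ i - p $ i\<bar> < r" for z
      unfolding detJ by (rule prod_pos) (use that r in \<open>auto simp: \<beta>(3) iff\<close>)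
    show "det (jacobian \<theta> z) = 0" if "r \<le> \<bar>z $ i - p $ i\<bar>" for z i
      unfolding detJ by (rule prod_zero) (use that \<beta>(4)[of "?u z i"] iff[of z i] in \<open>auto simp: not_less\<close>)
  qed
qed

lemma even_card_sum_signs:
  fixes s :: "'a \<Rightarrow> real"
  assumes "finite Z" "\<And>x. x \<in> Z \<Longrightarrow> s x = 1 \<or> s x = -1" "(\<Sum>x\<in>Z. s x) = 0"
  shows "even (card Z)"
proof -
  let ?k = "card {x \<in> Z. s x = 1}" and ?l = "card {x \<in> Z. s x \<noteq> 1}"
  have "(\<Sum>x\<in>Z. s x) = (\<Sum>x\<in>{x\<in>Z. s x = 1}. s x) + (\<Sum>x\<in>{x\<in>Z. s x \<noteq> 1}. s x)"
    by (subst sum.union_disjoint[symmetric]) (use assms(1) in \<open>auto intro!: sum.cong\<close>)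
  also have "\<dots> = real ?k - real ?l"
    using assms(2) by (subst sum.cong[of _ "{x\<in>Z. s x \<noteq> 1}" s "\<lambda>_. -1"]) auto
  finally have "?k = ?l" using assms(3) by simp
  moreover have "card Z = ?k + ?l"
    by (subst card_Un_disjoint[symmetric]) (use assms(1) in \<open>auto intro: arg_cong[where f = card]\<close>)
  ultimately show ?thesis by simp
qed

text \<open>Over a small cube around \<open>p\<close> the map \<open>f\<close> consists of one sheet
  through each preimage. The Jacobian determinant of \<open>\<theta> \<circ> f\<close> lives on
  these sheets, and each contributes plus or minus the same volume. Since the total is zero, the
  signs cancel in pairs.\<close>

lemma even_card_regular_fibre:
  fixes f :: "real^'n::{finite,wellorder} \<Rightarrow> real^'n::_"
  assumes f: "Ck_on (Suc 0) UNIV f" and supp: "\<And>x. x \<notin> cball 0 R \<Longrightarrow> f x = 0"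
    and p: "p \<noteq> 0" and reg: "\<And>x. f x = p \<Longrightarrow> det (jacobian f x) \<noteq> 0"
  shows "even (card (f -` {p}))"
proof -
  let ?Z = "f -` {p}" and ?J = "\<lambda>x. det (jacobian f x)"
  have fin: "finite ?Z" by (rule finite_fibre_compact[OF f supp p reg])
  have contf: "continuous_on S f" for S
    using continuous_on_subset[OF Ck_on_continuous_on[OF f]] by simp
  have contJ: "continuous_on UNIV ?J"
    by (rule continuous_on_det[OF Ck_on_continuous_jacobian_component[OF f]])
  have "\<exists>d>0. inj_on f (ball q d) \<and> (\<forall>x\<in>ball q d. 0 < ?J x * ?J q)" if q: "q \<in> ?Z" for q
  proof -
    have Jq: "?J q \<noteq> 0" using q reg by simp
    obtain d e where d: "0 < d" "0 < e"
      "\<And>x y. x \<in> ball q d \<Longrightarrow> y \<in> ball q d \<Longrightarrow> e * norm (x - y) \<le> norm (f x - f y)"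
      using Ck_on_local_lower_bound[OF open_UNIV f _ Jq] by auto
    have "inj_on f (ball q d)"
    proof (rule inj_onI)
      fix x y assume xy: "x \<in> ball q d" "y \<in> ball q d" "f x = f y"
      have "e * norm (x - y) \<le> 0" using d(3)[OF xy(1,2)] xy(3) by simp
      then show "x = y" using d(2) by (simp add: mult_le_0_iff)
    qed
    moreover have "open {x. 0 < ?J x * ?J q}"
      by (intro open_Collect_less continuous_intros contJ)
    moreover have "q \<in> {x. 0 < ?J x * ?J q}" using Jq by (auto simp: zero_less_mult_iff linorder_neq_iff)
    ultimately obtain d' where "0 < d'" "ball q d' \<subseteq> {x. 0 < ?J x * ?J q}"
      by (meson openE)
    with \<open>inj_on f (ball q d)\<close> d(1) show ?thesis
      by (intro exI[of _ "min d d'"]) (auto simp: subset_iff intro: inj_on_subset)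
  qed
  then obtain d where d: "\<And>q. q \<in> ?Z \<Longrightarrow> 0 < d q" "\<And>q. q \<in> ?Z \<Longrightarrow> inj_on f (ball q (d q))"
    "\<And>q x. q \<in> ?Z \<Longrightarrow> x \<in> ball q (d q) \<Longrightarrow> 0 < ?J x * ?J q"
    by metis
  \<comment> \<open>Half the mutual distances make the balls around the preimages disjoint, and
    \<open>d\<close> keeps each inside its injectivity ball. The 1 covers an empty fibre.\<close>
  define \<rho> where "\<rho> = Min (insert 1 (d ` ?Z \<union> (\<lambda>(q, q'). dist q q' / 2) ` {(q, q'). q \<in> ?Z \<and> q' \<in> ?Z \<and> q \<noteq> q'}))"
  have fin2: "finite {(q, q'). q \<in> ?Z \<and> q' \<in> ?Z \<and> q \<noteq> q'}"
    by (rule finite_subset[of _ "?Z \<times> ?Z"]) (use fin in auto)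
  have \<rho>: "0 < \<rho>" "\<And>q. q \<in> ?Z \<Longrightarrow> \<rho> \<le> d q"
    unfolding \<rho>_def using fin fin2 d(1) by (auto intro!: Min_le)
  have \<rho>3: "\<rho> \<le> dist q q' / 2" if "q \<in> ?Z" "q' \<in> ?Z" "q \<noteq> q'" for q q'
    unfolding \<rho>_def by (rule Min_le) (use fin fin2 that in \<open>auto intro!: rev_image_eqI[of "(q, q')"]\<close>)
  define W where "W q = ball q \<rho>" for q :: "(real, 'n) vec"
  have W: "open (W q)" "q \<in> W q" for q using \<rho>(1) by (auto simp: W_def)
  have Wd: "W q \<subseteq> ball q (d q)" if "q \<in> ?Z" for q
    using \<rho>(2)[OF that] by (auto simp: W_def)
  have injW: "inj_on f (W q)" if "q \<in> ?Z" for q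
    using inj_on_subset[OF d(2)[OF that] Wd[OF that]] .
  have disj: "W q \<inter> W q' = {}" if "q \<in> ?Z" "q' \<in> ?Z" "q \<noteq> q'" for q q'
  proof -
    have "2 * \<rho> \<le> dist q q'" using \<rho>3[OF that] by simp
    then show ?thesis unfolding W_def by (intro disjoint_ballI) simp
  qed
  \<comment> \<open>Values reached on every sheet and nowhere else in the support ball. Excluding 0
    keeps all their preimages inside that ball.\<close>
  define V where "V = (\<Inter>q\<in>?Z. f ` W q) \<inter> - (f ` (cball 0 R - (\<Union>q\<in>?Z. W q))) \<inter> - {0}"
  have "open V"
  proof -
    have "compact (f ` (cball 0 R - (\<Union>q\<in>?Z. W q)))"
      using W(1) by (intro compact_continuous_image contf compact_diff open_UN) auto
    then show ?thesis unfolding V_def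
      using fin W(1) injW by (intro open_Int open_INT ballI open_Compl compact_imp_closed invariance_of_domain contf) auto
  qed
  moreover have "p \<in> V" using p W(2) by (auto simp: V_def)
  ultimately obtain \<epsilon> where \<epsilon>: "0 < \<epsilon>" "ball p \<epsilon> \<subseteq> V" by (meson openE)
  \<comment> \<open>The norm is at most the sum of the absolute coordinates, so the cube of
    half-side \<open>r\<close> lies in \<open>ball p \<epsilon>\<close>.\<close>
  define r where "r = \<epsilon> / CARD('n)"
  have r: "0 < r" using \<epsilon> by (simp add: r_def)
  define D where "D = {z. \<forall>i. \<bar>z $ i - p $ i\<bar> < r}"
  have DV: "D \<subseteq> V"
  proof
    fix z assume "z \<in> D"
    then have "(\<Sum>i\<in>UNIV. \<bar>(z - p) $ i\<bar>) < (\<Sum>i\<in>(UNIV::'n set). r)"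
      by (intro sum_strict_mono) (auto simp: D_def)
    also have "\<dots> = \<epsilon>" by (simp add: r_def)
    finally have "norm (z - p) < \<epsilon>" using norm_le_l1_cart[of "z - p"] by linarith
    then show "z \<in> V" using \<epsilon>(2) by (auto simp: dist_norm norm_minus_commute)
  qed
  have openD: "open D"
  proof -
    have "D = (\<Inter>i\<in>UNIV. {z. \<bar>z $ i - p $ i\<bar> < r})" by (auto simp: D_def)
    then show ?thesis by (auto intro!: open_INT open_Collect_less continuous_intros)
  qed
  obtain \<theta> :: "(real, 'n) vec \<Rightarrow> (real, 'n) vec" where \<theta>: "Ck_on (Suc 0) UNIV \<theta>" "inj_on \<theta> D"
    "\<And>z. (\<And>i. \<bar>z $ i - p $ i\<bar> < r) \<Longrightarrow> 0 < det (jacobian \<theta> z)"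
    "\<And>z i. r \<le> \<bar>z $ i - p $ i\<bar> \<Longrightarrow> det (jacobian \<theta> z) = 0"
    unfolding D_def using cube_localisation[OF r, of p] by blast
  have \<theta>_out: "det (jacobian \<theta> z) = 0" if "z \<notin> D" for z
    using that \<theta>(4) by (auto simp: D_def not_less)
  let ?G = "\<lambda>x. \<theta> (f x)"
  \<comment> \<open>\<open>\<theta> \<circ> f\<close> is constant off the support ball; subtracting
    that constant gives compact support and keeps the Jacobian.\<close>
  define g where "g x = \<theta> (f x) - \<theta> 0" for x
  have G: "Ck_on (Suc 0) UNIV ?G" by (rule Ck_on_compose[OF open_UNIV open_UNIV f \<theta>(1)]) simp
  have DG: "(?G has_derivative (\<lambda>v. jacobian ?G x *v v)) (at x)" for x
    by (rule jacobian_has_derivative) (use G in simp)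
  have detG: "det (jacobian ?G x) = det (jacobian \<theta> (f x)) * ?J x" for x
    by (subst jacobian_compose) (use f \<theta>(1) in \<open>auto simp: det_mul\<close>)
  have "Ck_on (Suc 0) UNIV g"
    unfolding g_def by (rule Ck_on_diff[OF open_UNIV G Ck_on_const[OF open_UNIV]])
  moreover have "g x = 0" if "x \<notin> cball 0 R" for x using supp[OF that] by (simp add: g_def)
  ultimately have "((\<lambda>x. det (jacobian g x)) has_integral 0) (cball 0 R)"
    by (rule integral_det_jacobian_compact_support)
  moreover have "jacobian g x = jacobian ?G x" for x
    using jacobian_eq[OF has_derivative_diff[OF DG[of x] has_derivative_const[of "\<theta> 0"]]]
    by (simp add: g_def[abs_def])
  ultimately have int0: "((\<lambda>x. det (jacobian ?G x)) has_integral 0) (cball 0 R)" by simp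
  define S where "S q = W q \<inter> f -` D" for q
  have fS: "f ` S q = D" if "q \<in> ?Z" for q
    using DV that by (force simp: S_def V_def)
  have Sball: "S q \<subseteq> cball 0 R" for q
    using DV supp by (force simp: S_def V_def)
  have outside: "det (jacobian ?G x) = 0" if "x \<notin> (\<Union>q\<in>?Z. S q)" for x
  proof (cases "f x \<in> D")
    case True
    then have "f x \<in> V" using DV by blast
    then have "f x \<noteq> 0" "f x \<notin> f ` (cball 0 R - (\<Union>q\<in>?Z. W q))"
      unfolding V_def by blast+
    then have "x \<in> (\<Union>q\<in>?Z. W q)" using supp[of x] by blast
    then show ?thesis using that True by (auto simp: S_def)
  qed (simp add: detG \<theta>_out)
  have openS: "open (S q)" for q
    unfolding S_def using openD by (intro open_Int W open_vimage contf)
  let ?m = "measure lebesgue (\<theta> ` D)"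
  have meas: "\<theta> ` D \<in> lmeasurable"
  proof (rule bounded_set_imp_lmeasurable)
    have "bounded (cball p \<epsilon>)" by simp
    then have "compact (\<theta> ` cball p \<epsilon>)"
      by (intro compact_continuous_image continuous_on_subset[OF Ck_on_continuous_on[OF \<theta>(1)]]) auto
    moreover have "D \<subseteq> cball p \<epsilon>"
    proof
      fix z assume "z \<in> D"
      then have "(\<Sum>i\<in>UNIV. \<bar>(z - p) $ i\<bar>) \<le> (\<Sum>i\<in>(UNIV::'n set). r)"
        by (intro sum_mono) (auto simp: D_def less_imp_le)
      also have "\<dots> = \<epsilon>" by (simp add: r_def)
      finally have "norm (z - p) \<le> \<epsilon>" using norm_le_l1_cart[of "z - p"] by linarith
      then show "z \<in> cball p \<epsilon>" by (simp add: dist_norm norm_minus_commute)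
    qed
    ultimately show "bounded (\<theta> ` D)" by (meson bounded_subset compact_imp_bounded image_mono)
  next
    have "open (\<theta> ` D)"
      by (intro invariance_of_domain openD \<theta>(2) continuous_on_subset[OF Ck_on_continuous_on[OF \<theta>(1)]]) auto
    then show "\<theta> ` D \<in> sets lebesgue" by (simp add: borel_open)
  qed
  have mpos: "0 < ?m"
  proof -
    have "open (\<theta> ` D)"
      by (intro invariance_of_domain openD \<theta>(2) continuous_on_subset[OF Ck_on_continuous_on[OF \<theta>(1)]]) auto
    moreover have "p \<in> D" using r by (simp add: D_def)
    ultimately have "\<not> negligible (\<theta> ` D)" by (intro open_not_negligible) auto
    then show ?thesis using negligible_iff_measure0[OF meas] by (simp add: zero_less_measure_iff)
  qed
  \<comment> \<open>Change of variables gives the unsigned volume. The sign can be restored because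
    \<open>?J\<close> keeps the sign of \<open>?J q\<close> on the sheet and \<open>\<theta>\<close>
    has positive Jacobian determinant on the cube.\<close>
  have intS: "((\<lambda>x. det (jacobian ?G x)) has_integral sgn (?J q) * ?m) (S q)" if q: "q \<in> ?Z" for q
  proof -
    have "inj_on ?G (S q)"
    proof (rule inj_onI)
      fix x y assume xy: "x \<in> S q" "y \<in> S q" "\<theta> (f x) = \<theta> (f y)"
      then have "f x = f y" using inj_onD[OF \<theta>(2)] by (simp add: S_def)
      then show "x = y" using inj_onD[OF injW[OF q]] xy by (simp add: S_def)
    qed
    then have "(?G ` S q \<in> lmeasurable \<and> measure lebesgue (?G ` S q) = ?m) \<longleftrightarrow>
        ((\<lambda>x. \<bar>det (matrix (\<lambda>v. jacobian ?G x *v v))\<bar>) has_integral ?m) (S q)"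
      using openS DG by (intro has_measure_differentiable_image) (auto intro: has_derivative_at_withinI)
    moreover have "?G ` S q = \<theta> ` D" using fS[OF q] by (metis image_image)
    ultimately have "((\<lambda>x. \<bar>det (jacobian ?G x)\<bar>) has_integral ?m) (S q)"
      using meas by simp
    then have "((\<lambda>x. sgn (?J q) * \<bar>det (jacobian ?G x)\<bar>) has_integral sgn (?J q) * ?m) (S q)"
      by (rule has_integral_mult_right)
    moreover have "sgn (?J q) * \<bar>det (jacobian ?G x)\<bar> = det (jacobian ?G x)" if "x \<in> S q" for x
    proof -
      have "0 < ?J x * ?J q" using d(3)[OF q] Wd[OF q] that by (auto simp: S_def)
      moreover have "0 < det (jacobian \<theta> (f x))" using that by (intro \<theta>(3)) (simp add: S_def D_def)
      ultimately show ?thesis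
        unfolding detG by (auto simp: abs_mult zero_less_mult_iff sgn_if)
    qed
    ultimately show ?thesis by (rule has_integral_eq[rotated]) 
  qed
  have "((\<lambda>x. det (jacobian ?G x)) has_integral (\<Sum>q\<in>?Z. sgn (?J q) * ?m)) (\<Union>q\<in>?Z. S q)"
  proof (rule has_integral_UN[OF fin intS])
    show "pairwise (\<lambda>q q'. negligible (S q \<inter> S q')) ?Z"
    proof (rule pairwiseI)
      fix q q' assume "q \<in> ?Z" "q' \<in> ?Z" "q \<noteq> q'"
      then have "S q \<inter> S q' = {}" using disj by (auto simp: S_def)
      then show "negligible (S q \<inter> S q')" by simp
    qed
  qed
  then have "((\<lambda>x. det (jacobian ?G x)) has_integral (\<Sum>q\<in>?Z. sgn (?J q) * ?m)) (cball 0 R)"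
    by (rule has_integral_on_superset) (use outside Sball in auto)
  then have "(\<Sum>q\<in>?Z. sgn (?J q) * ?m) = 0" using int0 by (rule has_integral_unique)
  then have "(\<Sum>q\<in>?Z. sgn (?J q)) = 0" using mpos by (simp add: sum_distrib_right[symmetric])
  then show ?thesis
    using reg by (intro even_card_sum_signs[OF fin]) (auto simp: sgn_if)
qed

subsection \<open>Transfer to arbitrary finite index types\<close>

text \<open>The change-of-variables theorems of the library need a well-ordered index type, so every
  finite index type is replaced by a well-ordered copy of itself.\<close>

typedef 'a ranked = "UNIV :: 'a set" by simp

instance ranked :: (finite) finite
proof
  have "(UNIV :: 'a ranked set) = Abs_ranked ` UNIV"
    by (metis Rep_ranked_inverse surj_def)
  then show "finite (UNIV :: 'a ranked set)" by (metis finite finite_imageI)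
qed

instantiation ranked :: (finite) wellorder
begin

definition "a \<le> b \<longleftrightarrow> to_nat (Rep_ranked a) \<le> to_nat (Rep_ranked b)"
definition "a < b \<longleftrightarrow> to_nat (Rep_ranked a) < to_nat (Rep_ranked b)"

instance
proof
  fix P :: "'a ranked \<Rightarrow> bool" and a
  assume step: "\<And>x. (\<And>y. y < x \<Longrightarrow> P y) \<Longrightarrow> P x"
  show "P a"
    by (induction a rule: measure_induct_rule[where f = "\<lambda>a. to_nat (Rep_ranked a)"])
      (auto intro: step simp: less_ranked_def)
qed (auto simp: less_eq_ranked_def less_ranked_def Rep_ranked_inject)

end

definition reindex :: "real^'n \<Rightarrow> real^('n ranked)"
  where "reindex x = (\<chi> i. x $ Rep_ranked i)"

definition unreindex :: "real^('n ranked) \<Rightarrow> real^'n"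
  where "unreindex y = (\<chi> i. y $ Abs_ranked i)"

lemma unreindex_reindex [simp]: "unreindex (reindex x) = x"
  by (simp add: reindex_def unreindex_def Abs_ranked_inverse)

lemma reindex_unreindex [simp]: "reindex (unreindex y) = y"
  by (simp add: reindex_def unreindex_def Rep_ranked_inverse)

lemma bij_Abs_ranked: "bij Abs_ranked"
  by (metis Abs_ranked_inverse Rep_ranked_inverse UNIV_I bijI')

lemma card_ranked: "CARD('a ranked) = CARD('a)"
  by (rule bij_betw_same_card[OF bij_Abs_ranked, symmetric])

lemma bounded_linear_reindex: "bounded_linear (reindex :: real^'n \<Rightarrow> _)"
  by (intro linear_conv_bounded_linear[THEN iffD1] linearI) (auto simp: reindex_def vec_eq_iff)

lemma bounded_linear_unreindex: "bounded_linear (unreindex :: _ \<Rightarrow> real^'n)"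
  by (intro linear_conv_bounded_linear[THEN iffD1] linearI) (auto simp: unreindex_def vec_eq_iff)

lemma norm_unreindex: "norm (unreindex y) = norm y"
  unfolding norm_vec_def L2_set_def unreindex_def
  using sum.reindex_bij_betw[OF bij_Abs_ranked, of "\<lambda>i. (norm (y $ i))\<^sup>2"] by simp

lemma negligible_unreindex: "negligible S \<Longrightarrow> negligible (unreindex ` S :: (real^'n) set)"
  by (rule negligible_differentiable_image_negligible)
    (auto simp: card_ranked intro!: bounded_linear_imp_differentiable_on bounded_linear_unreindex)

lemma det_jacobian_reindex:
  fixes f :: "real^'n \<Rightarrow> real^'n"
  assumes "f differentiable (at x)"
  shows "((\<lambda>y. reindex (f (unreindex y))) has_derivative
      (\<lambda>v. reindex (jacobian f x *v unreindex v))) (at (reindex x))"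
    and "det (matrix (\<lambda>v. reindex (jacobian f x *v unreindex v))) = 0 \<longleftrightarrow> det (jacobian f x) = 0"
proof -
  note D = jacobian_has_derivative[OF assms]
  have u: "(unreindex has_derivative unreindex) (at (reindex x))"
    by (rule bounded_linear_imp_has_derivative[OF bounded_linear_unreindex])
  have "((\<lambda>y. f (unreindex y)) has_derivative (\<lambda>v. jacobian f x *v unreindex v)) (at (reindex x))"
    by (rule has_derivative_compose[OF u]) (use D in simp)
  then show *: "((\<lambda>y. reindex (f (unreindex y))) has_derivative
      (\<lambda>v. reindex (jacobian f x *v unreindex v))) (at (reindex x))"
    by (rule bounded_linear.has_derivative[OF bounded_linear_reindex])
  \<comment> \<open>Determinants over different index types are compared through injectivity, which
    linear isomorphisms preserve.\<close>
  have "inj (\<lambda>v. reindex (jacobian f x *v unreindex v)) \<longleftrightarrow> inj (\<lambda>v. jacobian f x *v v)"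
    unfolding inj_def by (metis reindex_unreindex unreindex_reindex)
  then show "det (matrix (\<lambda>v. reindex (jacobian f x *v unreindex v))) = 0 \<longleftrightarrow> det (jacobian f x) = 0"
    using det_nz_iff_inj[OF has_derivative_linear[OF *]] det_nz_iff_inj[OF has_derivative_linear[OF D]]
    by (metis matrix_of_matrix_vector_mul)
qed

text \<open>Sard's theorem between spaces of equal dimension asks only for differentiability, so it
  is available for a gradient map of class C^1.\<close>

lemma negligible_critical_values:
  fixes f :: "real^'n \<Rightarrow> real^'n"
  assumes "\<And>x. x \<in> S \<Longrightarrow> f differentiable (at x)"
  shows "negligible (f ` {x \<in> S. det (jacobian f x) = 0})"
proof -
  let ?C = "{x \<in> S. det (jacobian f x) = 0}"
  let ?g = "\<lambda>y. reindex (f (unreindex y))"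
  have "negligible (?g ` (reindex ` ?C))"
  proof (rule baby_Sard)
    show "(?g has_derivative (\<lambda>v. reindex (jacobian f (unreindex y) *v unreindex v))) (at y within reindex ` ?C)"
      if "y \<in> reindex ` ?C" for y
      using that det_jacobian_reindex(1)[OF assms] by (auto intro: has_derivative_at_withinI)
    show "rank (matrix (\<lambda>v. reindex (jacobian f (unreindex y) *v unreindex v))) < CARD('n ranked)"
      if "y \<in> reindex ` ?C" for y
      using that det_jacobian_reindex(2)[OF assms] by (auto simp flip: det_eq_0_rank)
  qed simp
  then have "negligible (unreindex ` (?g ` (reindex ` ?C)))" by (rule negligible_unreindex)
  then show ?thesis by (simp add: image_image)
qed

text \<open>With a negligible set of exceptions in place of regular values, the exceptions of
  several maps can simply be united. Finiteness is demanded separately because \<open>card\<close>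
  of an infinite set is 0, which is even.\<close>

definition even_fibres :: "('a \<Rightarrow> 'b::euclidean_space) \<Rightarrow> bool"
  where "even_fibres f \<longleftrightarrow> negligible {p. \<not> (finite (f -` {p}) \<and> even (card (f -` {p})))}"

lemma even_fibresI:
  assumes "negligible E" "\<And>p. p \<notin> E \<Longrightarrow> finite (f -` {p}) \<and> even (card (f -` {p}))"
  shows "even_fibres f"
  unfolding even_fibres_def by (rule negligible_subset[OF assms(1)]) (use assms(2) in blast)

text \<open>The value 0 joins the critical values as an exception, since its fibre contains
  everything off the ball.\<close>

lemma even_fibres_compact_support:
  fixes f :: "real^'n \<Rightarrow> real^'n"
  assumes f: "Ck_on (Suc 0) UNIV f" and supp: "\<And>x. x \<notin> cball 0 R \<Longrightarrow> f x = 0"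
  shows "even_fibres f"
proof (rule even_fibresI)
  let ?g = "\<lambda>y. reindex (f (unreindex y))"
  have diff: "f differentiable (at x)" for x using f by simp
  show "negligible (insert 0 (f ` {x \<in> UNIV. det (jacobian f x) = 0}))"
    using negligible_critical_values[of UNIV f] diff by simp
  fix p assume p: "p \<notin> insert 0 (f ` {x \<in> UNIV. det (jacobian f x) = 0})"
  then have reg: "det (jacobian f x) \<noteq> 0" if "f x = p" for x using that by auto
  have fin: "finite (f -` {p})"
    by (rule finite_fibre_compact[OF f supp]) (use p reg in auto)
  have g: "Ck_on (Suc 0) UNIV ?g"
    by (rule Ck_on_linear_compose[OF open_UNIV bounded_linear_reindex],
        rule Ck_on_compose[OF open_UNIV open_UNIV Ck_on_linear[OF open_UNIV bounded_linear_unreindex] f])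
      simp
  have zero: "reindex x = 0 \<longleftrightarrow> x = 0" for x :: "real^'n"
    by (metis bounded_linear_reindex bounded_linear_unreindex linear_simps(3) unreindex_reindex)
  have "even (card (?g -` {reindex p}))"
  proof (rule even_card_regular_fibre[OF g])
    show "?g y = 0" if "y \<notin> cball 0 R" for y
      using that supp[of "unreindex y"] by (simp add: zero norm_unreindex)
    show "reindex p \<noteq> 0" using p zero by simp
    show "det (jacobian ?g y) \<noteq> 0" if "?g y = reindex p" for y
    proof -
      have "f (unreindex y) = p" using that by (metis unreindex_reindex)
      then have "det (jacobian f (unreindex y)) \<noteq> 0" by (rule reg)
      then show ?thesis
        using jacobian_eq[OF det_jacobian_reindex(1)[OF diff[of "unreindex y"]]]
          det_jacobian_reindex(2)[OF diff[of "unreindex y"]] by simp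
    qed
  qed
  moreover have "?g -` {reindex p} = reindex ` (f -` {p})"
  proof (rule set_eqI, rule iffI)
    fix y assume "y \<in> ?g -` {reindex p}"
    then have "unreindex (?g y) = unreindex (reindex p)" by simp
    then have "unreindex y \<in> f -` {p}" by simp
    then have "reindex (unreindex y) \<in> reindex ` (f -` {p})" by (rule imageI)
    then show "y \<in> reindex ` (f -` {p})" by simp
  qed auto
  moreover have "card (reindex ` (f -` {p})) = card (f -` {p})"
    by (rule card_image) (metis inj_onI unreindex_reindex)
  ultimately show "finite (f -` {p}) \<and> even (card (f -` {p}))" using fin by simp
qed

section \<open>Functions on manifolds\<close>

lemma smooth_atlas_chartD:
  assumes "smooth_atlas A" "\<kappa> \<in> A"
  shows "open (fst \<kappa>)" "open (snd \<kappa> ` fst \<kappa>)"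
    "continuous_on (fst \<kappa>) (snd \<kappa>)" "continuous_on (snd \<kappa> ` fst \<kappa>) (chart_inv \<kappa>)"
    "\<And>x. x \<in> fst \<kappa> \<Longrightarrow> chart_inv \<kappa> (snd \<kappa> x) = x"
    "\<And>u. u \<in> snd \<kappa> ` fst \<kappa> \<Longrightarrow> chart_inv \<kappa> u \<in> fst \<kappa>"
    "\<And>u. u \<in> snd \<kappa> ` fst \<kappa> \<Longrightarrow> snd \<kappa> (chart_inv \<kappa> u) = u"
proof -
  have "is_chart \<kappa>" using assms by (auto simp: smooth_atlas_def)
  then show "open (fst \<kappa>)" "open (snd \<kappa> ` fst \<kappa>)"
    "continuous_on (fst \<kappa>) (snd \<kappa>)" "continuous_on (snd \<kappa> ` fst \<kappa>) (chart_inv \<kappa>)"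
    "\<And>x. x \<in> fst \<kappa> \<Longrightarrow> chart_inv \<kappa> (snd \<kappa> x) = x"
    "\<And>u. u \<in> snd \<kappa> ` fst \<kappa> \<Longrightarrow> chart_inv \<kappa> u \<in> fst \<kappa>"
    "\<And>u. u \<in> snd \<kappa> ` fst \<kappa> \<Longrightarrow> snd \<kappa> (chart_inv \<kappa> u) = u"
    unfolding is_chart_def homeomorphism_def by (auto simp: image_iff)
qed

lemma smooth_atlas_cover:
  assumes "smooth_atlas A"
  obtains \<kappa> where "\<kappa> \<in> A" "x \<in> fst \<kappa>"
  using assms unfolding smooth_atlas_def by blast

lemma open_chart_image:
  assumes "smooth_atlas A" "\<kappa> \<in> A" "open U"
  shows "open (snd \<kappa> ` (fst \<kappa> \<inter> U))"
proof -
  note c = smooth_atlas_chartD[OF assms(1,2)]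
  have "open (snd \<kappa> ` fst \<kappa> \<inter> chart_inv \<kappa> -` U)"
    using c(2,4) assms(3) by (simp add: continuous_on_open_vimage Int_commute)
  moreover have "snd \<kappa> ` fst \<kappa> \<inter> chart_inv \<kappa> -` U = snd \<kappa> ` (fst \<kappa> \<inter> U)"
    using c by auto
  ultimately show ?thesis by simp
qed

lemma transition_Ck_on:
  assumes "smooth_atlas A" "\<kappa> \<in> A" "\<eta> \<in> A"
  shows "Ck_on k (snd \<kappa> ` (fst \<kappa> \<inter> fst \<eta>)) (\<lambda>u. snd \<eta> (chart_inv \<kappa> u))"
  using assms unfolding smooth_atlas_def smooth_on_def comp_def by blast

text \<open>The counterpart of \<open>Ck_functions\<close> for vector values, needed for the
  gradient map.\<close>

definition Ck_map :: "nat \<Rightarrow> ('m, 'e::euclidean_space) chart set \<Rightarrow> ('m \<Rightarrow> 'b::real_normed_vector) \<Rightarrow> bool"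
  where "Ck_map k A f \<longleftrightarrow> (\<forall>\<kappa>\<in>A. Ck_on k (snd \<kappa> ` fst \<kappa>) (\<lambda>u. f (chart_inv \<kappa> u)))"

lemma Ck_map_le: "Ck_map l A f \<Longrightarrow> k \<le> l \<Longrightarrow> Ck_map k A f"
  unfolding Ck_map_def using Ck_on_le by blast

lemma Ck_map_scaleR:
  assumes "smooth_atlas A" "Ck_map k A f" "Ck_map k A g"
  shows "Ck_map k A (\<lambda>x. f x *\<^sub>R g x)"
  using assms smooth_atlas_chartD(2)[OF assms(1)] unfolding Ck_map_def by (simp add: Ck_on_scaleR)

lemma Ck_map_const_diff:
  assumes "smooth_atlas A" "Ck_map k A f"
  shows "Ck_map k A (\<lambda>x. c - f x)"
  using assms smooth_atlas_chartD(2)[OF assms(1)] unfolding Ck_map_def by (simp add: Ck_on_diff Ck_on_const)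

lemma compact_chart_image:
  assumes "smooth_atlas A" "\<kappa> \<in> A" "compact K" "K \<subseteq> fst \<kappa>"
  shows "compact (snd \<kappa> ` K)"
  using smooth_atlas_chartD(3)[OF assms(1,2)] assms(3,4)
  by (intro compact_continuous_image) (auto intro: continuous_on_subset)

text \<open>Two open sets cover any other chart: on the overlap with \<open>\<kappa>\<close> a
  transition map carries the regularity over, and off \<open>K\<close>, which is closed because the
  space is Hausdorff, the function is 0.\<close>

lemma Ck_map_extend:
  fixes A :: "('m::t2_space, 'e::euclidean_space) chart set"
  assumes A: "smooth_atlas A" and \<kappa>: "\<kappa> \<in> A" and K: "compact K" "K \<subseteq> fst \<kappa>"
    and zero: "\<And>x. x \<notin> K \<Longrightarrow> f x = 0"
    and f: "Ck_on k (snd \<kappa> ` fst \<kappa>) (\<lambda>u. f (chart_inv \<kappa> u))"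
  shows "Ck_map k A f"
  unfolding Ck_map_def
proof
  fix \<eta> assume \<eta>: "\<eta> \<in> A"
  note c = smooth_atlas_chartD[OF A \<kappa>] and e = smooth_atlas_chartD[OF A \<eta>]
  show "Ck_on k (snd \<eta> ` fst \<eta>) (\<lambda>u. f (chart_inv \<eta> u))"
  proof (rule Ck_on_open_Union[OF e(2)])
    fix u assume u: "u \<in> snd \<eta> ` fst \<eta>"
    show "\<exists>T. open T \<and> u \<in> T \<and> Ck_on k T (\<lambda>u. f (chart_inv \<eta> u))"
    proof (cases "chart_inv \<eta> u \<in> fst \<kappa>")
      case True
      let ?T = "snd \<eta> ` (fst \<eta> \<inter> fst \<kappa>)"
      have op: "open ?T" by (rule open_chart_image[OF A \<eta> c(1)])
      have "Ck_on k ?T (\<lambda>u. f (chart_inv \<kappa> (snd \<kappa> (chart_inv \<eta> u))))"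
        by (rule Ck_on_compose[OF op c(2) transition_Ck_on[OF A \<eta> \<kappa>] f]) (use e in auto)
      then have "Ck_on k ?T (\<lambda>u. f (chart_inv \<eta> u))"
        by (rule Ck_on_cong[OF op, rotated]) (use c e in auto)
      moreover have "u \<in> ?T" using True u e by (auto simp: image_iff intro!: bexI[of _ "chart_inv \<eta> u"])
      ultimately show ?thesis using op by blast
    next
      case False
      let ?T = "snd \<eta> ` (fst \<eta> \<inter> - K)"
      have op: "open ?T"
        using K(1) by (intro open_chart_image[OF A \<eta>] open_Compl compact_imp_closed)
      have "Ck_on k ?T (\<lambda>u. f (chart_inv \<eta> u))"
        by (rule Ck_on_cong[OF op _ Ck_on_const[OF op, of k 0]]) (use e zero in auto)
      moreover have "u \<in> ?T" using False K(2) u e by (auto simp: image_iff intro!: bexI[of _ "chart_inv \<eta> u"])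
      ultimately show ?thesis using op by blast
    qed
  qed
qed

text \<open>The reverse passage. As \<open>chart_inv\<close> is arbitrary outside the image of the
  chart, the value 0 is inserted by hand.\<close>

lemma Ck_on_chart_push:
  fixes A :: "('m::t2_space, 'e::euclidean_space) chart set"
  assumes A: "smooth_atlas A" and \<kappa>: "\<kappa> \<in> A" and K: "compact K" "K \<subseteq> fst \<kappa>"
    and zero: "\<And>x. x \<notin> K \<Longrightarrow> f x = 0" and f: "Ck_map k A f"
  shows "Ck_on k UNIV (\<lambda>u. if u \<in> snd \<kappa> ` K then f (chart_inv \<kappa> u) else 0)"
proof (rule Ck_on_open_Union[OF open_UNIV])
  note c = smooth_atlas_chartD[OF A \<kappa>]
  let ?g = "\<lambda>u. if u \<in> snd \<kappa> ` K then f (chart_inv \<kappa> u) else 0"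
  have op: "open (- (snd \<kappa> ` K))"
    using compact_chart_image[OF A \<kappa> K] by (simp add: compact_imp_closed open_Compl)
  have 1: "Ck_on k (snd \<kappa> ` fst \<kappa>) ?g"
  proof (rule Ck_on_cong[OF c(2)])
    show "Ck_on k (snd \<kappa> ` fst \<kappa>) (\<lambda>u. f (chart_inv \<kappa> u))" using f \<kappa> by (simp add: Ck_map_def)
    show "f (chart_inv \<kappa> u) = ?g u" if "u \<in> snd \<kappa> ` fst \<kappa>" for u
      using zero c(7)[OF that] by force
  qed
  have 2: "Ck_on k (- (snd \<kappa> ` K)) ?g"
    by (rule Ck_on_cong[OF op _ Ck_on_const[OF op, of k 0]]) auto
  show "\<exists>T. open T \<and> u \<in> T \<and> Ck_on k T ?g" for u
    using 1 2 op c(2) K(2) by (cases "u \<in> snd \<kappa> ` fst \<kappa>") blast+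
qed

text \<open>Two nested bumps with radii \<open>R / 3\<close>, \<open>2 * R / 3\<close> and
  \<open>R\<close>: \<open>\<sigma>\<close> is 1 on the compact set that carries
  \<open>\<rho>\<close>, so a change made with \<open>\<rho>\<close> survives multiplication by
  \<open>\<sigma>\<close> unaltered.\<close>

lemma manifold_bump:
  fixes A :: "('m::t2_space, 'e::euclidean_space) chart set"
  assumes A: "smooth_atlas A" and \<kappa>: "\<kappa> \<in> A" and x: "x \<in> fst \<kappa>"
  obtains U and \<rho> :: "'m \<Rightarrow> real" and K and \<sigma> :: "'m \<Rightarrow> real" and K' where
    "open U" "x \<in> U" "\<And>y. y \<in> U \<Longrightarrow> \<rho> y = 1" "\<And>y. y \<in> K \<Longrightarrow> \<sigma> y = 1"
    "compact K" "K \<subseteq> fst \<kappa>" "\<And>y. y \<notin> K \<Longrightarrow> \<rho> y = 0"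
    "compact K'" "K' \<subseteq> fst \<kappa>" "\<And>y. y \<notin> K' \<Longrightarrow> \<sigma> y = 0"
    "Ck_map (Suc (Suc 0)) A \<rho>" "Ck_map (Suc (Suc 0)) A \<sigma>" "U \<subseteq> K"
proof -
  note c = smooth_atlas_chartD[OF A \<kappa>]
  let ?u = "snd \<kappa> x"
  obtain R where R: "0 < R" "cball ?u R \<subseteq> snd \<kappa> ` fst \<kappa>"
    using c(2) x open_contains_cball by blast
  have R3: "0 < R / 3" "R / 3 < 2 * R / 3" "0 < 2 * R / 3" "2 * R / 3 < R" using R(1) by auto
  obtain \<beta>1 :: "'e \<Rightarrow> real" where \<beta>1: "Ck_on (Suc (Suc 0)) UNIV \<beta>1"
    "\<And>v. v \<in> cball ?u (R / 3) \<Longrightarrow> \<beta>1 v = 1" "\<And>v. v \<notin> ball ?u (2 * R / 3) \<Longrightarrow> \<beta>1 v = 0"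
    using bump_function[OF R3(1,2)] by blast
  obtain \<beta>2 :: "'e \<Rightarrow> real" where \<beta>2: "Ck_on (Suc (Suc 0)) UNIV \<beta>2"
    "\<And>v. v \<in> cball ?u (2 * R / 3) \<Longrightarrow> \<beta>2 v = 1" "\<And>v. v \<notin> ball ?u R \<Longrightarrow> \<beta>2 v = 0"
    using bump_function[OF R3(3,4)] by blast
  define lift where "lift \<beta> y = (if y \<in> fst \<kappa> then \<beta> (snd \<kappa> y) else 0)" for \<beta> :: "'e \<Rightarrow> real" and y
  define C where "C r = chart_inv \<kappa> ` cball ?u r" for r
  have mem: "y \<in> C r \<longleftrightarrow> y \<in> fst \<kappa> \<and> snd \<kappa> y \<in> cball ?u r" if "r \<le> R" for y r
  proof -
    have sub: "cball ?u r \<subseteq> snd \<kappa> ` fst \<kappa>" using R(2) subset_cball[OF that] by blast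
    show ?thesis
    proof
      assume "y \<in> C r"
      then obtain v where v: "v \<in> cball ?u r" "y = chart_inv \<kappa> v" unfolding C_def by blast
      then have "v \<in> snd \<kappa> ` fst \<kappa>" using sub by blast
      then show "y \<in> fst \<kappa> \<and> snd \<kappa> y \<in> cball ?u r"
        using v c(6)[of v] c(7)[of v] by simp
    next
      assume "y \<in> fst \<kappa> \<and> snd \<kappa> y \<in> cball ?u r"
      then show "y \<in> C r" unfolding C_def using c(5)[of y] by (metis image_eqI)
    qed
  qed
  have C: "compact (C r)" "C r \<subseteq> fst \<kappa>" if "r \<le> R" for r
  proof -
    have sub: "cball ?u r \<subseteq> snd \<kappa> ` fst \<kappa>" using R(2) subset_cball[OF that] by blast
    show "compact (C r)" unfolding C_def
      by (intro compact_continuous_image continuous_on_subset[OF c(4) sub]) simp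
    show "C r \<subseteq> fst \<kappa>" using mem[OF that] by blast
  qed
  have lift_Ck: "Ck_map (Suc (Suc 0)) A (lift \<beta>)"
    if \<beta>: "Ck_on (Suc (Suc 0)) UNIV \<beta>" and r: "r \<le> R" and z: "\<And>v. v \<notin> cball ?u r \<Longrightarrow> \<beta> v = 0" for \<beta> r
  proof (rule Ck_map_extend[OF A \<kappa> C[OF r]])
    show "lift \<beta> y = 0" if "y \<notin> C r" for y
      using that z mem[OF r] by (auto simp: lift_def simp del: mem_cball)
    show "Ck_on (Suc (Suc 0)) (snd \<kappa> ` fst \<kappa>) (\<lambda>u. lift \<beta> (chart_inv \<kappa> u))"
      by (rule Ck_on_cong[OF c(2) _ Ck_on_subset[OF \<beta>]]) (use c in \<open>auto simp: lift_def\<close>)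
  qed
  let ?U = "chart_inv \<kappa> ` ball ?u (R / 3)"
  have Usub: "ball ?u (R / 3) \<subseteq> snd \<kappa> ` fst \<kappa>"
    using R(2) R3 by (meson ball_subset_cball subset_ball subset_trans less_imp_le less_trans)
  have U: "?U = fst \<kappa> \<inter> snd \<kappa> -` ball ?u (R / 3)"
  proof (rule set_eqI, rule iffI)
    fix y assume "y \<in> ?U"
    then obtain v where v: "v \<in> ball ?u (R / 3)" "y = chart_inv \<kappa> v" by blast
    then have "v \<in> snd \<kappa> ` fst \<kappa>" using Usub by blast
    then show "y \<in> fst \<kappa> \<inter> snd \<kappa> -` ball ?u (R / 3)"
      using v c(6)[of v] c(7)[of v] by simp
  next
    fix y assume "y \<in> fst \<kappa> \<inter> snd \<kappa> -` ball ?u (R / 3)"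
    then show "y \<in> ?U" using c(5)[of y] by (metis IntE image_eqI vimageE)
  qed
  show ?thesis
  proof (rule that[of ?U "lift \<beta>1" "C (2 * R / 3)" "lift \<beta>2" "C R"])
    show "open ?U" unfolding U by (rule continuous_open_preimage[OF c(3) c(1)]) simp
    show "x \<in> ?U" unfolding U using x R by simp
    show "lift \<beta>1 y = 1" if "y \<in> ?U" for y
      using that \<beta>1(2) unfolding U lift_def by auto
    show "lift \<beta>2 y = 1" if "y \<in> C (2 * R / 3)" for y
      using that \<beta>2(2) mem[of "2 * R / 3"] R3 unfolding lift_def by (auto simp del: mem_cball)
    show "compact (C (2 * R / 3))" "C (2 * R / 3) \<subseteq> fst \<kappa>" "compact (C R)" "C R \<subseteq> fst \<kappa>"
      using C R3 by auto
    show "lift \<beta>1 y = 0" if "y \<notin> C (2 * R / 3)" for y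
      using that \<beta>1(3)[of "snd \<kappa> y"] mem[of "2 * R / 3" y] R3 by (auto simp: lift_def)
    show "lift \<beta>2 y = 0" if "y \<notin> C R" for y
      using that \<beta>2(3)[of "snd \<kappa> y"] mem[of R y] by (auto simp: lift_def)
    show "Ck_map (Suc (Suc 0)) A (lift \<beta>1)"
      by (rule lift_Ck[OF \<beta>1(1), of "2 * R / 3"]) (use \<beta>1(3) R3 in auto)
    show "Ck_map (Suc (Suc 0)) A (lift \<beta>2)"
      by (rule lift_Ck[OF \<beta>2(1), of R]) (use \<beta>2(3) in auto)
    show "?U \<subseteq> C (2 * R / 3)"
    proof
      fix y assume "y \<in> ?U"
      then show "y \<in> C (2 * R / 3)"
        unfolding U using mem[of "2 * R / 3" y] R3 by auto
    qed
  qed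
qed

section \<open>Parity of the fibres of a map from a closed manifold\<close>

text \<open>For \<open>p \<noteq> 0\<close> the fibre lies in \<open>K\<close>, where the chart is
  injective, so it can be counted in Euclidean space.\<close>

lemma even_fibres_in_chart:
  fixes A :: "('m::t2_space, real^'d) chart set" and f :: "'m \<Rightarrow> real^'d"
  assumes A: "smooth_atlas A" and \<kappa>: "\<kappa> \<in> A" and K: "compact K" "K \<subseteq> fst \<kappa>"
    and zero: "\<And>x. x \<notin> K \<Longrightarrow> f x = 0" and f: "Ck_map (Suc 0) A f"
  shows "even_fibres f"
proof -
  note c = smooth_atlas_chartD[OF A \<kappa>]
  let ?g = "\<lambda>u. if u \<in> snd \<kappa> ` K then f (chart_inv \<kappa> u) else 0"
  obtain R where R: "\<And>u. u \<in> snd \<kappa> ` K \<Longrightarrow> norm u \<le> R"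
    using compact_imp_bounded[OF compact_chart_image[OF A \<kappa> K]] unfolding bounded_iff by metis
  have g: "even_fibres ?g"
  proof (rule even_fibres_compact_support)
    show "Ck_on (Suc 0) UNIV ?g" by (rule Ck_on_chart_push[OF A \<kappa> K zero f])
    show "?g u = 0" if "u \<notin> cball 0 R" for u
    proof -
      have "u \<notin> snd \<kappa> ` K" using R[of u] that by auto
      then show ?thesis by (rule if_not_P)
    qed
  qed
  show ?thesis
  proof (rule even_fibresI)
    show "negligible (insert 0 {p. \<not> (finite (?g -` {p}) \<and> even (card (?g -` {p})))})"
      using g by (simp add: even_fibres_def)
    fix p assume p: "p \<notin> insert 0 {p. \<not> (finite (?g -` {p}) \<and> even (card (?g -` {p})))}"
    have sub: "f -` {p} \<subseteq> K" using zero p by force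
    have "?g -` {p} = snd \<kappa> ` (f -` {p})"
    proof (rule set_eqI, rule iffI)
      fix u assume "u \<in> ?g -` {p}"
      then have u: "u \<in> snd \<kappa> ` K" "f (chart_inv \<kappa> u) = p" using p by (auto split: if_splits)
      then have "snd \<kappa> (chart_inv \<kappa> u) = u" using c(7) K(2) by blast
      then show "u \<in> snd \<kappa> ` (f -` {p})" using u(2) by (metis image_eqI singletonI vimageI)
    next
      fix u assume "u \<in> snd \<kappa> ` (f -` {p})"
      then obtain y where y: "u = snd \<kappa> y" "f y = p" by auto
      then have "y \<in> K" using sub by auto
      then show "u \<in> ?g -` {p}" using y c(5)[of y] K(2) by auto
    qed
    moreover have "inj_on (snd \<kappa>) (f -` {p})"
      using sub K(2) c(5) by (metis inj_on_inverseI subsetD)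
    ultimately show "finite (f -` {p}) \<and> even (card (f -` {p}))"
      using p by (simp add: card_image finite_image_iff)
  qed
qed

text \<open>Two maps that agree off a compact part of a chart: their products with a cutoff have even
  fibres, so both fibres have the same parity inside the compact part.\<close>

lemma even_fibres_local_change:
  fixes A :: "('m::t2_space, real^'d) chart set" and f g :: "'m \<Rightarrow> real^'d" and \<sigma> :: "'m \<Rightarrow> real"
  assumes A: "smooth_atlas A" and \<kappa>: "\<kappa> \<in> A"
    and K: "\<And>y. y \<in> K \<Longrightarrow> \<sigma> y = 1" "compact K'" "K' \<subseteq> fst \<kappa>" "\<And>y. y \<notin> K' \<Longrightarrow> \<sigma> y = 0"
    and \<sigma>: "Ck_map (Suc 0) A \<sigma>" and f: "Ck_map (Suc 0) A f" and g: "Ck_map (Suc 0) A g"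
    and eq: "\<And>y. y \<notin> K \<Longrightarrow> f y = g y" and even: "even_fibres g"
  shows "even_fibres f"
proof -
  let ?f = "\<lambda>y. \<sigma> y *\<^sub>R f y" and ?g = "\<lambda>y. \<sigma> y *\<^sub>R g y"
  define bad :: "('m \<Rightarrow> real^'d) \<Rightarrow> (real^'d) set"
    where "bad h = {p. \<not> (finite (h -` {p}) \<and> even (card (h -` {p})))}" for h
  have "even_fibres ?f" "even_fibres ?g"
    by (rule even_fibres_in_chart[OF A \<kappa> K(2,3) _ Ck_map_scaleR[OF A \<sigma> f]], simp add: K(4))
      (rule even_fibres_in_chart[OF A \<kappa> K(2,3) _ Ck_map_scaleR[OF A \<sigma> g]], simp add: K(4))
  then have neg: "negligible (bad ?f \<union> bad ?g \<union> bad g)"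
    using even by (simp add: even_fibres_def bad_def)
  show ?thesis
  proof (rule even_fibresI[OF neg])
    fix p assume "p \<notin> bad ?f \<union> bad ?g \<union> bad g"
    then have fin: "finite (?f -` {p})" "finite (?g -` {p})" "finite (g -` {p})"
      and ev: "even (card (?f -` {p}))" "even (card (?g -` {p}))" "even (card (g -` {p}))"
      by (auto simp: bad_def)
    have split: "card (h -` {p}) = card (h -` {p} \<inter> K) + card (h -` {p} - K)" if "finite (h -` {p})"
      for h :: "'m \<Rightarrow> real^'d"
      using card_Int_Diff[OF that] .
    have on_K: "?f -` {p} \<inter> K = f -` {p} \<inter> K" "?g -` {p} \<inter> K = g -` {p} \<inter> K"
      using K(1) by auto
    have off_K: "?f -` {p} - K = ?g -` {p} - K" "f -` {p} - K = g -` {p} - K"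
      using eq by auto
    \<comment> \<open>The fibre of \<open>f\<close> is assembled from that of \<open>?f\<close>
      inside \<open>K\<close> and that of \<open>g\<close> outside, which gives its finiteness
      first.\<close>
    have "finite (f -` {p} \<inter> K)" "finite (f -` {p} - K)"
      using fin on_K off_K by (metis finite_Int, metis finite_Diff)
    then have finf: "finite (f -` {p})" by (metis Int_Diff_Un finite_UnI)
    show "finite (f -` {p}) \<and> even (card (f -` {p}))"
      using split[OF fin(1)] split[OF fin(2)] split[OF fin(3)] split[OF finf] ev finf on_K off_K by simp
  qed
qed

lemma even_fibres_closed_manifold:
  fixes A :: "('m::{t2_space,second_countable_topology}, real^'d) chart set" and f :: "'m \<Rightarrow> real^'d"
  assumes A: "closed_manifold A" and f: "Ck_map (Suc 0) A f"
  shows "even_fibres f"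
proof -
  have comp: "compact (UNIV :: 'm set)" and atlas: "smooth_atlas A"
    using A by (auto simp: closed_manifold_def)
  \<comment> \<open>The last clause strips one cutoff factor from an arbitrary map; the induction
    below applies it to partial products.\<close>
  have "\<exists>U \<rho>. open U \<and> x \<in> U \<and> (\<forall>y\<in>U. \<rho> y = 1) \<and> Ck_map (Suc 0) A \<rho> \<and>
      (\<forall>g :: 'm \<Rightarrow> real^'d. Ck_map (Suc 0) A g \<longrightarrow> even_fibres (\<lambda>y. (1 - \<rho> y) *\<^sub>R g y) \<longrightarrow> even_fibres g)"
    for x
  proof -
    obtain \<kappa> where \<kappa>: "\<kappa> \<in> A" "x \<in> fst \<kappa>" by (rule smooth_atlas_cover[OF atlas])
    obtain U and \<rho> :: "'m \<Rightarrow> real" and K and \<sigma> :: "'m \<Rightarrow> real" and K' where b: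
      "open U" "x \<in> U" "\<And>y. y \<in> U \<Longrightarrow> \<rho> y = 1" "\<And>y. y \<in> K \<Longrightarrow> \<sigma> y = 1"
      "compact K" "K \<subseteq> fst \<kappa>" "\<And>y. y \<notin> K \<Longrightarrow> \<rho> y = 0"
      "compact K'" "K' \<subseteq> fst \<kappa>" "\<And>y. y \<notin> K' \<Longrightarrow> \<sigma> y = 0"
      "Ck_map (Suc (Suc 0)) A \<rho>" "Ck_map (Suc (Suc 0)) A \<sigma>" "U \<subseteq> K"
      using manifold_bump[OF atlas \<kappa>] by blast
    have \<rho>: "Ck_map (Suc 0) A \<rho>" and \<sigma>: "Ck_map (Suc 0) A \<sigma>"
      using b(11,12) Ck_map_le by (blast intro: le_SucI)+
    have "even_fibres g" if g: "Ck_map (Suc 0) A g" "even_fibres (\<lambda>y. (1 - \<rho> y) *\<^sub>R g y)" for g :: "'m \<Rightarrow> real^'d"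
      by (rule even_fibres_local_change[OF atlas \<kappa>(1) b(4,8,9,10) \<sigma> g(1)
            Ck_map_scaleR[OF atlas Ck_map_const_diff[OF atlas \<rho>] g(1)] _ g(2)])
        (auto simp: b(7))
    with b(1-3) \<rho> show ?thesis by blast
  qed
  then obtain U \<rho> where U: "\<And>x. open (U x)" "\<And>x. x \<in> U x" "\<And>x y. y \<in> U x \<Longrightarrow> \<rho> x y = 1"
    "\<And>x. Ck_map (Suc 0) A (\<rho> x)"
    "\<And>x (g :: 'm \<Rightarrow> real^'d). Ck_map (Suc 0) A g \<Longrightarrow> even_fibres (\<lambda>y. (1 - \<rho> x y) *\<^sub>R g y) \<Longrightarrow> even_fibres g"
    by metis
  obtain X where X: "finite X" "UNIV \<subseteq> (\<Union>x\<in>X. U x)"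
  proof (rule compactE_image[OF comp, of UNIV U])
    show "UNIV \<subseteq> (\<Union>x\<in>UNIV. U x)" using U(2) by blast
  qed (use U(1) that in auto)
  have step: "even_fibres g" if "finite Y" "Ck_map (Suc 0) A g"
    "even_fibres (\<lambda>y. (\<Prod>x\<in>Y. 1 - \<rho> x y) *\<^sub>R g y)" for Y and g :: "'m \<Rightarrow> real^'d"
    using that
  proof (induction Y arbitrary: g rule: finite_induct)
    case empty
    then show ?case by simp
  next
    case (insert x Y)
    have g: "Ck_map (Suc 0) A (\<lambda>y. (1 - \<rho> x y) *\<^sub>R g y)"
      by (rule Ck_map_scaleR[OF atlas Ck_map_const_diff[OF atlas U(4)] insert.prems(1)])
    have "(\<Prod>x\<in>insert x Y. 1 - \<rho> x y) *\<^sub>R g y = (\<Prod>x\<in>Y. 1 - \<rho> x y) *\<^sub>R (1 - \<rho> x y) *\<^sub>R g y" for y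
      using insert.hyps by (simp add: mult.commute)
    then have "even_fibres (\<lambda>y. (\<Prod>x\<in>Y. 1 - \<rho> x y) *\<^sub>R (1 - \<rho> x y) *\<^sub>R g y)"
      using insert.prems(2) by (simp only:)
    from insert.IH[OF g this] show ?case by (rule U(5)[OF insert.prems(1)])
  qed
  \<comment> \<open>Every point lies in some \<open>U x\<close>, so the full product is the zero
    map, whose fibres over non-zero values are empty.\<close>
  have "(\<Prod>x\<in>X. 1 - \<rho> x y) = 0" for y
  proof -
    obtain x where "x \<in> X" "y \<in> U x" using X(2) by blast
    then show ?thesis using X(1) U(3) by (auto intro!: prod_zero)
  qed
  then have "even_fibres (\<lambda>y. (\<Prod>x\<in>X. 1 - \<rho> x y) *\<^sub>R f y)"
    by (intro even_fibresI[of "{0}"]) (auto simp: vimage_def)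
  then show ?thesis by (rule step[OF X(1) f])
qed

text \<open>Near \<open>x\<close> the map is injective, so by invariance of domain its values fill
  an open set, which is not negligible. One of these values is not critical and has an even fibre;
  being nonempty, this fibre has a second point. As the value has to be generic, neither point need
  be \<open>x\<close> itself.\<close>

lemma second_regular_preimage:
  fixes A :: "('m::{t2_space,second_countable_topology}, real^'d) chart set" and f :: "'m \<Rightarrow> real^'d"
  assumes A: "closed_manifold A" and f: "Ck_map (Suc 0) A f"
    and \<kappa>: "\<kappa> \<in> A" "x \<in> fst \<kappa>" and reg: "det (jacobian (\<lambda>u. f (chart_inv \<kappa> u)) (snd \<kappa> x)) \<noteq> 0"
  obtains y z \<eta> \<zeta> where "y \<noteq> z" "f y = f z" "\<eta> \<in> A" "\<zeta> \<in> A" "y \<in> fst \<eta>" "z \<in> fst \<zeta>"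
    "det (jacobian (\<lambda>u. f (chart_inv \<eta> u)) (snd \<eta> y)) \<noteq> 0"
    "det (jacobian (\<lambda>u. f (chart_inv \<zeta> u)) (snd \<zeta> z)) \<noteq> 0"
proof -
  have comp: "compact (UNIV :: 'm set)" and atlas: "smooth_atlas A"
    using A by (auto simp: closed_manifold_def)
  let ?f = "\<lambda>\<eta> u. f (chart_inv \<eta> u)"
  have fC: "Ck_on (Suc 0) (snd \<eta> ` fst \<eta>) (?f \<eta>)" if "\<eta> \<in> A" for \<eta>
    using f that by (simp add: Ck_map_def)
  \<comment> \<open>A finite subatlas keeps the union of the critical values negligible.\<close>
  obtain A0 where A0: "A0 \<subseteq> A" "finite A0" "UNIV \<subseteq> (\<Union>\<eta>\<in>A0. fst \<eta>)"
    by (rule compactE_image[OF comp, of A fst])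
      (use smooth_atlas_chartD(1)[OF atlas] atlas in \<open>auto simp: smooth_atlas_def\<close>)
  let ?crit = "\<lambda>\<eta>. ?f \<eta> ` {u \<in> snd \<eta> ` fst \<eta>. det (jacobian (?f \<eta>) u) = 0}"
  let ?bad = "{p. \<not> (finite (f -` {p}) \<and> even (card (f -` {p})))} \<union> (\<Union>\<eta>\<in>A0. ?crit \<eta>)"
  have "negligible (?crit \<eta>)" if "\<eta> \<in> A0" for \<eta>
    using fC[of \<eta>] A0(1) that by (intro negligible_critical_values) auto
  then have bad: "negligible ?bad"
    using even_fibres_closed_manifold[OF A f] A0(2) by (auto simp: even_fibres_def)
  note c = smooth_atlas_chartD[OF atlas \<kappa>(1)]
  obtain d e where d: "0 < d" "0 < e" "ball (snd \<kappa> x) d \<subseteq> snd \<kappa> ` fst \<kappa>"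
    "\<And>u v. u \<in> ball (snd \<kappa> x) d \<Longrightarrow> v \<in> ball (snd \<kappa> x) d \<Longrightarrow> e * norm (u - v) \<le> norm (?f \<kappa> u - ?f \<kappa> v)"
    using Ck_on_local_lower_bound[OF c(2) fC[OF \<kappa>(1)] _ reg] \<kappa>(2) by blast
  let ?W = "?f \<kappa> ` ball (snd \<kappa> x) d"
  have "open ?W"
  proof (rule invariance_of_domain)
    show "continuous_on (ball (snd \<kappa> x) d) (?f \<kappa>)"
      using Ck_on_continuous_on[OF fC[OF \<kappa>(1)]] d(3) by (rule continuous_on_subset)
    show "inj_on (?f \<kappa>) (ball (snd \<kappa> x) d)"
    proof (rule inj_onI)
      fix u v assume uv: "u \<in> ball (snd \<kappa> x) d" "v \<in> ball (snd \<kappa> x) d" "?f \<kappa> u = ?f \<kappa> v"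
      have "e * norm (u - v) \<le> 0" using d(4)[OF uv(1,2)] uv(3) by simp
      then show "u = v" using d(2) by (simp add: mult_le_0_iff)
    qed
  qed simp
  moreover have "?W \<noteq> {}" using d(1) by simp
  ultimately have "\<not> negligible ?W" by (rule open_not_negligible)
  then have "\<not> ?W \<subseteq> ?bad" using negligible_subset[OF bad] by blast
  then obtain p where p: "p \<in> ?W" "p \<notin> ?bad" by blast
  then obtain y where y: "f y = p" by blast
  have fin: "finite (f -` {p})" and ev: "even (card (f -` {p}))" using p(2) by auto
  have "f -` {p} \<noteq> {y}" using ev by auto
  then obtain z where z: "f z = p" "z \<noteq> y" using y by blast
  have chart: "\<exists>\<eta>\<in>A. w \<in> fst \<eta> \<and> det (jacobian (?f \<eta>) (snd \<eta> w)) \<noteq> 0" if w: "f w = p" for w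
  proof -
    obtain \<eta> where \<eta>: "\<eta> \<in> A0" "w \<in> fst \<eta>" using A0(3) by blast
    then have "\<eta> \<in> A" using A0(1) by blast
    note e = smooth_atlas_chartD[OF atlas this]
    have "p \<notin> ?crit \<eta>" using p(2) \<eta>(1) by blast
    then have "det (jacobian (?f \<eta>) (snd \<eta> w)) \<noteq> 0" using e(5)[OF \<eta>(2)] w \<eta>(2) by force
    with \<open>\<eta> \<in> A\<close> \<eta>(2) show ?thesis by blast
  qed
  from chart[OF y] chart[OF z(1)] show ?thesis using that[of y z] y z by metis
qed

section \<open>Contact sets near a non-degenerate point\<close>

definition grad1 :: "((real^'d) \<times> (real^'e) \<Rightarrow> real) \<Rightarrow> (real^'d) \<times> (real^'e) \<Rightarrow> real^'d"
  where "grad1 f z = (\<chi> i. dir_deriv f (axis i 1, 0) z)"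

lemma grad1_inner:
  assumes "f differentiable (at z)"
  shows "dir_deriv f (w, 0) z = grad1 f z \<bullet> w"
proof -
  note l = has_derivative_linear[OF differentiable_has_derivative_dir[OF assms]]
  have eq: "(w, 0) = (\<Sum>i\<in>UNIV. (w $ i) *\<^sub>R (axis i 1, 0))"
    using basis_expansion[of w] by (simp add: prod_eq_iff fst_sum snd_sum scalar_mult_eq_scaleR)
  have "dir_deriv f (w, 0) z = (\<Sum>i\<in>UNIV. w $ i * dir_deriv f (axis i 1, 0) z)"
    by (subst eq) (simp add: linear_sum[OF l] linear_scale[OF l] del: scaleR_Pair)
  then show ?thesis by (simp add: grad1_def inner_vec_def mult.commute)
qed

lemma Ck_on_grad1:
  assumes "open S" "Ck_on (Suc k) S f"
  shows "Ck_on k S (grad1 f)"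
  by (rule Ck_on_vec[OF assms(1)]) (use assms(2) in \<open>simp add: grad1_def\<close>)

text \<open>A concave paraboloid with value 0 and gradient \<open>p\<close> at \<open>u0\<close>.
  Subtracting it adds \<open>L\<close> times the identity to the Hessian in the first variable, so a
  large \<open>L\<close> makes up for missing convexity.\<close>

definition tilt :: "'a::real_inner \<Rightarrow> real \<Rightarrow> 'a \<Rightarrow> 'a \<Rightarrow> real"
  where "tilt p L u0 u = p \<bullet> (u - u0) - L / 2 * (norm (u - u0))\<^sup>2"

text \<open>The minimiser of \<open>f(\<cdot>, v) - tilt\<close> solves \<open>u = u0 + (p - grad1 f (u, v)) / L\<close>,
  a contraction for large \<open>L\<close>; the same equation makes it bi-Lipschitz in \<open>v\<close>.\<close>

lemma local_contact:
  fixes f :: "(real^'d) \<times> (real^'d) \<Rightarrow> real"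
  assumes "open \<Omega>" and f: "Ck_on (Suc (Suc 0)) \<Omega> f" and z0: "(u0, v0) \<in> \<Omega>"
    and reg: "det (jacobian (\<lambda>v. grad1 f (u0, v)) v0) \<noteq> 0"
  shows "\<exists>\<Lambda> r0. 0 < \<Lambda> \<and> 0 < r0 \<and> (\<forall>L r. \<Lambda> \<le> L \<longrightarrow> 0 < r \<longrightarrow> r \<le> r0 \<longrightarrow> (\<exists>s>0. \<exists>S e. 0 < e \<and> cball u0 r \<times> ball v0 s \<subseteq> \<Omega> \<and> S v0 = u0 \<and>
       (\<forall>v\<in>ball v0 s. S v \<in> cball u0 r \<and> (\<forall>u\<in>cball u0 r. u \<noteq> S v \<longrightarrow>
          f (S v, v) - tilt (grad1 f (u0, v0)) L u0 (S v) < f (u, v) - tilt (grad1 f (u0, v0)) L u0 u)) \<and>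
       (\<forall>v\<in>ball v0 s. \<forall>w\<in>ball v0 s. norm (S v - S w) \<le> norm (v - w) \<and> e * norm (v - w) \<le> norm (S v - S w))))"
proof -
  let ?H = "grad1 f" and ?z0 = "(u0, v0)"
  define p where "p = ?H ?z0"
  have HC: "Ck_on (Suc 0) \<Omega> ?H" by (rule Ck_on_grad1[OF assms(1) f])
  let ?D = "\<lambda>w. dir_deriv ?H w ?z0"
  have HD: "(?H has_derivative ?D) (at ?z0)" by (rule Ck_on_has_derivative[OF HC z0])
  have "((\<lambda>v. (u0, v)) has_derivative (\<lambda>w. (0, w))) (at v0)"
    by (auto intro!: derivative_eq_intros)
  from has_derivative_compose[OF this HD]
  have D2: "((\<lambda>v. ?H (u0, v)) has_derivative (\<lambda>w. ?D (0, w))) (at v0)" .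
  have "inj (\<lambda>w. ?D (0, w))"
    using reg det_nz_iff_inj[OF has_derivative_linear[OF D2]] by (simp add: jacobian_eq[OF D2])
  then obtain b where b: "0 < b" "\<And>w. b * norm w \<le> norm (?D (0, w))"
    using linear_inj_bounded_below_pos[OF has_derivative_linear[OF D2]] by blast
  obtain K where K: "0 < K" "\<And>w. norm (?D w) \<le> K * norm w"
    using bounded_linear.pos_bounded[OF has_derivative_bounded_linear[OF HD]] by (metis mult.commute)
  have b2: "0 < b / 2" using b(1) by simp
  obtain d where d: "0 < d" "ball ?z0 d \<subseteq> \<Omega>"
    "\<And>x y. x \<in> ball ?z0 d \<Longrightarrow> y \<in> ball ?z0 d \<Longrightarrow> norm (?H x - ?H y - ?D (x - y)) \<le> b / 2 * norm (x - y)"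
    using Ck_on_strict_derivative[OF assms(1) HC z0 b2] by blast
  define M where "M = K + b / 2"
  have M: "0 < M" using K(1) b(1) by (simp add: M_def)
  have lip: "norm (?H x - ?H y) \<le> M * norm (x - y)" if "x \<in> ball ?z0 d" "y \<in> ball ?z0 d" for x y
  proof -
    have "norm (?H x - ?H y) \<le> norm (?H x - ?H y - ?D (x - y)) + norm (?D (x - y))"
      using norm_triangle_sub[of "?H x - ?H y" "?D (x - y)"] by simp
    then show ?thesis
      using d(3)[OF that] K(2)[of "x - y"] by (simp add: M_def distrib_right)
  qed
  \<comment> \<open>With \<open>u\<close> fixed, only the block of the derivative in the second
    variable enters, and this is the block assumed invertible.\<close>
  have low: "b / 2 * norm (v - w) \<le> norm (?H (u, v) - ?H (u, w))"
    if "(u, v) \<in> ball ?z0 d" "(u, w) \<in> ball ?z0 d" for u v w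
  proof -
    have "norm (?D (0, v - w)) \<le> norm (?H (u, v) - ?H (u, w)) + norm (?H (u, v) - ?H (u, w) - ?D (0, v - w))"
      using norm_triangle_sub[of "?D (0, v - w)" "?H (u, v) - ?H (u, w)"] by (simp add: norm_minus_commute)
    then show ?thesis
      using d(3)[OF that] b(2)[of "v - w"] by (simp add: norm_Pair)
  qed
  show ?thesis
  \<comment> \<open>\<open>L \<ge> 2 * M\<close> makes the fixed point map contract by 1/2, and
    \<open>r \<le> d / 2\<close> keeps both variables where the estimates hold. Whole ranges of
    \<open>L\<close> and \<open>r\<close> are claimed because two contact points will have to share
    one tilt.\<close>
  proof (rule exI[of _ "2 * M"], rule exI[of _ "d / 2"], intro conjI allI impI)
    show "0 < 2 * M" "0 < d / 2" using M d(1) by auto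
    fix L r assume L: "2 * M \<le> L" and r: "0 < r" "r \<le> d / 2"
    have L0: "0 < L" using L M by simp
    have mem: "(u, v) \<in> ball ?z0 d" if "u \<in> cball u0 r" "v \<in> ball v0 r" for u v
    proof -
      have "dist ?z0 (u, v) \<le> dist u0 u + dist v0 v"
        unfolding dist_Pair_Pair by (rule sqrt_sum_squares_le_sum) auto
      also have "\<dots> < d" using that r by simp
      finally show ?thesis by simp
    qed
    define T where "T v u = u0 + (1 / L) *\<^sub>R (p - ?H (u, v))" for v u
    have normT: "norm ((1 / L) *\<^sub>R w) = norm w / L" for w :: "real^'d" using L0 by simp
    have pairn: "norm ((u, v) - (u', v')) \<le> norm (u - u') + norm (v - v')" for u u' v v' :: "real^'d"
      by (simp add: norm_Pair_le)
    have "\<exists>!u. u \<in> cball u0 r \<and> T v u = u" if v: "v \<in> ball v0 r" for v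
    proof (rule Banach_fix[where c = "1/2"])
      show "T v ` cball u0 r \<subseteq> cball u0 r"
      proof
        fix x assume "x \<in> T v ` cball u0 r"
        then obtain u where u: "u \<in> cball u0 r" "x = T v u" by blast
        have "norm (p - ?H (u, v)) \<le> M * norm (?z0 - (u, v))"
          unfolding p_def by (rule lip) (use mem[OF u(1) v] d(1) in auto)
        also have "\<dots> \<le> M * (norm (u0 - u) + norm (v0 - v))"
          using M pairn by (intro mult_left_mono) auto
        also have "\<dots> \<le> M * (r + r)"
          using M u(1) v by (intro mult_left_mono add_mono) (auto simp: dist_norm)
        also have "\<dots> \<le> L * r" using mult_right_mono[OF L, of r] r by simp
        finally have "norm (p - ?H (u, v)) / L \<le> r" using L0 by (simp add: field_simps)
        then show "x \<in> cball u0 r"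
          unfolding u(2) T_def mem_cball dist_norm using normT[of "p - ?H (u, v)"]
          by (simp add: norm_minus_commute[of u0] abs_of_pos[OF L0])
      qed
      show "dist (T v x) (T v y) \<le> 1/2 * dist x y" if "x \<in> cball u0 r" "y \<in> cball u0 r" for x y
      proof -
        have "T v x - T v y = (1 / L) *\<^sub>R (?H (y, v) - ?H (x, v))"
          by (simp add: T_def scaleR_diff_right[symmetric])
        then have "dist (T v x) (T v y) = norm (?H (y, v) - ?H (x, v)) / L"
          using L0 by (simp add: dist_norm)
        also have "\<dots> \<le> M * norm ((y, v) - (x, v)) / L"
          using L0 by (intro divide_right_mono lip mem that v) auto
        also have "\<dots> = M / L * dist x y" by (simp add: norm_Pair dist_norm norm_minus_commute)
        also have "\<dots> \<le> 1/2 * dist x y"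
          using L L0 by (intro mult_right_mono) (auto simp: field_simps)
        finally show ?thesis .
      qed
    qed (use r in \<open>auto simp: complete_eq_closed\<close>)
    then obtain S where S: "\<And>v. v \<in> ball v0 r \<Longrightarrow> S v \<in> cball u0 r" "\<And>v. v \<in> ball v0 r \<Longrightarrow> T v (S v) = S v"
      "\<And>v u. v \<in> ball v0 r \<Longrightarrow> u \<in> cball u0 r \<Longrightarrow> T v u = u \<Longrightarrow> u = S v"
      by metis
    have crit: "?H (S v, v) = p - L *\<^sub>R (S v - u0)" if "v \<in> ball v0 r" for v
    proof -
      have "L *\<^sub>R (S v - u0) = L *\<^sub>R (T v (S v) - u0)" using S(2)[OF that] by simp
      also have "\<dots> = p - ?H (S v, v)" using L0 by (simp add: T_def)
      finally show ?thesis by simp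
    qed
    have min: "f (S v, v) - tilt p L u0 (S v) < f (u, v) - tilt p L u0 u"
      if v: "v \<in> ball v0 r" and u: "u \<in> cball u0 r" "u \<noteq> S v" for v u
    proof -
      let ?w = "u - S v"
      let ?x = "\<lambda>t. S v + t *\<^sub>R ?w"
      let ?g = "\<lambda>t. f (?x t, v) - tilt p L u0 (?x t)"
      have seg: "?x t \<in> cball u0 r" if "0 \<le> t" "t \<le> 1" for t
      proof -
        have "?x t = (1 - t) *\<^sub>R S v + t *\<^sub>R u" by (simp add: algebra_simps)
        then show ?thesis using convexD[OF convex_cball S(1)[OF v] u(1), of "1 - t" t] that by simp
      qed
      have "\<exists>t. 0 < t \<and> t < 1 \<and> ?g 1 - ?g 0 = (1 - 0) * (?H (?x t, v) \<bullet> ?w - (p - L *\<^sub>R (?x t - u0)) \<bullet> ?w)"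
      proof (rule MVT2)
        fix t :: real assume t: "0 \<le> t" "t \<le> 1"
        have in\<Omega>: "(?x t, v) \<in> \<Omega>" using mem[OF seg[OF t] v] d(2) by blast
        have eq: "(S v, v) + t *\<^sub>R (?w, 0) = (?x t, v)" for t by simp
        have "((\<lambda>t. f ((S v, v) + t *\<^sub>R (?w, 0))) has_real_derivative dir_deriv f (?w, 0) ((S v, v) + t *\<^sub>R (?w, 0))) (at t)"
          by (rule dir_deriv_real_line) (use Ck_on_differentiable[OF f in\<Omega>] in simp)
        then have 1: "((\<lambda>t. f (?x t, v)) has_real_derivative ?H (?x t, v) \<bullet> ?w) (at t)"
          unfolding eq grad1_inner[OF Ck_on_differentiable[OF f in\<Omega>]] .
        have "((\<lambda>t. tilt p L u0 (?x t)) has_derivative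
           (\<lambda>h. (p \<bullet> ?w - L * ((?x t - u0) \<bullet> ?w)) * h)) (at t)"
          unfolding tilt_def power2_norm_eq_inner
          by (auto intro!: derivative_eq_intros simp: inner_commute algebra_simps)
        then have 2: "((\<lambda>t. tilt p L u0 (?x t)) has_real_derivative (p - L *\<^sub>R (?x t - u0)) \<bullet> ?w) (at t)"
          unfolding has_field_derivative_def by (simp add: inner_diff_left)
        show "(?g has_real_derivative ?H (?x t, v) \<bullet> ?w - (p - L *\<^sub>R (?x t - u0)) \<bullet> ?w) (at t)"
          by (rule DERIV_diff[OF 1 2])
      qed simp
      then obtain t where t: "0 < t" "t < 1"
        "?g 1 - ?g 0 = ?H (?x t, v) \<bullet> ?w - (p - L *\<^sub>R (?x t - u0)) \<bullet> ?w" by auto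
      \<comment> \<open>Criticality of \<open>S v\<close> cancels the terms of order zero; the
        quadratic part with factor \<open>L * t\<close> then beats the Lipschitz error with factor
        \<open>M * t\<close>.\<close>
      have "?g 1 - ?g 0 = (?H (?x t, v) - ?H (S v, v)) \<bullet> ?w + L * t * (?w \<bullet> ?w)"
        unfolding t(3) crit[OF v] by (simp add: inner_diff_left inner_add_left algebra_simps)
      moreover have "\<bar>(?H (?x t, v) - ?H (S v, v)) \<bullet> ?w\<bar> \<le> M * t * (?w \<bullet> ?w)"
      proof -
        have "norm (?H (?x t, v) - ?H (S v, v)) \<le> M * norm ((?x t, v) - (S v, v))"
          using t S(1)[OF v] by (intro lip mem seg v) auto
        also have "\<dots> = M * t * norm ?w" using t(1) by (simp add: norm_Pair)
        finally have "norm (?H (?x t, v) - ?H (S v, v)) * norm ?w \<le> M * t * norm ?w * norm ?w"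
          by (intro mult_right_mono) auto
        moreover have "norm ?w * norm ?w = ?w \<bullet> ?w" by (simp add: power2_norm_eq_inner flip: power2_eq_square)
        ultimately show ?thesis
          using Cauchy_Schwarz_ineq2[of "?H (?x t, v) - ?H (S v, v)" ?w] by (simp add: mult.assoc)
      qed
      moreover have "M * t * (?w \<bullet> ?w) < L * t * (?w \<bullet> ?w)"
        using u(2) t(1) L M by (intro mult_strict_right_mono) auto
      ultimately have "0 < ?g 1 - ?g 0" by linarith
      then show ?thesis by simp
    qed
    \<comment> \<open>Both bounds compare the critical equations at \<open>v\<close> and
      \<open>w\<close>. Above, \<open>L \<ge> 2 * M\<close> absorbs the dependence on the first
      variable; below, a change of \<open>v\<close> alone is felt with factor
      \<open>b / 2\<close>.\<close>
    have bilip: "norm (S v - S w) \<le> norm (v - w)" "b / 2 / (L + M) * norm (v - w) \<le> norm (S v - S w)"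
      if v: "v \<in> ball v0 r" and w: "w \<in> ball v0 r" for v w
    proof -
      have diff: "?H (S v, v) - ?H (S w, w) = - (L *\<^sub>R (S v - S w))"
        unfolding crit[OF v] crit[OF w] by (simp add: algebra_simps)
      have "L * norm (S v - S w) = norm (?H (S v, v) - ?H (S w, w))"
        unfolding diff using L0 by simp
      also have "\<dots> \<le> M * norm ((S v, v) - (S w, w))" by (intro lip mem S v w)
      also have "\<dots> \<le> M * (norm (S v - S w) + norm (v - w))"
        using M pairn by (intro mult_left_mono) auto
      finally have "L * norm (S v - S w) \<le> M * norm (S v - S w) + M * norm (v - w)"
        by (simp add: distrib_left)
      moreover have "2 * M * norm (S v - S w) \<le> L * norm (S v - S w)"
        using L by (intro mult_right_mono) auto
      ultimately have "M * norm (S v - S w) \<le> M * norm (v - w)" by simp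
      then show "norm (S v - S w) \<le> norm (v - w)" using M by simp
      have "b / 2 * norm (v - w) \<le> norm (?H (S v, v) - ?H (S v, w))"
        by (intro low mem S v w)
      also have "\<dots> \<le> norm (?H (S v, v) - ?H (S w, w)) + norm (?H (S w, w) - ?H (S v, w))"
        using norm_triangle_ineq[of "?H (S v, v) - ?H (S w, w)" "?H (S w, w) - ?H (S v, w)"] by simp
      also have "norm (?H (S w, w) - ?H (S v, w)) \<le> M * norm ((S w, w) - (S v, w))" by (intro lip mem S v w)
      also have "norm ((S w, w) - (S v, w)) = norm (S v - S w)" by (simp add: norm_Pair norm_minus_commute)
      also have "norm (?H (S v, v) - ?H (S w, w)) = L * norm (S v - S w)"
        unfolding diff using L0 by simp
      finally have "b / 2 * norm (v - w) \<le> (L + M) * norm (S v - S w)"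
        by (simp add: distrib_right)
      then show "b / 2 / (L + M) * norm (v - w) \<le> norm (S v - S w)"
        using L0 M by (simp add: field_simps)
    qed
    have "T v0 u0 = u0" by (simp add: T_def p_def)
    then have "S v0 = u0" using S(3)[of v0 u0] r by auto
    moreover have "cball u0 r \<times> ball v0 r \<subseteq> \<Omega>" using mem d(2) by blast
    moreover have "0 < b / 2 / (L + M)" using b(1) L0 M by simp
    ultimately show "\<exists>s>0. \<exists>S e. 0 < e \<and> cball u0 r \<times> ball v0 s \<subseteq> \<Omega> \<and> S v0 = u0 \<and>
       (\<forall>v\<in>ball v0 s. S v \<in> cball u0 r \<and> (\<forall>u\<in>cball u0 r. u \<noteq> S v \<longrightarrow>
          f (S v, v) - tilt (grad1 f (u0, v0)) L u0 (S v) < f (u, v) - tilt (grad1 f (u0, v0)) L u0 u)) \<and>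
       (\<forall>v\<in>ball v0 s. \<forall>w\<in>ball v0 s. norm (S v - S w) \<le> norm (v - w) \<and> e * norm (v - w) \<le> norm (S v - S w))"
      using r(1) S(1) min bilip unfolding p_def[symmetric]
      by (intro exI[of _ r] exI[of _ S] exI[of _ "b / 2 / (L + M)"] conjI ballI impI) auto
  qed
qed

section \<open>Duality for plans carried by the graph of a map of the second variable\<close>

lemma transport_plan_prob:
  fixes \<gamma> :: "('m::topological_space \<times> 'n::topological_space) measure"
  assumes "prob_space \<nu>" "\<gamma> \<in> transport_plans \<mu> \<nu>"
  shows "prob_space \<gamma>"
proof
  have s: "sets \<gamma> = sets borel" "distr \<gamma> borel snd = \<nu>" using assms(2) by (auto simp: transport_plans_def)
  have "snd \<in> measurable \<gamma> borel"
    using borel_measurable_continuous_onI[OF continuous_on_snd[OF continuous_on_id]]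
    by (simp add: measurable_cong_sets[OF s(1) refl])
  then have "emeasure \<nu> (space \<nu>) = emeasure \<gamma> (space \<gamma>)"
    unfolding s(2)[symmetric] by (subst emeasure_distr) (auto intro!: arg_cong2[where f = emeasure])
  then show "emeasure \<gamma> (space \<gamma>) = 1" using assms(1) by (simp add: prob_space.emeasure_space_1)
qed

text \<open>The integral of \<open>D = c - \<phi> - \<psi>\<close> against a plan is its cost minus
  a number fixed by the marginals. For every plan \<open>D\<close> is almost everywhere
  non-negative, and there zero exactly on the graph of \<open>T\<close>, so optimality means
  concentration on that graph; such a plan is recovered from its second marginal. Comparing points
  of \<open>U\<close> and \<open>V\<close> is enough, since the marginals force every plan onto
  their product.\<close>

lemma unique_optimal_graph_plan:
  fixes c :: "('m::{t2_space,second_countable_topology} \<times> 'n::{t2_space,second_countable_topology}) \<Rightarrow> real"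
  assumes \<nu>: "prob_space \<nu>" "sets \<nu> = sets borel" and T: "T \<in> borel_measurable borel"
    and c: "c \<in> borel_measurable borel" "\<And>z. 0 \<le> c z" "\<And>z. c z \<le> C"
    and \<phi>: "\<phi> \<in> borel_measurable borel" "\<And>x. \<bar>\<phi> x\<bar> \<le> C"
    and U: "U \<in> sets borel" and V: "V \<in> sets borel" "AE y in \<nu>. y \<in> V"
    and TU: "\<And>y. y \<in> V \<Longrightarrow> T y \<in> U"
    and min: "\<And>x y. y \<in> V \<Longrightarrow> x \<in> U \<Longrightarrow> x \<noteq> T y \<Longrightarrow> c (T y, y) - \<phi> (T y) < c (x, y) - \<phi> x"
  shows "optimal_plan c (distr \<nu> borel T) \<nu> \<gamma> \<longleftrightarrow> \<gamma> = distr \<nu> borel (\<lambda>y. (T y, y))"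
proof -
  let ?\<mu> = "distr \<nu> borel T" and ?\<gamma> = "distr \<nu> borel (\<lambda>y. (T y, y))"
  \<comment> \<open>The potential conjugate to \<open>\<phi>\<close>: for \<open>y\<close> in
    \<open>V\<close>, the minimum over \<open>U\<close> is attained at \<open>T y\<close>.\<close>
  define \<psi> where "\<psi> y = c (T y, y) - \<phi> (T y)" for y
  define D where "D z = c z - \<phi> (fst z) - \<psi> (snd z)" for z
  interpret \<nu>: prob_space \<nu> by (rule \<nu>(1))
  have Tn: "T \<in> measurable \<nu> borel" using T by (simp add: measurable_cong_sets[OF \<nu>(2) refl])
  have graph: "(\<lambda>y. (T y, y)) \<in> borel_measurable borel"
    using T by (intro borel_measurable_Pair) auto
  then have graphn: "(\<lambda>y. (T y, y)) \<in> measurable \<nu> borel" by (simp add: measurable_cong_sets[OF \<nu>(2) refl])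
  have \<psi>: "\<psi> \<in> borel_measurable borel" unfolding \<psi>_def
    using measurable_compose[OF graph c(1)] measurable_compose[OF T \<phi>(1)] by simp
  have \<psi>b: "\<bar>\<psi> y\<bar> \<le> 2 * C" for y
    using c(2,3)[of "(T y, y)"] \<phi>(2)[of "T y"] by (auto simp: \<psi>_def abs_le_iff)
  have fsm: "(fst :: 'm \<times> 'n \<Rightarrow> 'm) \<in> borel_measurable borel" "(snd :: 'm \<times> 'n \<Rightarrow> 'n) \<in> borel_measurable borel"
    by (auto intro!: borel_measurable_continuous_onI continuous_intros)
  have \<gamma>plan: "?\<gamma> \<in> transport_plans ?\<mu> \<nu>"
  proof -
    have "distr ?\<gamma> borel fst = ?\<mu>" "distr ?\<gamma> borel snd = distr \<nu> borel (\<lambda>y. y)"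
      using distr_distr[OF fsm(1) graphn] distr_distr[OF fsm(2) graphn] by (simp_all add: comp_def)
    moreover have "distr \<nu> borel (\<lambda>y. y) = \<nu>" using \<nu>(2) by (intro distr_id2) simp
    ultimately show ?thesis by (simp add: transport_plans_def)
  qed
  have key: "transport_cost c \<gamma>' = ennreal (integral\<^sup>L \<gamma>' D + (integral\<^sup>L ?\<mu> \<phi> + integral\<^sup>L \<nu> \<psi>)) \<and>
      0 \<le> integral\<^sup>L \<gamma>' D \<and> 0 \<le> integral\<^sup>L \<gamma>' D + (integral\<^sup>L ?\<mu> \<phi> + integral\<^sup>L \<nu> \<psi>) \<and>
      (integral\<^sup>L \<gamma>' D = 0 \<longleftrightarrow> (AE z in \<gamma>'. fst z = T (snd z)))"
    if plan: "\<gamma>' \<in> transport_plans ?\<mu> \<nu>" for \<gamma>'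
  proof -
    have s: "sets \<gamma>' = sets borel" "distr \<gamma>' borel fst = ?\<mu>" "distr \<gamma>' borel snd = \<nu>"
      using plan by (auto simp: transport_plans_def)
    interpret \<gamma>': prob_space \<gamma>' by (rule transport_plan_prob[OF \<nu>(1) plan])
    note ms = measurable_cong_sets[OF s(1) refl]
    have m1: "fst \<in> measurable \<gamma>' borel" "snd \<in> measurable \<gamma>' borel" "c \<in> borel_measurable \<gamma>'"
      using fsm c(1) by (simp_all add: ms)
    have m2: "(\<lambda>z. \<phi> (fst z)) \<in> borel_measurable \<gamma>'" "(\<lambda>z. \<psi> (snd z)) \<in> borel_measurable \<gamma>'"
      using measurable_compose[OF m1(1) \<phi>(1)] measurable_compose[OF m1(2) \<psi>] by auto
    have "integrable \<gamma>' c"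
    proof (rule \<gamma>'.integrable_const_bound[of _ C])
      show "AE z in \<gamma>'. norm (c z) \<le> C"
        unfolding real_norm_def abs_of_nonneg[OF c(2)] by (intro AE_I2 c(3))
    qed (rule m1(3))
    moreover have "integrable \<gamma>' (\<lambda>z. \<phi> (fst z))" "integrable \<gamma>' (\<lambda>z. \<psi> (snd z))"
      using \<phi>(2) \<psi>b m2
      by (auto intro: \<gamma>'.integrable_const_bound[of _ C] \<gamma>'.integrable_const_bound[of _ "2 * C"])
    ultimately have i: "integrable \<gamma>' c" "integrable \<gamma>' (\<lambda>z. \<phi> (fst z))" "integrable \<gamma>' (\<lambda>z. \<psi> (snd z))" .
    have iD: "integrable \<gamma>' D" unfolding D_def using i by simp
    have "integral\<^sup>L \<gamma>' c = integral\<^sup>L \<gamma>' (\<lambda>z. D z + (\<phi> (fst z) + \<psi> (snd z)))" by (simp add: D_def)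
    also have "\<dots> = integral\<^sup>L \<gamma>' D + (integral\<^sup>L \<gamma>' (\<lambda>z. \<phi> (fst z)) + integral\<^sup>L \<gamma>' (\<lambda>z. \<psi> (snd z)))"
      using i iD by simp
    also have "integral\<^sup>L \<gamma>' (\<lambda>z. \<phi> (fst z)) = integral\<^sup>L ?\<mu> \<phi>"
      unfolding s(2)[symmetric] using m1 \<phi>(1) by (simp add: integral_distr)
    also have "integral\<^sup>L \<gamma>' (\<lambda>z. \<psi> (snd z)) = integral\<^sup>L \<nu> \<psi>"
      unfolding s(3)[symmetric] using m1 \<psi> by (simp add: integral_distr)
    finally have int: "integral\<^sup>L \<gamma>' c = integral\<^sup>L \<gamma>' D + (integral\<^sup>L ?\<mu> \<phi> + integral\<^sup>L \<nu> \<psi>)" .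
    have cost: "transport_cost c \<gamma>' = ennreal (integral\<^sup>L \<gamma>' c)"
      unfolding transport_cost_def using i(1) c(2) by (intro nn_integral_eq_integral) auto
    have nn: "0 \<le> integral\<^sup>L \<gamma>' c" using c(2) by (intro integral_nonneg_AE) auto
    have "AE y in distr \<gamma>' borel snd. y \<in> V" using V(2) by (simp only: s(3))
    then have AEV: "AE z in \<gamma>'. snd z \<in> V" by (rule AE_distrD[OF m1(2)])
    have "AE y in \<nu>. T y \<in> U" using V(2) TU by auto
    then have "AE x in distr \<gamma>' borel fst. x \<in> U"
      unfolding s(2) using Tn U by (subst AE_distr_iff) auto
    then have AEU: "AE z in \<gamma>'. fst z \<in> U" by (rule AE_distrD[OF m1(1)])
    have Dpos: "AE z in \<gamma>'. 0 \<le> D z \<and> (D z = 0 \<longleftrightarrow> fst z = T (snd z))"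
      using AEU AEV
    proof eventually_elim
      case (elim z)
      show ?case
      proof (cases "fst z = T (snd z)")
        case True
        then have "D z = 0" unfolding D_def \<psi>_def by (metis diff_diff_eq diff_self prod.collapse add_diff_cancel_left' diff_add_cancel)
        with True show ?thesis by simp
      next
        case False
        then show ?thesis using min[OF elim(2,1)] by (simp add: D_def \<psi>_def)
      qed
    qed
    have "0 \<le> integral\<^sup>L \<gamma>' D" using Dpos by (intro integral_nonneg_AE) auto
    moreover have "integral\<^sup>L \<gamma>' D = 0 \<longleftrightarrow> (AE z in \<gamma>'. D z = 0)"
      using Dpos by (intro integral_nonneg_eq_0_iff_AE iD) auto
    moreover have "(AE z in \<gamma>'. D z = 0) \<longleftrightarrow> (AE z in \<gamma>'. fst z = T (snd z))"
    proof
      show "AE z in \<gamma>'. fst z = T (snd z)" if "AE z in \<gamma>'. D z = 0"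
        using that Dpos by eventually_elim simp
      show "AE z in \<gamma>'. D z = 0" if "AE z in \<gamma>'. fst z = T (snd z)"
        using that Dpos by eventually_elim simp
    qed
    ultimately show ?thesis using cost int nn by simp
  qed
  have \<gamma>0: "integral\<^sup>L ?\<gamma> D = 0"
  proof -
    have m: "c \<in> borel_measurable borel" "(\<lambda>z :: 'm \<times> 'n. \<phi> (fst z)) \<in> borel_measurable borel"
      "(\<lambda>z :: 'm \<times> 'n. \<psi> (snd z)) \<in> borel_measurable borel"
      using c(1) measurable_compose[OF fsm(1) \<phi>(1)] measurable_compose[OF fsm(2) \<psi>] by auto
    then have "D \<in> borel_measurable borel" unfolding D_def by (intro borel_measurable_diff)
    then have "integral\<^sup>L ?\<gamma> D = (\<integral>y. D (T y, y) \<partial>\<nu>)" using graphn by (simp add: integral_distr)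
    then show ?thesis by (simp add: D_def \<psi>_def)
  qed
  show ?thesis
  proof
    assume opt: "optimal_plan c ?\<mu> \<nu> \<gamma>"
    then have plan: "\<gamma> \<in> transport_plans ?\<mu> \<nu>" and le: "transport_cost c \<gamma> \<le> transport_cost c ?\<gamma>"
      using \<gamma>plan by (auto simp: optimal_plan_def)
    have s: "sets \<gamma> = sets borel" "distr \<gamma> borel snd = \<nu>" using plan by (auto simp: transport_plans_def)
    have "integral\<^sup>L \<gamma> D \<le> 0"
      using le key[OF plan] key[OF \<gamma>plan] \<gamma>0 by (auto simp: ennreal_le_iff)
    then have AE: "AE z in \<gamma>. fst z = T (snd z)" using key[OF plan] by linarith
    have m: "snd \<in> measurable \<gamma> borel" "(\<lambda>z. z) \<in> measurable \<gamma> borel"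
      using fsm by (simp_all add: measurable_cong_sets[OF s(1) refl])
    have "\<gamma> = distr \<gamma> borel (\<lambda>z. z)" using s(1) by (intro distr_id2[symmetric]) simp
    also have "\<dots> = distr \<gamma> borel (\<lambda>z. (T (snd z), snd z))"
    proof (rule distr_cong_AE)
      show "AE z in \<gamma>. z = (T (snd z), snd z)" using AE by (auto simp: prod_eq_iff)
      show "(\<lambda>z. (T (snd z), snd z)) \<in> measurable \<gamma> borel" by (rule measurable_compose[OF m(1) graph])
    qed (use m in auto)
    also have "\<dots> = distr (distr \<gamma> borel snd) borel (\<lambda>y. (T y, y))"
      using distr_distr[OF graph m(1)] by (simp add: comp_def)
    finally show "\<gamma> = ?\<gamma>" unfolding s(2) .
  next
    assume eq: "\<gamma> = ?\<gamma>"
    have "transport_cost c ?\<gamma> \<le> transport_cost c \<gamma>'" if "\<gamma>' \<in> transport_plans ?\<mu> \<nu>" for \<gamma>'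
      using key[OF that] key[OF \<gamma>plan] \<gamma>0 by (auto simp: ennreal_le_iff)
    then show "optimal_plan c ?\<mu> \<nu> \<gamma>" unfolding eq optimal_plan_def using \<gamma>plan by blast
  qed
qed

section \<open>Products of charts\<close>

lemma chart_inv_prod_chart:
  assumes "smooth_atlas A" "smooth_atlas B" "\<kappa> \<in> A" "\<eta> \<in> B" "u \<in> snd \<kappa> ` fst \<kappa>" "v \<in> snd \<eta> ` fst \<eta>"
  shows "chart_inv (prod_chart \<kappa> \<eta>) (u, v) = (chart_inv \<kappa> u, chart_inv \<eta> v)"
proof -
  note c = smooth_atlas_chartD[OF assms(1,3)] and e = smooth_atlas_chartD[OF assms(2,4)]
  have 1: "inj_on (map_prod (snd \<kappa>) (snd \<eta>)) (fst \<kappa> \<times> fst \<eta>)"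
    by (intro map_prod_inj_on inj_on_inverseI[of _ "chart_inv \<kappa>"] inj_on_inverseI[of _ "chart_inv \<eta>"] c e)
  have 2: "map_prod (snd \<kappa>) (snd \<eta>) (chart_inv \<kappa> u, chart_inv \<eta> v) = (u, v)"
    using c(7) e(7) assms by simp
  have 3: "(chart_inv \<kappa> u, chart_inv \<eta> v) \<in> fst \<kappa> \<times> fst \<eta>"
    using c(6) e(6) assms by simp
  show ?thesis
    using inv_into_f_f[OF 1 3] unfolding 2
    unfolding chart_inv_def[of "prod_chart \<kappa> \<eta>"] by (simp add: prod_chart_def)
qed

lemma prod_chart_image: "snd (prod_chart \<kappa> \<eta>) ` fst (prod_chart \<kappa> \<eta>) = (snd \<kappa> ` fst \<kappa>) \<times> (snd \<eta> ` fst \<eta>)"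
  by (auto simp: prod_chart_def image_iff)

lemma Ck_functions_prodD:
  assumes "c \<in> Ck_functions k (prod_atlas A B)" "\<kappa> \<in> A" "\<eta> \<in> B"
  shows "Ck_on k ((snd \<kappa> ` fst \<kappa>) \<times> (snd \<eta> ` fst \<eta>)) (c \<circ> chart_inv (prod_chart \<kappa> \<eta>))"
proof -
  have "prod_chart \<kappa> \<eta> \<in> prod_atlas A B" using assms(2,3) unfolding prod_atlas_def by blast
  then show ?thesis using assms(1) unfolding Ck_functions_def prod_chart_image[symmetric] by blast
qed

lemma open_prod_chart_image:
  assumes "smooth_atlas A" "smooth_atlas B" "\<kappa> \<in> A" "\<eta> \<in> B"
  shows "open ((snd \<kappa> ` fst \<kappa>) \<times> (snd \<eta> ` fst \<eta>))"
  by (intro open_Times smooth_atlas_chartD(2)[OF assms(1,3)] smooth_atlas_chartD(2)[OF assms(2,4)])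

lemma Ck_functions_prod_continuous:
  fixes A :: "('m::t2_space, 'e::euclidean_space) chart set" and B :: "('n::t2_space, 'f::euclidean_space) chart set"
  assumes A: "smooth_atlas A" and B: "smooth_atlas B" and c: "c \<in> Ck_functions k (prod_atlas A B)"
  shows "continuous_on UNIV c"
proof -
  have "\<exists>T. open T \<and> z \<in> T \<and> continuous_on T c" for z
  proof -
    obtain \<kappa> where \<kappa>: "\<kappa> \<in> A" "fst z \<in> fst \<kappa>" by (rule smooth_atlas_cover[OF A])
    obtain \<eta> where \<eta>: "\<eta> \<in> B" "snd z \<in> fst \<eta>" by (rule smooth_atlas_cover[OF B])
    note k = smooth_atlas_chartD[OF A \<kappa>(1)] and e = smooth_atlas_chartD[OF B \<eta>(1)]
    have "continuous_on ((snd \<kappa> ` fst \<kappa>) \<times> (snd \<eta> ` fst \<eta>)) (c \<circ> chart_inv (prod_chart \<kappa> \<eta>))"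
      by (rule Ck_on_continuous_on[OF Ck_functions_prodD[OF c \<kappa>(1) \<eta>(1)]])
    moreover have "continuous_on (fst \<kappa> \<times> fst \<eta>) (map_prod (snd \<kappa>) (snd \<eta>))"
      unfolding map_prod_def case_prod_beta
      by (intro continuous_on_Pair continuous_on_compose2[OF k(3) continuous_on_fst[OF continuous_on_id]]
          continuous_on_compose2[OF e(3) continuous_on_snd[OF continuous_on_id]]) auto
    ultimately have "continuous_on (fst \<kappa> \<times> fst \<eta>)
        (\<lambda>z. (c \<circ> chart_inv (prod_chart \<kappa> \<eta>)) (map_prod (snd \<kappa>) (snd \<eta>) z))"
      by (rule continuous_on_compose2) auto
    then have "continuous_on (fst \<kappa> \<times> fst \<eta>) c"
      by (rule continuous_on_eq)
        (use chart_inv_prod_chart[OF A B \<kappa>(1) \<eta>(1)] k(5) e(5) in auto)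
    moreover have "open (fst \<kappa> \<times> fst \<eta>)" using k(1) e(1) by (rule open_Times)
    ultimately show ?thesis using \<kappa>(2) \<eta>(2) by (intro exI[of _ "fst \<kappa> \<times> fst \<eta>"]) (auto simp: mem_Times_iff)
  qed
  then have "continuous (at z) c" for z
    by (meson continuous_on_eq_continuous_at)
  then show ?thesis by (simp add: continuous_on_eq_continuous_at)
qed

text \<open>Turns non-degeneracy into regularity of the gradient map in the second variable.\<close>

lemma mixed_partials_eq_jacobian:
  assumes "open S" "Ck_on (Suc (Suc 0)) S F" "(u, v) \<in> S"
  shows "mixed_partials F (u, v) = jacobian (\<lambda>v. grad1 F (u, v)) v"
proof -
  have G: "grad1 F differentiable (at (u, v))"
    by (rule Ck_on_differentiable[OF Ck_on_grad1[OF assms(1,2)] assms(3)])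
  have "((\<lambda>v. (u, v)) has_derivative (\<lambda>w. (0, w))) (at v)"
    by (auto intro!: derivative_eq_intros)
  from has_derivative_compose[OF this differentiable_has_derivative_dir[OF G]]
  have D: "dir_deriv (\<lambda>v. grad1 F (u, v)) w v = dir_deriv (grad1 F) (0, w) (u, v)" for w
    by (rule dir_deriv_eq)
  have "mixed_partials F (u, v) $ i $ j = jacobian (\<lambda>v. grad1 F (u, v)) v $ i $ j" for i j
  proof -
    have "mixed_partials F (u, v) $ i $ j = dir_deriv (dir_deriv F (axis i 1, 0)) (0, axis j 1) (u, v)"
      unfolding mixed_partials_def by (simp add: dir_deriv_commute[OF assms])
    also have "dir_deriv F (axis i 1, 0) = (\<lambda>z. grad1 F z $ i)" by (simp add: grad1_def)
    also have "dir_deriv (\<lambda>z. grad1 F z $ i) (0, axis j 1) (u, v) = dir_deriv (grad1 F) (0, axis j 1) (u, v) $ i"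
      by (rule dir_deriv_linear_compose[OF G bounded_linear_vec_nth])
    finally show ?thesis by (simp add: jacobian_component D)
  qed
  then show ?thesis by (simp add: vec_eq_iff)
qed

section \<open>Absolutely continuous marginals\<close>

text \<open>The inverse of \<open>h\<close> on its image is Lipschitz, and Lipschitz maps preserve
  negligible sets.\<close>

lemma negligible_expanding_preimage:
  fixes h :: "'a::euclidean_space \<Rightarrow> 'a"
  assumes "0 < e" "\<And>w w'. w \<in> E \<Longrightarrow> w' \<in> E \<Longrightarrow> e * norm (w - w') \<le> norm (h w - h w')" "negligible Q"
  shows "negligible {w \<in> E. h w \<in> Q}"
proof -
  have inj: "inj_on h E"
  proof (rule inj_onI)
    fix w w' assume w: "w \<in> E" "w' \<in> E" "h w = h w'"
    have "e * norm (w - w') \<le> 0" using assms(2)[OF w(1,2)] w(3) by simp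
    then show "w = w'" using assms(1) by (simp add: mult_le_0_iff)
  qed
  have "negligible (inv_into E h ` (Q \<inter> h ` E))"
  proof (rule negligible_locally_Lipschitz_image[OF order_refl])
    show "negligible (Q \<inter> h ` E)" using assms(3) by (rule negligible_subset) simp
    fix x assume x: "x \<in> Q \<inter> h ` E"
    have "norm (inv_into E h y - inv_into E h x) \<le> 1 / e * norm (y - x)" if "y \<in> Q \<inter> h ` E" for y
      using assms(2)[of "inv_into E h y" "inv_into E h x"] that x assms(1)
      by (simp add: inv_into_into f_inv_into_f field_simps)
    then show "\<exists>T B. open T \<and> x \<in> T \<and> (\<forall>y\<in>Q \<inter> h ` E \<inter> T. norm (inv_into E h y - inv_into E h x) \<le> B * norm (y - x))"
      by (intro exI[of _ UNIV] exI[of _ "1 / e"]) auto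
  qed
  moreover have "{w \<in> E. h w \<in> Q} \<subseteq> inv_into E h ` (Q \<inter> h ` E)"
  proof clarify
    fix w assume w: "w \<in> E" "h w \<in> Q"
    then have "inv_into E h (h w) \<in> inv_into E h ` (Q \<inter> h ` E)" by blast
    then show "w \<in> inv_into E h ` (Q \<inter> h ` E)" using inv_into_f_f[OF inj w(1)] by simp
  qed
  ultimately show ?thesis by (rule negligible_subset)
qed

text \<open>\<open>Z\<close> is carried from the chart \<open>\<kappa>'\<close> into
  \<open>\<kappa>\<close> by a transition map, which is differentiable and so preserves negligible
  sets; the lower bound on \<open>h\<close> pulls the result back.\<close>

lemma negligible_chart_preimage:
  fixes A :: "('m::topological_space, 'e::euclidean_space) chart set" and h :: "'e \<Rightarrow> 'e"
  assumes A: "smooth_atlas A" and \<kappa>: "\<kappa> \<in> A" and \<kappa>': "\<kappa>' \<in> A"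
    and h: "0 < e" "\<And>w w'. w \<in> E \<Longrightarrow> w' \<in> E \<Longrightarrow> e * norm (w - w') \<le> norm (h w - h w')"
    "\<And>w. w \<in> E \<Longrightarrow> h w \<in> snd \<kappa> ` fst \<kappa>"
    and Z: "negligible Z"
  shows "negligible {w \<in> E. chart_inv \<kappa> (h w) \<in> fst \<kappa>' \<and> snd \<kappa>' (chart_inv \<kappa> (h w)) \<in> Z}"
proof -
  note c = smooth_atlas_chartD[OF A \<kappa>] and c' = smooth_atlas_chartD[OF A \<kappa>']
  let ?\<tau> = "\<lambda>u. snd \<kappa> (chart_inv \<kappa>' u)" and ?S = "snd \<kappa>' ` (fst \<kappa>' \<inter> fst \<kappa>)"
  have "negligible (?\<tau> ` (Z \<inter> ?S))"
  proof (rule negligible_differentiable_image_negligible[OF order_refl])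
    show "negligible (Z \<inter> ?S)" using Z by (rule negligible_subset) simp
    have "\<forall>u\<in>?S. ?\<tau> differentiable (at u)"
      using transition_Ck_on[OF A \<kappa>' \<kappa>, of "Suc 0"] by simp
    then show "?\<tau> differentiable_on (Z \<inter> ?S)"
      by (auto simp: differentiable_on_def intro: differentiable_at_withinI)
  qed
  then have "negligible {w \<in> E. h w \<in> ?\<tau> ` (Z \<inter> ?S)}"
    by (intro negligible_expanding_preimage[of e E h, OF h(1)]) (use h(2) in auto)
  then show ?thesis
  proof (rule negligible_subset)
    show "{w \<in> E. chart_inv \<kappa> (h w) \<in> fst \<kappa>' \<and> snd \<kappa>' (chart_inv \<kappa> (h w)) \<in> Z} \<subseteq> {w \<in> E. h w \<in> ?\<tau> ` (Z \<inter> ?S)}"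
    proof clarify
      fix w assume w: "w \<in> E" "chart_inv \<kappa> (h w) \<in> fst \<kappa>'" "snd \<kappa>' (chart_inv \<kappa> (h w)) \<in> Z"
      let ?x = "chart_inv \<kappa> (h w)"
      have x: "?x \<in> fst \<kappa>" "snd \<kappa> ?x = h w" using c(6,7) h(3)[OF w(1)] by auto
      have "h w = ?\<tau> (snd \<kappa>' ?x)" using c'(5)[OF w(2)] x(2) by simp
      moreover have "snd \<kappa>' ?x \<in> Z \<inter> ?S" using w x(1) by auto
      ultimately show "h w \<in> ?\<tau> ` (Z \<inter> ?S)" by (rule image_eqI)
    qed
  qed
qed

text \<open>Both marginals will be images of one uniform measure on a Euclidean set, so absolute
  continuity comes down to negligible preimages of negligible sets.\<close>

lemma ac_prob_distr_uniform:
  fixes A :: "('m::topological_space, 'e::euclidean_space) chart set"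
  assumes A: "smooth_atlas A" and D: "D \<in> sets lborel" "emeasure lborel D \<noteq> 0" "emeasure lborel D \<noteq> \<infinity>"
    and Y: "Y \<in> borel_measurable borel"
    and neg: "\<And>\<kappa> Z. \<kappa> \<in> A \<Longrightarrow> negligible Z \<Longrightarrow> negligible {w \<in> D. Y w \<in> fst \<kappa> \<and> snd \<kappa> (Y w) \<in> Z}"
  shows "ac_prob A (distr (uniform_measure lborel D) borel Y)"
proof -
  let ?P = "uniform_measure lborel D"
  let ?\<mu> = "distr ?P borel Y"
  have Ym: "Y \<in> measurable ?P borel" using Y by simp
  have P: "prob_space ?P" using D by (intro prob_space_uniform_measure) auto
  have "absolutely_continuous lborel (distr (restrict_space ?\<mu> (fst \<kappa>)) borel (snd \<kappa>))" if \<kappa>: "\<kappa> \<in> A" for \<kappa>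
    unfolding absolutely_continuous_def
  proof
    note c = smooth_atlas_chartD[OF A \<kappa>]
    fix Z :: "'e set" assume Z: "Z \<in> null_sets lborel"
    then have Zb: "Z \<in> sets borel" by auto
    have opn: "fst \<kappa> \<in> sets borel" using c(1) by simp
    have "sets (restrict_space ?\<mu> (fst \<kappa>)) = sets (restrict_space borel (fst \<kappa>))"
      by (intro sets_restrict_space_cong) simp
    then have m: "snd \<kappa> \<in> measurable (restrict_space ?\<mu> (fst \<kappa>)) borel"
      using borel_measurable_continuous_on_restrict[OF c(3)] measurable_cong_sets by blast
    let ?Q = "snd \<kappa> -` Z \<inter> fst \<kappa>"
    have sp: "space (restrict_space ?\<mu> (fst \<kappa>)) = fst \<kappa>" by (simp add: space_restrict_space)
    have "?Q \<in> sets (restrict_space ?\<mu> (fst \<kappa>))"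
      using measurable_sets[OF m Zb] by (simp add: sp)
    then have Qb: "?Q \<in> sets borel"
      using opn by (simp add: sets_restrict_space_iff)
    have "emeasure (distr (restrict_space ?\<mu> (fst \<kappa>)) borel (snd \<kappa>)) Z = emeasure (restrict_space ?\<mu> (fst \<kappa>)) ?Q"
      using emeasure_distr[OF m Zb] by (simp add: sp)
    also have "\<dots> = emeasure ?\<mu> ?Q" using opn by (intro emeasure_restrict_space) auto
    also have "\<dots> = emeasure ?P (Y -` ?Q)" using emeasure_distr[OF Ym Qb] by simp
    also have "\<dots> = emeasure lborel (D \<inter> Y -` ?Q) / emeasure lborel D"
      using D(1) measurable_sets[OF Y Qb] by (intro emeasure_uniform_measure) auto
    also have "emeasure lborel (D \<inter> Y -` ?Q) = 0"
    proof -
      have "negligible Z" using Z by (simp add: negligible_iff_null_sets null_sets_completionI)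
      then have "negligible {w \<in> D. Y w \<in> fst \<kappa> \<and> snd \<kappa> (Y w) \<in> Z}" by (rule neg[OF \<kappa>])
      moreover have "{w \<in> D. Y w \<in> fst \<kappa> \<and> snd \<kappa> (Y w) \<in> Z} = D \<inter> Y -` ?Q" by auto
      moreover have "D \<inter> Y -` ?Q \<in> sets lborel" using D(1) measurable_sets[OF Y Qb] by auto
      ultimately have "D \<inter> Y -` ?Q \<in> null_sets lborel"
        by (simp add: negligible_iff_null_sets null_sets_completion_iff)
      then show ?thesis by auto
    qed
    finally show "Z \<in> null_sets (distr (restrict_space ?\<mu> (fst \<kappa>)) borel (snd \<kappa>))"
      using Zb by (simp add: null_setsI)
  qed
  then show ?thesis
    unfolding ac_prob_def using prob_space.prob_space_distr[OF P Ym] by simp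
qed

lemma measurable_piecewise:
  fixes f g :: "'a::topological_space \<Rightarrow> 'b::topological_space"
  assumes "U \<in> sets borel" "continuous_on U f" "g \<in> borel_measurable borel"
  shows "(\<lambda>x. if x \<in> U then f x else g x) \<in> borel_measurable borel"
proof -
  have "f \<in> measurable (restrict_space borel {x. x \<in> U}) borel"
    using borel_measurable_continuous_on_restrict[OF assms(2)] by simp
  moreover have "g \<in> measurable (restrict_space borel {x. x \<notin> U}) borel"
    using assms(3) by (rule measurable_restrict_space1)
  ultimately show ?thesis
    using assms(1) by (subst measurable_If_restrict_space_iff) auto
qed

lemma chart_inv_image:
  assumes "smooth_atlas A" "\<kappa> \<in> A" "V \<subseteq> snd \<kappa> ` fst \<kappa>"
  shows "chart_inv \<kappa> ` V = fst \<kappa> \<inter> snd \<kappa> -` V"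
proof (rule set_eqI, rule iffI)
  note c = smooth_atlas_chartD[OF assms(1,2)]
  fix y
  {
    assume "y \<in> chart_inv \<kappa> ` V"
    then obtain v where v: "v \<in> V" "y = chart_inv \<kappa> v" by blast
    then have "v \<in> snd \<kappa> ` fst \<kappa>" using assms(3) by blast
    then show "y \<in> fst \<kappa> \<inter> snd \<kappa> -` V" using v c(6)[of v] c(7)[of v] by simp
  next
    assume "y \<in> fst \<kappa> \<inter> snd \<kappa> -` V"
    then show "y \<in> chart_inv \<kappa> ` V" using c(5)[of y] by (metis IntE image_eqI vimageE)
  }
qed

lemma open_chart_inv_image:
  assumes "smooth_atlas A" "\<kappa> \<in> A" "V \<subseteq> snd \<kappa> ` fst \<kappa>" "open V"
  shows "open (chart_inv \<kappa> ` V)"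
  unfolding chart_inv_image[OF assms(1-3)]
  by (rule continuous_open_preimage[OF smooth_atlas_chartD(3,1)[OF assms(1,2)] assms(4)])

section \<open>Two contact charts over the same point\<close>

lemma jacobian_cong_open:
  assumes "open S" "x \<in> S" "\<And>y. y \<in> S \<Longrightarrow> f y = g y" "g differentiable (at x)"
  shows "jacobian f x = jacobian g x"
proof -
  have "(f has_derivative (\<lambda>v. jacobian g x *v v)) (at x)"
    by (rule has_derivative_transform_within_open[OF jacobian_has_derivative[OF assms(4)] assms(1,2)])
      (simp add: assms(3))
  then show ?thesis by (simp add: jacobian_eq)
qed

text \<open>One value \<open>p\<close> of the gradient map at two points means that one tilt serves
  both. The \<open>bool\<close> index treats the two contacts alike, with common \<open>p\<close>,
  \<open>L\<close>, \<open>r\<close> and \<open>s\<close>.\<close>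

lemma two_contact_charts:
  fixes A :: "('m::{t2_space,second_countable_topology}, real^'d) chart set"
    and B :: "('n::{t2_space,second_countable_topology}, real^'d) chart set"
  assumes A: "closed_manifold A" and B: "closed_manifold B"
    and c: "c \<in> Ck_functions 2 (prod_atlas A B)" and nd: "nondegenerate_at A B c x y"
  obtains \<kappa> u0 r p L s and \<eta> :: "bool \<Rightarrow> ('n, real^'d) chart" and v0 S e where
    "\<kappa> \<in> A" "\<And>b. \<eta> b \<in> B" "0 < r" "0 < s" "\<And>b. 0 < e b"
    "cball u0 r \<subseteq> snd \<kappa> ` fst \<kappa>" "\<And>b. ball (v0 b) s \<subseteq> snd (\<eta> b) ` fst (\<eta> b)" "\<And>b. S b (v0 b) = u0"
    "\<And>b v. v \<in> ball (v0 b) s \<Longrightarrow> S b v \<in> cball u0 r"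
    "\<And>b v u. v \<in> ball (v0 b) s \<Longrightarrow> u \<in> cball u0 r \<Longrightarrow> u \<noteq> S b v \<Longrightarrow>
       c (chart_inv \<kappa> (S b v), chart_inv (\<eta> b) v) - tilt p L u0 (S b v) <
       c (chart_inv \<kappa> u, chart_inv (\<eta> b) v) - tilt p L u0 u"
    "\<And>b v w. v \<in> ball (v0 b) s \<Longrightarrow> w \<in> ball (v0 b) s \<Longrightarrow> norm (S b v - S b w) \<le> norm (v - w)"
    "\<And>b v w. v \<in> ball (v0 b) s \<Longrightarrow> w \<in> ball (v0 b) s \<Longrightarrow> e b * norm (v - w) \<le> norm (S b v - S b w)"
    "chart_inv (\<eta> False) ` ball (v0 False) s \<inter> chart_inv (\<eta> True) ` ball (v0 True) s = {}"
proof -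
  have atA: "smooth_atlas A" and atB: "smooth_atlas B" using A B by (auto simp: closed_manifold_def)
  obtain \<kappa> \<eta>0 where \<kappa>: "\<kappa> \<in> A" "x \<in> fst \<kappa>" and \<eta>0: "\<eta>0 \<in> B" "y \<in> fst \<eta>0"
    and inv: "invertible (mixed_partials (c \<circ> chart_inv (prod_chart \<kappa> \<eta>0)) (snd \<kappa> x, snd \<eta>0 y))"
    using nd unfolding nondegenerate_at_def by blast
  note k = smooth_atlas_chartD[OF atA \<kappa>(1)]
  define u0 where "u0 = snd \<kappa> x"
  have u0: "u0 \<in> snd \<kappa> ` fst \<kappa>" using \<kappa>(2) by (simp add: u0_def)
  define F where "F \<eta> = c \<circ> chart_inv (prod_chart \<kappa> \<eta>)" for \<eta> :: "('n, real^'d) chart"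
  let ?\<Omega> = "\<lambda>\<eta>. (snd \<kappa> ` fst \<kappa>) \<times> (snd \<eta> ` fst \<eta>)"
  have F: "Ck_on (Suc (Suc 0)) (?\<Omega> \<eta>) (F \<eta>)" if "\<eta> \<in> B" for \<eta>
    using Ck_functions_prodD[OF c \<kappa>(1) that] by (simp add: F_def numeral_2_eq_2 del: Ck_on.simps)
  have op: "open (?\<Omega> \<eta>)" if "\<eta> \<in> B" for \<eta>
    by (rule open_prod_chart_image[OF atA atB \<kappa>(1) that])
  have Fval: "F \<eta> (u, v) = c (chart_inv \<kappa> u, chart_inv \<eta> v)"
    if "\<eta> \<in> B" "u \<in> snd \<kappa> ` fst \<kappa>" "v \<in> snd \<eta> ` fst \<eta>" for \<eta> u v
    using chart_inv_prod_chart[OF atA atB \<kappa>(1) that] by (simp add: F_def)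
  \<comment> \<open>Only the chart on the first manifold is fixed, so \<open>G\<close> is defined on
    the whole second manifold, as the parity argument requires.\<close>
  define G :: "'n \<Rightarrow> real^'d" where "G y = (\<chi> i. dir_deriv (\<lambda>u. c (chart_inv \<kappa> u, y)) (axis i 1) u0)" for y
  have G: "G (chart_inv \<eta> v) = grad1 (F \<eta>) (u0, v)" if \<eta>: "\<eta> \<in> B" and v: "v \<in> snd \<eta> ` fst \<eta>" for \<eta> v
  proof -
    have "(F \<eta> has_derivative (\<lambda>w. dir_deriv (F \<eta>) w (u0, v))) (at (u0, v))"
      by (rule Ck_on_has_derivative[OF F[OF \<eta>]]) (use u0 v in auto)
    moreover have "((\<lambda>u. (u, v)) has_derivative (\<lambda>w. (w, 0))) (at u0)"
      by (auto intro!: derivative_eq_intros)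
    ultimately have "((\<lambda>u. F \<eta> (u, v)) has_derivative (\<lambda>w. dir_deriv (F \<eta>) (w, 0) (u0, v))) (at u0)"
      by (rule has_derivative_compose[rotated])
    then have "((\<lambda>u. c (chart_inv \<kappa> u, chart_inv \<eta> v)) has_derivative (\<lambda>w. dir_deriv (F \<eta>) (w, 0) (u0, v))) (at u0)"
      by (rule has_derivative_transform_within_open[OF _ k(2) u0]) (rule Fval[OF \<eta> _ v])
    then show ?thesis by (simp add: G_def grad1_def dir_deriv_eq)
  qed
  have gC: "Ck_on (Suc 0) (snd \<eta> ` fst \<eta>) (\<lambda>v. grad1 (F \<eta>) (u0, v))" if \<eta>: "\<eta> \<in> B" for \<eta>
  proof -
    note e = smooth_atlas_chartD[OF atB \<eta>]
    show ?thesis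
      by (rule Ck_on_compose[OF e(2) op[OF \<eta>] Ck_on_Pair[OF e(2) Ck_on_const[OF e(2)] Ck_on_id[OF e(2)]]
            Ck_on_grad1[OF op[OF \<eta>] F[OF \<eta>]]])
        (use u0 in simp)
  qed
  have GC: "Ck_map (Suc 0) B G"
    unfolding Ck_map_def
  proof
    fix \<eta> assume \<eta>: "\<eta> \<in> B"
    show "Ck_on (Suc 0) (snd \<eta> ` fst \<eta>) (\<lambda>u. G (chart_inv \<eta> u))"
      by (rule Ck_on_cong[OF smooth_atlas_chartD(2)[OF atB \<eta>] _ gC[OF \<eta>]]) (simp add: G[OF \<eta>])
  qed
  have jac: "jacobian (\<lambda>v. G (chart_inv \<eta> v)) v = jacobian (\<lambda>v. grad1 (F \<eta>) (u0, v)) v"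
    if \<eta>: "\<eta> \<in> B" and v: "v \<in> snd \<eta> ` fst \<eta>" for \<eta> v
    by (rule jacobian_cong_open[OF smooth_atlas_chartD(2)[OF atB \<eta>] v G[OF \<eta>] Ck_on_differentiable[OF gC[OF \<eta>] v]])
  have y0: "snd \<eta>0 y \<in> snd \<eta>0 ` fst \<eta>0" using \<eta>0(2) by simp
  have "det (mixed_partials (F \<eta>0) (u0, snd \<eta>0 y)) \<noteq> 0"
    using inv by (simp add: F_def u0_def invertible_det_nz)
  then have "det (jacobian (\<lambda>v. G (chart_inv \<eta>0 v)) (snd \<eta>0 y)) \<noteq> 0"
    using mixed_partials_eq_jacobian[OF op[OF \<eta>0(1)] F[OF \<eta>0(1)], of u0 "snd \<eta>0 y"] jac[OF \<eta>0(1) y0] u0 y0 by simp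
  then obtain y1 y2 \<eta>1 \<eta>2 where yy: "y1 \<noteq> y2" "G y1 = G y2" "\<eta>1 \<in> B" "\<eta>2 \<in> B" "y1 \<in> fst \<eta>1" "y2 \<in> fst \<eta>2"
    "det (jacobian (\<lambda>u. G (chart_inv \<eta>1 u)) (snd \<eta>1 y1)) \<noteq> 0"
    "det (jacobian (\<lambda>u. G (chart_inv \<eta>2 u)) (snd \<eta>2 y2)) \<noteq> 0"
    using second_regular_preimage[OF B GC \<eta>0] by metis
  define Y where "Y b = (if b then y2 else y1)" for b
  define \<eta> where "\<eta> b = (if b then \<eta>2 else \<eta>1)" for b
  define v0 where "v0 b = snd (\<eta> b) (Y b)" for b
  define p where "p = G y1"
  have \<eta>: "\<eta> b \<in> B" "Y b \<in> fst (\<eta> b)" "G (Y b) = p" for b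
    using yy by (auto simp: Y_def \<eta>_def p_def)
  note e = smooth_atlas_chartD[OF atB \<eta>(1)]
  have v0: "v0 b \<in> snd (\<eta> b) ` fst (\<eta> b)" for b using \<eta>(2) by (simp add: v0_def)
  have reg: "det (jacobian (\<lambda>v. grad1 (F (\<eta> b)) (u0, v)) (v0 b)) \<noteq> 0" for b
    unfolding jac[OF \<eta>(1) v0, symmetric] using yy by (cases b) (auto simp: Y_def \<eta>_def v0_def)
  have p: "grad1 (F (\<eta> b)) (u0, v0 b) = p" for b
    using G[OF \<eta>(1) v0, of b] \<eta>(3)[of b] e(5)[OF \<eta>(2)] by (simp add: v0_def)
  define Q where "Q b L r s S e' \<longleftrightarrow> 0 < e' \<and> cball u0 r \<times> ball (v0 b) s \<subseteq> ?\<Omega> (\<eta> b) \<and> S (v0 b) = u0 \<and>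
       (\<forall>v\<in>ball (v0 b) s. S v \<in> cball u0 r \<and> (\<forall>u\<in>cball u0 r. u \<noteq> S v \<longrightarrow>
          F (\<eta> b) (S v, v) - tilt p L u0 (S v) < F (\<eta> b) (u, v) - tilt p L u0 u)) \<and>
       (\<forall>v\<in>ball (v0 b) s. \<forall>w\<in>ball (v0 b) s. norm (S v - S w) \<le> norm (v - w) \<and> e' * norm (v - w) \<le> norm (S v - S w))"
    for b L r s S e'
  have "\<exists>\<Lambda> r0. 0 < \<Lambda> \<and> 0 < r0 \<and> (\<forall>L r. \<Lambda> \<le> L \<longrightarrow> 0 < r \<longrightarrow> r \<le> r0 \<longrightarrow> (\<exists>s>0. \<exists>S e'. Q b L r s S e'))" for b
  proof -
    have "(u0, v0 b) \<in> ?\<Omega> (\<eta> b)" using u0 v0 by simp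
    from local_contact[OF op[OF \<eta>(1)] F[OF \<eta>(1)] this reg] show ?thesis
      unfolding Q_def p .
  qed
  then obtain \<Lambda> r0 where \<Lambda>: "\<And>b. 0 < r0 b" "\<And>b L r. \<Lambda> b \<le> L \<Longrightarrow> 0 < r \<Longrightarrow> r \<le> r0 b \<Longrightarrow> \<exists>s>0. \<exists>S e'. Q b L r s S e'"
    by metis
  define L where "L = max (\<Lambda> False) (\<Lambda> True)"
  define r where "r = min (r0 False) (r0 True)"
  have r: "0 < r" using \<Lambda>(1) by (simp add: r_def)
  have "\<exists>s>0. \<exists>S e'. Q b L r s S e'" for b
    by (rule \<Lambda>(2)) (use r in \<open>cases b; simp add: L_def r_def\<close>)+
  then obtain s1 S e' where Q: "\<And>b. 0 < s1 b" "\<And>b. Q b L r (s1 b) (S b) (e' b)" by metis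
  \<comment> \<open>The radii in the second variable are shrunk into disjoint neighbourhoods, so
    that the two pieces of the second marginal stay apart.\<close>
  obtain O1 O2 where O12: "open O1" "open O2" "y1 \<in> O1" "y2 \<in> O2" "O1 \<inter> O2 = {}"
    using hausdorff[OF yy(1)] by blast
  define Ob where "Ob b = (if b then O2 else O1)" for b
  have "\<exists>s>0. ball (v0 b) s \<subseteq> snd (\<eta> b) ` (fst (\<eta> b) \<inter> Ob b)" for b
  proof -
    have "open (snd (\<eta> b) ` (fst (\<eta> b) \<inter> Ob b))"
      using O12 by (intro open_chart_image[OF atB \<eta>(1)]) (simp add: Ob_def)
    moreover have "v0 b \<in> snd (\<eta> b) ` (fst (\<eta> b) \<inter> Ob b)"
      using \<eta>(2) O12 by (auto simp: v0_def Ob_def Y_def)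
    ultimately show ?thesis by (meson openE)
  qed
  then obtain s2 where s2: "\<And>b. 0 < s2 b" "\<And>b. ball (v0 b) (s2 b) \<subseteq> snd (\<eta> b) ` (fst (\<eta> b) \<inter> Ob b)" by metis
  define s where "s = min (min (s1 False) (s1 True)) (min (s2 False) (s2 True))"
  have s: "0 < s" "s \<le> s1 b" "s \<le> s2 b" for b
    using Q(1) s2(1) by (auto simp: s_def) (cases b; simp)+
  have sub1: "ball (v0 b) s \<subseteq> ball (v0 b) (s1 b)" and sub2: "ball (v0 b) s \<subseteq> snd (\<eta> b) ` (fst (\<eta> b) \<inter> Ob b)" for b
    using s(2,3)[of b] s2(2)[of b] by (meson subset_ball subset_trans)+
  have prod: "cball u0 r \<times> ball (v0 b) (s1 b) \<subseteq> ?\<Omega> (\<eta> b)" for b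
    using Q(2)[of b] unfolding Q_def by blast
  have centre: "u0 \<in> cball u0 r" "v0 b \<in> ball (v0 b) (s1 b)" for b using r Q(1) by auto
  have rsub: "cball u0 r \<subseteq> snd \<kappa> ` fst \<kappa>"
    using prod[of False] centre(2)[of False] by blast
  have ssub: "ball (v0 b) (s1 b) \<subseteq> snd (\<eta> b) ` fst (\<eta> b)" for b
    using prod[of b] centre(1) by blast
  have OO: "chart_inv (\<eta> b) ` ball (v0 b) s \<subseteq> Ob b" for b
  proof clarify
    fix v assume "v \<in> ball (v0 b) s"
    then obtain z where "z \<in> fst (\<eta> b) \<inter> Ob b" "v = snd (\<eta> b) z" using sub2 by blast
    then show "chart_inv (\<eta> b) v \<in> Ob b" using e(5) by simp
  qed
  show ?thesis
  proof (rule that[of \<kappa> \<eta> r s e' u0 v0 S p L])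
    show "\<kappa> \<in> A" "\<And>b. \<eta> b \<in> B" "0 < r" "0 < s" "cball u0 r \<subseteq> snd \<kappa> ` fst \<kappa>"
      using \<kappa> \<eta> r s rsub by auto
    show "ball (v0 b) s \<subseteq> snd (\<eta> b) ` fst (\<eta> b)" for b using sub1 ssub by blast
    show "0 < e' b" "S b (v0 b) = u0" for b using Q(2)[of b] by (auto simp: Q_def)
    have OOd: "Ob False \<inter> Ob True = {}" using O12 by (simp add: Ob_def)
    show "chart_inv (\<eta> False) ` ball (v0 False) s \<inter> chart_inv (\<eta> True) ` ball (v0 True) s = {}"
      using OO[of False] OO[of True] OOd by blast
    fix b v assume v: "v \<in> ball (v0 b) s"
    then have v1: "v \<in> ball (v0 b) (s1 b)" using sub1 by blast
    have vi: "v \<in> snd (\<eta> b) ` fst (\<eta> b)" using v1 ssub by blast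
    show Sv: "S b v \<in> cball u0 r" using Q(2)[of b] v1 unfolding Q_def by blast
    show "c (chart_inv \<kappa> (S b v), chart_inv (\<eta> b) v) - tilt p L u0 (S b v) <
       c (chart_inv \<kappa> u, chart_inv (\<eta> b) v) - tilt p L u0 u" if u: "u \<in> cball u0 r" "u \<noteq> S b v" for u
    proof -
      have "F (\<eta> b) (S b v, v) - tilt p L u0 (S b v) < F (\<eta> b) (u, v) - tilt p L u0 u"
        using Q(2)[of b] v1 u unfolding Q_def by blast
      moreover have "u \<in> snd \<kappa> ` fst \<kappa>" "S b v \<in> snd \<kappa> ` fst \<kappa>" using u(1) Sv rsub by blast+
      ultimately show ?thesis using Fval[OF \<eta>(1) _ vi] by simp
    qed
    fix w assume "w \<in> ball (v0 b) s"
    then have w1: "w \<in> ball (v0 b) (s1 b)" using sub1 by blast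
    show "norm (S b v - S b w) \<le> norm (v - w)" "e' b * norm (v - w) \<le> norm (S b v - S b w)"
      using Q(2)[of b] v1 w1 unfolding Q_def by blast+
  qed
qed

section \<open>Construction of the marginals\<close>

text \<open>One uniform measure on two disjoint balls parametrises everything: its images under
  \<open>J\<close> and \<open>T \<circ> J\<close> are \<open>\<nu>\<close> and \<open>\<mu>\<close>.
  The lower bound on \<open>S\<close> gives absolute continuity of \<open>\<mu>\<close> and open
  images; the upper bound gives measurability of \<open>T\<close> and controls images of null
  sets.\<close>

lemma contact_charts_measures:
  fixes A :: "('m::{t2_space,second_countable_topology}, real^'d) chart set"
    and B :: "('n::{t2_space,second_countable_topology}, real^'d) chart set"
    and \<eta> :: "bool \<Rightarrow> ('n, real^'d) chart"
  assumes A: "closed_manifold A" and B: "closed_manifold B"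
    and c: "c \<in> Ck_functions 2 (prod_atlas A B)" "\<And>z. 0 \<le> c z"
    and \<kappa>: "\<kappa> \<in> A" and \<eta>: "\<And>b. \<eta> b \<in> B" and r: "0 < r" and s: "0 < s" and e: "\<And>b. 0 < e b"
    and rsub: "cball u0 r \<subseteq> snd \<kappa> ` fst \<kappa>" and ssub: "\<And>b. ball (v0 b) s \<subseteq> snd (\<eta> b) ` fst (\<eta> b)"
    and S0: "\<And>b. S b (v0 b) = u0"
    and S: "\<And>b v. v \<in> ball (v0 b) s \<Longrightarrow> S b v \<in> cball u0 r"
    and min: "\<And>b v u. v \<in> ball (v0 b) s \<Longrightarrow> u \<in> cball u0 r \<Longrightarrow> u \<noteq> S b v \<Longrightarrow>
       c (chart_inv \<kappa> (S b v), chart_inv (\<eta> b) v) - tilt p L u0 (S b v) <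
       c (chart_inv \<kappa> u, chart_inv (\<eta> b) v) - tilt p L u0 u"
    and lip: "\<And>b v w. v \<in> ball (v0 b) s \<Longrightarrow> w \<in> ball (v0 b) s \<Longrightarrow> norm (S b v - S b w) \<le> norm (v - w)"
    and low: "\<And>b v w. v \<in> ball (v0 b) s \<Longrightarrow> w \<in> ball (v0 b) s \<Longrightarrow> e b * norm (v - w) \<le> norm (S b v - S b w)"
    and disj: "chart_inv (\<eta> False) ` ball (v0 False) s \<inter> chart_inv (\<eta> True) ` ball (v0 True) s = {}"
  shows "\<exists>\<mu> \<nu>. ac_prob A \<mu> \<and> ac_prob B \<nu> \<and> (\<exists>!\<gamma>. optimal_plan c \<mu> \<nu> \<gamma>) \<and>
    (\<forall>\<gamma>. optimal_plan c \<mu> \<nu> \<gamma> \<longrightarrow> \<not> supported_on_graph \<gamma>)"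
proof -
  have atA: "smooth_atlas A" and atB: "smooth_atlas B" and cA: "compact (UNIV :: 'm set)" and cB: "compact (UNIV :: 'n set)"
    using A B by (auto simp: closed_manifold_def)
  note k = smooth_atlas_chartD[OF atA \<kappa>] and ch = smooth_atlas_chartD[OF atB \<eta>]
  \<comment> \<open>Open balls of radius \<open>s\<close> with centres at distance
    \<open>2 * s\<close> are disjoint.\<close>
  obtain a1 :: "real^'d" where a1: "norm a1 = 2 * s"
    using vector_choose_size[of "2 * s"] s by auto
  define a where "a b = (if b then a1 else 0)" for b
  define D where "D b = ball (a b) s" for b
  define h where "h b w = S b (v0 b + (w - a b))" for b w
  define q where "q b w = chart_inv (\<eta> b) (v0 b + (w - a b))" for b w
  define W where "W b = chart_inv (\<eta> b) ` ball (v0 b) s" for b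
  define t where "t b y = chart_inv \<kappa> (S b (snd (\<eta> b) y))" for b y
  define DD where "DD = D False \<union> D True"
  let ?P = "uniform_measure lborel DD"
  \<comment> \<open>The value \<open>undefined\<close> is harmless: the uniform measure does not see
    the complement of \<open>DD\<close>.\<close>
  define J where "J w = (if w \<in> D False then q False w else if w \<in> D True then q True w else undefined)" for w
  define T where "T y = (if y \<in> W False then t False y else if y \<in> W True then t True y else undefined)" for y
  have shift: "v0 b + (w - a b) \<in> ball (v0 b) s" if "w \<in> D b" for b w
    using that by (simp add: D_def dist_norm norm_minus_commute)
  have Dopen: "open (D b)" and aD: "a b \<in> D b" for b using s by (auto simp: D_def)
  have Ddisj: "D False \<inter> D True = {}"
    unfolding D_def a_def using a1 by (intro disjoint_ballI) (simp add: dist_norm)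
  have Wopen: "open (W b)" for b
    unfolding W_def by (rule open_chart_inv_image[OF atB \<eta> ssub]) simp
  have Wdisj: "W False \<inter> W True = {}" using disj by (simp add: W_def)
  have Weq: "W b = fst (\<eta> b) \<inter> snd (\<eta> b) -` ball (v0 b) s" for b
    unfolding W_def by (rule chart_inv_image[OF atB \<eta> ssub])
  have qW: "q b w \<in> W b" if "w \<in> D b" for b w
    using shift[OF that] by (auto simp: q_def W_def)
  have Jq: "J w = q b w" if "w \<in> D b" for b w
    using that Ddisj by (cases b) (auto simp: J_def)
  have Tt: "T y = t b y" if "y \<in> W b" for b y
    using that Wdisj by (cases b) (auto simp: T_def)
  have Tq: "T (q b w) = chart_inv \<kappa> (h b w)" if "w \<in> D b" for b w
  proof -
    have "snd (\<eta> b) (q b w) = v0 b + (w - a b)"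
      unfolding q_def by (rule ch(7)) (use shift[OF that] ssub in blast)
    then show ?thesis unfolding Tt[OF qW[OF that]] t_def h_def by simp
  qed
  have hball: "h b w \<in> cball u0 r" if "w \<in> D b" for b w
    unfolding h_def by (rule S[OF shift[OF that]])
  have hlip: "norm (h b w - h b w') \<le> 1 * norm (w - w')" if "w \<in> D b" "w' \<in> D b" for b w w'
    using lip[OF shift[OF that(1)] shift[OF that(2)]] by (simp add: h_def)
  have hlow: "e b * norm (w - w') \<le> norm (h b w - h b w')" if "w \<in> D b" "w' \<in> D b" for b w w'
    using low[OF shift[OF that(1)] shift[OF that(2)]] by (simp add: h_def)
  have contS: "continuous_on (ball (v0 b) s) (S b)" for b
    by (rule lipschitz_on_continuous_on[of 1]) (use lip in \<open>auto simp: lipschitz_on_def dist_norm\<close>)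
  have conth: "continuous_on (D b) (h b)" for b
    by (rule lipschitz_on_continuous_on[of 1]) (use hlip in \<open>auto simp: lipschitz_on_def dist_norm\<close>)
  have Jm: "J \<in> borel_measurable borel"
  proof -
    have "continuous_on (D b) (q b)" for b
      unfolding q_def
    proof (rule continuous_on_compose2[OF ch(4)])
      show "(\<lambda>w. v0 b + (w - a b)) ` D b \<subseteq> snd (\<eta> b) ` fst (\<eta> b)" using shift ssub by blast
    qed (intro continuous_intros)
    then show ?thesis unfolding J_def
      using Dopen by (intro measurable_piecewise) auto
  qed
  have Tm: "T \<in> borel_measurable borel"
  proof -
    have "continuous_on (W b) (t b)" for b
      unfolding t_def
    proof (rule continuous_on_compose2[OF k(4)])
      show "continuous_on (W b) (\<lambda>y. S b (snd (\<eta> b) y))"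
        by (rule continuous_on_compose2[OF contS continuous_on_subset[OF ch(3)]]) (auto simp: Weq)
      show "(\<lambda>y. S b (snd (\<eta> b) y)) ` W b \<subseteq> snd \<kappa> ` fst \<kappa>"
        using S[of _ b] rsub unfolding Weq by blast
    qed
    then show ?thesis unfolding T_def
      using Wopen by (intro measurable_piecewise) auto
  qed
  have DDs: "DD \<in> sets lborel" using Dopen by (simp add: DD_def)
  have DD0: "emeasure lborel DD \<noteq> 0"
  proof
    assume "emeasure lborel DD = 0"
    then have "DD \<in> null_sets lborel" using DDs by auto
    then have "negligible DD" by (simp add: negligible_iff_null_sets null_sets_completionI)
    moreover have "open DD" "DD \<noteq> {}" using Dopen aD by (auto simp: DD_def)
    ultimately show False using open_not_negligible by blast
  qed
  have DDfin: "emeasure lborel DD \<noteq> \<infinity>"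
    using emeasure_bounded_finite[of DD] by (simp add: DD_def D_def)
  have P: "prob_space ?P" using DD0 DDfin by (rule prob_space_uniform_measure)
  define \<nu> where "\<nu> = distr ?P borel J"
  define \<mu> where "\<mu> = distr \<nu> borel T"
  have JP: "J \<in> measurable ?P borel" using Jm by simp
  have \<nu>: "prob_space \<nu>" "sets \<nu> = sets borel"
    unfolding \<nu>_def using prob_space.prob_space_distr[OF P JP] by auto
  have \<mu>_eq: "\<mu> = distr ?P borel (\<lambda>w. T (J w))"
    unfolding \<mu>_def \<nu>_def using distr_distr[OF Tm JP] by (simp add: comp_def)
  have DDcases: "\<exists>b. w \<in> D b" if "w \<in> DD" for w using that by (auto simp: DD_def)
  have ac\<nu>: "ac_prob B \<nu>"
    unfolding \<nu>_def
  proof (rule ac_prob_distr_uniform[OF atB DDs DD0 DDfin Jm])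
    fix \<zeta> and Z :: "(real^'d) set" assume Z: "\<zeta> \<in> B" "negligible Z"
    have neg: "negligible {w \<in> D b. chart_inv (\<eta> b) (v0 b + (w - a b)) \<in> fst \<zeta> \<and> snd \<zeta> (chart_inv (\<eta> b) (v0 b + (w - a b))) \<in> Z}" for b
    proof (rule negligible_chart_preimage[OF atB \<eta> Z(1) _ _ _ Z(2), where e = 1])
      show "v0 b + (w - a b) \<in> snd (\<eta> b) ` fst (\<eta> b)" if "w \<in> D b" for w
        using shift[OF that] ssub by blast
    qed auto
    have "{w \<in> DD. J w \<in> fst \<zeta> \<and> snd \<zeta> (J w) \<in> Z} \<subseteq>
      (\<Union>b. {w \<in> D b. chart_inv (\<eta> b) (v0 b + (w - a b)) \<in> fst \<zeta> \<and> snd \<zeta> (chart_inv (\<eta> b) (v0 b + (w - a b))) \<in> Z})"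
      using DDcases Jq by (fastforce simp: q_def)
    then show "negligible {w \<in> DD. J w \<in> fst \<zeta> \<and> snd \<zeta> (J w) \<in> Z}"
      by (rule negligible_subset[rotated]) (use neg in \<open>auto simp: UNIV_bool\<close>)
  qed
  have ac\<mu>: "ac_prob A \<mu>"
    unfolding \<mu>_eq
  proof (rule ac_prob_distr_uniform[OF atA DDs DD0 DDfin measurable_compose[OF Jm Tm]])
    fix \<zeta> and Z :: "(real^'d) set" assume Z: "\<zeta> \<in> A" "negligible Z"
    have neg: "negligible {w \<in> D b. chart_inv \<kappa> (h b w) \<in> fst \<zeta> \<and> snd \<zeta> (chart_inv \<kappa> (h b w)) \<in> Z}" for b
      by (rule negligible_chart_preimage[OF atA \<kappa> Z(1) e[of b] hlow[of _ b] _ Z(2)]) (use hball rsub in blast)+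
    have "{w \<in> DD. T (J w) \<in> fst \<zeta> \<and> snd \<zeta> (T (J w)) \<in> Z} \<subseteq>
      (\<Union>b. {w \<in> D b. chart_inv \<kappa> (h b w) \<in> fst \<zeta> \<and> snd \<zeta> (chart_inv \<kappa> (h b w)) \<in> Z})"
    proof clarify
      fix w assume w: "w \<in> DD" "T (J w) \<in> fst \<zeta>" "snd \<zeta> (T (J w)) \<in> Z"
      obtain b where b: "w \<in> D b" using DDcases[OF w(1)] by blast
      show "w \<in> (\<Union>b. {w \<in> D b. chart_inv \<kappa> (h b w) \<in> fst \<zeta> \<and> snd \<zeta> (chart_inv \<kappa> (h b w)) \<in> Z})"
        using w b unfolding Jq[OF b] Tq[OF b] by blast
    qed
    then show "negligible {w \<in> DD. T (J w) \<in> fst \<zeta> \<and> snd \<zeta> (T (J w)) \<in> Z}"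
      by (rule negligible_subset[rotated]) (use neg in \<open>auto simp: UNIV_bool\<close>)
  qed
  define U where "U = chart_inv \<kappa> ` cball u0 r"
  \<comment> \<open>Extended by 0 to be bounded and measurable on all of the manifold; the
    comparison of costs takes place on \<open>U\<close>.\<close>
  define \<phi> where "\<phi> x = (if x \<in> U then tilt p L u0 (snd \<kappa> x) else 0)" for x
  have Ueq: "U = fst \<kappa> \<inter> snd \<kappa> -` cball u0 r"
    unfolding U_def by (rule chart_inv_image[OF atA \<kappa> rsub])
  have "compact U" unfolding U_def
    using rsub by (intro compact_continuous_image continuous_on_subset[OF k(4)]) auto
  then have Ub: "U \<in> sets borel" by (simp add: compact_imp_closed)
  have tilt_cont: "continuous_on X (tilt p L u0)" for X
    unfolding tilt_def by (intro continuous_intros)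
  have \<phi>m: "\<phi> \<in> borel_measurable borel"
    unfolding \<phi>_def
  proof (rule measurable_piecewise[OF Ub])
    show "continuous_on U (\<lambda>x. tilt p L u0 (snd \<kappa> x))"
      by (rule continuous_on_compose2[OF tilt_cont continuous_on_subset[OF k(3)]]) (auto simp: Ueq)
  qed simp
  obtain C1 where C1: "\<And>u. u \<in> cball u0 r \<Longrightarrow> \<bar>tilt p L u0 u\<bar> \<le> C1"
    using compact_imp_bounded[OF compact_continuous_image[OF tilt_cont compact_cball[of u0 r]]]
    unfolding bounded_iff real_norm_def by blast
  have ccont: "continuous_on UNIV c" by (rule Ck_functions_prod_continuous[OF atA atB c(1)])
  have "compact (UNIV :: ('m \<times> 'n) set)" using compact_Times[OF cA cB] by simp
  then obtain C2 where C2: "\<And>z. \<bar>c z\<bar> \<le> C2"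
    using compact_imp_bounded[OF compact_continuous_image[OF ccont]] unfolding bounded_iff by auto
  define C where "C = max C1 C2"
  \<comment> \<open>One value of \<open>c\<close> shows \<open>0 \<le> C\<close>, which is the bound
    needed outside \<open>U\<close>.\<close>
  have \<phi>C: "\<bar>\<phi> x\<bar> \<le> C" for x
    using C1[of "snd \<kappa> x"] C2[of undefined] by (auto simp: \<phi>_def Ueq C_def)
  have cC: "c z \<le> C" for z using C2[of z] by (simp add: C_def)
  have cm: "c \<in> borel_measurable borel" using ccont by (rule borel_measurable_continuous_onI)
  define V where "V = W False \<union> W True"
  have Vcases: "\<exists>b. y \<in> W b" if "y \<in> V" for y using that by (auto simp: V_def)
  have Vb: "V \<in> sets borel" using Wopen by (simp add: V_def)
  have "AE w in ?P. J w \<in> V"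
  proof (rule AE_uniform_measureI[OF DDs], intro AE_I2 impI)
    fix w assume "w \<in> DD"
    then obtain b where "w \<in> D b" using DDcases by blast
    then have "J w \<in> W b" using Jq qW by simp
    then show "J w \<in> V" by (cases b) (auto simp: V_def)
  qed
  then have AEV: "AE y in \<nu>. y \<in> V"
    unfolding \<nu>_def using JP Vb by (subst AE_distr_iff) auto
  have optimal: "optimal_plan c \<mu> \<nu> \<gamma> \<longleftrightarrow> \<gamma> = distr \<nu> borel (\<lambda>y. (T y, y))" for \<gamma>
    unfolding \<mu>_def
  proof (rule unique_optimal_graph_plan[OF \<nu> Tm cm c(2) cC \<phi>m \<phi>C Ub Vb AEV])
    fix y assume "y \<in> V"
    then obtain b where b: "y \<in> W b" using Vcases by blast
    let ?v = "snd (\<eta> b) y"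
    have v: "?v \<in> ball (v0 b) s" "chart_inv (\<eta> b) ?v = y" using b ch(5) by (auto simp: Weq)
    have Ty: "T y = chart_inv \<kappa> (S b ?v)" unfolding Tt[OF b] t_def by simp
    have Sv: "S b ?v \<in> cball u0 r" by (rule S[OF v(1)])
    then show TU: "T y \<in> U" unfolding Ty U_def by blast
    have \<phi>U: "\<phi> (chart_inv \<kappa> u) = tilt p L u0 u" if "u \<in> cball u0 r" for u
    proof -
      have "u \<in> snd \<kappa> ` fst \<kappa>" using that rsub by blast
      then show ?thesis using that k(7) by (simp add: \<phi>_def U_def)
    qed
    fix x assume x: "x \<in> U" "x \<noteq> T y"
    then obtain u where u: "u \<in> cball u0 r" "x = chart_inv \<kappa> u" unfolding U_def by blast
    then have "u \<noteq> S b ?v" using x(2) Ty by auto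
    from min[OF v(1) u(1) this] show "c (T y, y) - \<phi> (T y) < c (x, y) - \<phi> x"
      unfolding Ty u(2) \<phi>U[OF Sv] \<phi>U[OF u(1)] v(2) .
  qed
  have "\<not> supported_on_graph (distr \<nu> borel (\<lambda>y. (T y, y)))"
  proof
    assume "supported_on_graph (distr \<nu> borel (\<lambda>y. (T y, y)))"
    then obtain G where G: "single_valued G" "AE z in distr \<nu> borel (\<lambda>y. (T y, y)). z \<in> G"
      unfolding supported_on_graph_def by blast
    have "(\<lambda>y. (T y, y)) \<in> borel_measurable borel"
      using Tm by (intro borel_measurable_Pair) auto
    then have gm: "(\<lambda>y. (T y, y)) \<in> measurable \<nu> borel"
      by (simp add: measurable_cong_sets[OF \<nu>(2) refl])
    have "AE y in distr ?P borel J. (T y, y) \<in> G"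
      using AE_distrD[OF gm G(2)] unfolding \<nu>_def .
    then have "AE w in ?P. (T (J w), J w) \<in> G" by (rule AE_distrD[OF JP])
    then have "AE w in lborel. w \<in> DD \<longrightarrow> (T (J w), J w) \<in> G"
      using DDs DD0 DDfin by (subst (asm) AE_uniform_measure) (auto simp: top.not_eq_extremum zero_less_iff_neq_zero)
    then obtain N where N: "N \<in> null_sets lborel" "{w \<in> space lborel. \<not> (w \<in> DD \<longrightarrow> (T (J w), J w) \<in> G)} \<subseteq> N"
      by (auto simp: eventually_ae_filter)
    have negN: "negligible N" using N(1) by (simp add: negligible_iff_null_sets null_sets_completionI)
    have opn: "open (h b ` D b)" for b
    proof (rule invariance_of_domain[OF conth Dopen])
      show "inj_on (h b) (D b)"
      proof (rule inj_onI)
        fix w w' assume w: "w \<in> D b" "w' \<in> D b" "h b w = h b w'"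
        have "e b * norm (w - w') \<le> 0" using hlow[OF w(1,2)] w(3) by simp
        then show "w = w'" using e[of b] by (simp add: mult_le_0_iff)
      qed
    qed
    have u0: "u0 \<in> h b ` D b" for b
      using aD[of b] S0[of b] by (auto simp: h_def image_iff intro!: bexI[of _ "a b"])
    have neg: "negligible (h b ` (N \<inter> D b))" for b
    proof (rule negligible_locally_Lipschitz_image[OF order_refl])
      show "negligible (N \<inter> D b)" using negN by (rule negligible_subset) simp
      show "\<exists>T B. open T \<and> x \<in> T \<and> (\<forall>y\<in>N \<inter> D b \<inter> T. norm (h b y - h b x) \<le> B * norm (y - x))"
        if "x \<in> N \<inter> D b" for x
        using that hlip by (intro exI[of _ UNIV] exI[of _ 1]) auto
    qed
    \<comment> \<open>Both images are open and contain \<open>u0\<close>, so they meet in a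
      non-negligible set, whereas the exceptional parameters have negligible images. Some point is
      thus reached from both pieces outside the exceptions, and a graph carrying the plan would hold
      two targets for it.\<close>
    have "open (h False ` D False \<inter> h True ` D True)" using opn by blast
    moreover have "h False ` D False \<inter> h True ` D True \<noteq> {}" using u0 by blast
    ultimately have "\<not> negligible (h False ` D False \<inter> h True ` D True)" by (rule open_not_negligible)
    moreover have "negligible (h False ` (N \<inter> D False) \<union> h True ` (N \<inter> D True))" using neg by simp
    ultimately have "\<not> h False ` D False \<inter> h True ` D True \<subseteq> h False ` (N \<inter> D False) \<union> h True ` (N \<inter> D True)"
      using negligible_subset by blast
    then obtain w1 w2 where w: "w1 \<in> D False" "w2 \<in> D True" "h False w1 = h True w2" "w1 \<notin> N" "w2 \<notin> N"
      by blast
    have mem: "(chart_inv \<kappa> (h b w), q b w) \<in> G" if "w \<in> D b" "w \<notin> N" for b w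
    proof -
      have "w \<in> DD" using that(1) by (cases b) (auto simp: DD_def)
      then have "(T (J w), J w) \<in> G" using N(2) that(2) by auto
      then show ?thesis unfolding Jq[OF that(1)] Tq[OF that(1)] .
    qed
    have "q False w1 = q True w2"
      using mem[OF w(1,4)] mem[OF w(2,5)] unfolding w(3) by (rule single_valuedD[OF G(1)])
    then show False using qW[OF w(1)] qW[OF w(2)] Wdisj by auto
  qed
  then show ?thesis
    using ac\<mu> ac\<nu> optimal by (intro exI[of _ \<mu>] exI[of _ \<nu>]) auto
qed

lemma nondegenerate_cost_measures:
  fixes A :: "('m::{t2_space,second_countable_topology}, real^'d) chart set"
    and B :: "('n::{t2_space,second_countable_topology}, real^'d) chart set"
  assumes A: "closed_manifold A" and B: "closed_manifold B"
    and c: "c \<in> Ck_functions 2 (prod_atlas A B)" "\<And>z. 0 \<le> c z" and nd: "nondegenerate_at A B c x y"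
  shows "\<exists>\<mu> \<nu>. ac_prob A \<mu> \<and> ac_prob B \<nu> \<and> (\<exists>!\<gamma>. optimal_plan c \<mu> \<nu> \<gamma>) \<and>
    (\<forall>\<gamma>. optimal_plan c \<mu> \<nu> \<gamma> \<longrightarrow> \<not> supported_on_graph \<gamma>)"
proof (rule two_contact_charts[OF A B c(1) nd], goal_cases)
  case (1 \<kappa> u0 r p L s \<eta> v0 S e)
  then show ?case by (rule contact_charts_measures[OF A B c])
qed

section \<open>The set of non-degenerate costs\<close>

lemma Ck_on_dir_deriv: "Ck_on (Suc k) S f \<Longrightarrow> Ck_on k S (dir_deriv f v)"
  by simp

text \<open>\<open>frechet_derivative\<close> is a choice among all derivatives at \<open>x\<close>,
  and \<open>f\<close> and \<open>g\<close> have the same ones; the equality thus holds even where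
  there are none.\<close>

lemma dir_deriv_cong_open:
  assumes "open S" "x \<in> S" "\<And>y. y \<in> S \<Longrightarrow> f y = g y"
  shows "dir_deriv f v x = dir_deriv g v x"
proof -
  have "(f has_derivative D) (at x) \<longleftrightarrow> (g has_derivative D) (at x)" for D
    using has_derivative_transform_within_open[OF _ assms(1,2), of f D UNIV g]
      has_derivative_transform_within_open[OF _ assms(1,2), of g D UNIV f] assms(3)
    by auto
  then show ?thesis by (simp add: dir_deriv_def frechet_derivative_def)
qed

lemma dir_deriv_add_scaled:
  fixes F E :: "'a::real_normed_vector \<Rightarrow> real"
  assumes "F differentiable (at x)" "E differentiable (at x)"
  shows "dir_deriv (\<lambda>x. F x + t * E x) v x = dir_deriv F v x + t * dir_deriv E v x"
  by (rule dir_deriv_eq) (rule has_derivative_add[OF differentiable_has_derivative_dir[OF assms(1)]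
      has_derivative_mult_right[OF differentiable_has_derivative_dir[OF assms(2)]]])

lemma mixed_partials_add_scaled:
  assumes S: "open S" "z \<in> S" and F: "Ck_on (Suc (Suc 0)) S F" and E: "Ck_on (Suc (Suc 0)) S E"
  shows "mixed_partials (\<lambda>x. F x + t * E x) z = mixed_partials F z + t *\<^sub>R mixed_partials E z"
proof -
  have "dir_deriv (dir_deriv (\<lambda>x. F x + t * E x) v) w z =
      dir_deriv (dir_deriv F v) w z + t * dir_deriv (dir_deriv E v) w z" for v w
  proof -
    have "dir_deriv (dir_deriv (\<lambda>x. F x + t * E x) v) w z =
        dir_deriv (\<lambda>x. dir_deriv F v x + t * dir_deriv E v x) w z"
      by (rule dir_deriv_cong_open[OF S]) (use F E in \<open>simp add: dir_deriv_add_scaled\<close>)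
    also have "\<dots> = dir_deriv (dir_deriv F v) w z + t * dir_deriv (dir_deriv E v) w z"
      by (rule dir_deriv_add_scaled[OF Ck_on_differentiable[OF Ck_on_dir_deriv[OF F] S(2)]
            Ck_on_differentiable[OF Ck_on_dir_deriv[OF E] S(2)]])
    finally show ?thesis .
  qed
  then show ?thesis by (simp add: mixed_partials_def vec_eq_iff)
qed

lemma Ck_small_cong:
  assumes "open S" "K \<subseteq> S" "\<And>x. x \<in> S \<Longrightarrow> F x = G x" "Ck_small k K \<epsilon> F"
  shows "Ck_small k K \<epsilon> G"
  using assms(3,4)
proof (induction k arbitrary: F G)
  case 0
  then show ?case using assms(2) by fastforce
next
  case (Suc k)
  have "Ck_small k K \<epsilon> (dir_deriv G b)" if "b \<in> Basis" for b
  proof (rule Suc.IH[of "dir_deriv F b"])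
    show "dir_deriv F b x = dir_deriv G b x" if "x \<in> S" for x
      by (rule dir_deriv_cong_open[OF assms(1) that Suc.prems(1)])
  qed (use Suc.prems that in simp)
  then show ?case using Suc.prems assms(2) by fastforce
qed

lemma Ck_small_zero: "0 < \<epsilon> \<Longrightarrow> Ck_small k K \<epsilon> (\<lambda>x. 0)"
proof (induction k)
  case (Suc k)
  have "dir_deriv (\<lambda>x::'a. 0 :: real) b = (\<lambda>x. 0)" for b
    by (rule ext, rule dir_deriv_eq) simp
  then show ?case using Suc by simp
qed simp

text \<open>Strict bounds on a compact set leave a margin, and every derivative of the perturbed
  function is affine in \<open>t\<close>.\<close>

lemma Ck_small_perturb:
  fixes F E :: "'a::euclidean_space \<Rightarrow> real"
  assumes S: "open S" and K: "compact K" "K \<subseteq> S"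
    and "Ck_on k S F" "Ck_on k S E" "Ck_small k K \<epsilon> F"
  shows "\<exists>\<delta>>0. \<forall>t. \<bar>t\<bar> < \<delta> \<longrightarrow> Ck_small k K \<epsilon> (\<lambda>x. F x + t * E x)"
proof -
  have base: "\<exists>\<delta>>0. \<forall>t. \<bar>t\<bar> < \<delta> \<longrightarrow> (\<forall>x\<in>K. \<bar>F x + t * E x\<bar> < \<epsilon>)"
    if F: "continuous_on S F" and E: "continuous_on S E" and small: "\<forall>x\<in>K. \<bar>F x\<bar> < \<epsilon>" for F E :: "'a \<Rightarrow> real"
  proof (cases "K = {}")
    case True
    then show ?thesis by (intro exI[of _ 1]) simp
  next
    case False
    have FK: "continuous_on K (\<lambda>x. \<bar>F x\<bar>)" and EK: "continuous_on K (\<lambda>x. \<bar>E x\<bar>)"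
      using F E K(2) by (auto intro!: continuous_intros intro: continuous_on_subset)
    obtain x0 where x0: "x0 \<in> K" "\<And>x. x \<in> K \<Longrightarrow> \<bar>F x\<bar> \<le> \<bar>F x0\<bar>"
      using continuous_attains_sup[OF K(1) False FK] by auto
    obtain x1 where x1: "x1 \<in> K" "\<And>x. x \<in> K \<Longrightarrow> \<bar>E x\<bar> \<le> \<bar>E x1\<bar>"
      using continuous_attains_sup[OF K(1) False EK] by auto
    \<comment> \<open>The least margin of \<open>F\<close> divided by the largest size of
      \<open>E\<close>; the added 1 avoids a zero denominator.\<close>
    let ?\<delta> = "(\<epsilon> - \<bar>F x0\<bar>) / (\<bar>E x1\<bar> + 1)"
    have "0 < ?\<delta>" using small x0(1) by (intro divide_pos_pos) auto
    moreover have "\<bar>F x + t * E x\<bar> < \<epsilon>" if t: "\<bar>t\<bar> < ?\<delta>" and x: "x \<in> K" for t x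
    proof -
      have "\<bar>t * E x\<bar> \<le> \<bar>t\<bar> * (\<bar>E x1\<bar> + 1)"
        unfolding abs_mult using x1(2)[OF x] by (intro mult_left_mono) auto
      also have "\<dots> < \<epsilon> - \<bar>F x0\<bar>" using t by (simp add: pos_less_divide_eq)
      finally show ?thesis using x0(2)[OF x] by linarith
    qed
    ultimately show ?thesis by blast
  qed
  show ?thesis
    using assms(4-)
  proof (induction k arbitrary: F E)
    case 0
    then show ?case using base[of F E] by simp
  next
    case (Suc k)
    have "\<exists>\<delta>>0. \<forall>t. \<bar>t\<bar> < \<delta> \<longrightarrow> Ck_small k K \<epsilon> (\<lambda>x. dir_deriv F b x + t * dir_deriv E b x)" if "b \<in> Basis" for b
      using Suc.IH[of "dir_deriv F b" "dir_deriv E b"] Suc.prems that by simp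
    then obtain d where d: "\<And>b. b \<in> Basis \<Longrightarrow> 0 < d b"
      "\<And>b t. b \<in> Basis \<Longrightarrow> \<bar>t\<bar> < d b \<Longrightarrow> Ck_small k K \<epsilon> (\<lambda>x. dir_deriv F b x + t * dir_deriv E b x)"
      by metis
    obtain d0 where d0: "0 < d0" "\<And>t. \<bar>t\<bar> < d0 \<Longrightarrow> \<forall>x\<in>K. \<bar>F x + t * E x\<bar> < \<epsilon>"
      using base[OF Ck_on_continuous_on[OF Suc.prems(1)] Ck_on_continuous_on[OF Suc.prems(2)]] Suc.prems(3) by auto
    let ?\<delta> = "Min (insert d0 (d ` Basis))"
    have "0 < ?\<delta>" using d0 d(1) by simp
    moreover have "Ck_small (Suc k) K \<epsilon> (\<lambda>x. F x + t * E x)" if t: "\<bar>t\<bar> < ?\<delta>" for t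
    proof -
      have td: "\<bar>t\<bar> < d0" "\<And>b. b \<in> Basis \<Longrightarrow> \<bar>t\<bar> < d b" using t by auto
      have "Ck_small k K \<epsilon> (dir_deriv (\<lambda>x. F x + t * E x) b)" if b: "b \<in> Basis" for b
        by (rule Ck_small_cong[OF S K(2) _ d(2)[OF b td(2)[OF b]]])
          (use Suc.prems in \<open>simp add: dir_deriv_add_scaled\<close>)
      then show ?thesis using d0(2)[OF td(1)] by simp
    qed
    ultimately show ?case by blast
  qed
qed

section \<open>Openness\<close>

lemma invertible_perturb:
  fixes M :: "real^'n^'n"
  assumes "invertible M"
  obtains \<epsilon> where "0 < \<epsilon>" "\<And>M'. (\<And>i j. \<bar>M' $ i $ j - M $ i $ j\<bar> < \<epsilon>) \<Longrightarrow> invertible M'"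
proof -
  have "continuous_on UNIV (\<lambda>M :: real^'n^'n. det M)"
    by (rule continuous_on_det) (intro continuous_intros)
  then have "open {M :: real^'n^'n. det M \<noteq> 0}"
    by (intro open_Collect_neq continuous_on_const)
  then obtain d where d: "0 < d" "ball M d \<subseteq> {M. det M \<noteq> 0}"
    using assms openE by (metis (mono_tags) invertible_det_nz mem_Collect_eq)
  \<comment> \<open>Neighbourhoods in the C^2 topology control single entries. One factor
    \<open>?n\<close> is spent on the norm of a row, the other on the sum over the rows.\<close>
  let ?n = "real CARD('n)"
  show ?thesis
  proof (rule that[of "d / (?n * ?n)"])
    show "0 < d / (?n * ?n)" using d(1) by simp
    fix M' :: "real^'n^'n" assume M': "\<And>i j. \<bar>M' $ i $ j - M $ i $ j\<bar> < d / (?n * ?n)"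
    have row: "norm ((M' - M) $ i) < d / ?n" for i
    proof -
      have "norm ((M' - M) $ i) \<le> (\<Sum>j\<in>UNIV. \<bar>(M' - M) $ i $ j\<bar>)" by (rule norm_le_l1_cart)
      also have "\<dots> < (\<Sum>j\<in>(UNIV :: 'n set). d / (?n * ?n))" by (rule sum_strict_mono) (use M' in auto)
      finally show ?thesis by simp
    qed
    have "norm (M' - M) \<le> (\<Sum>i\<in>UNIV. norm ((M' - M) $ i))"
      unfolding norm_vec_def by (rule L2_set_le_sum) simp
    also have "\<dots> < (\<Sum>i\<in>(UNIV :: 'n set). d / ?n)" by (rule sum_strict_mono) (use row in auto)
    finally have "norm (M' - M) < d" by simp
    then have "M' \<in> ball M d" by (simp add: dist_norm norm_minus_commute)
    then show "invertible M'" using d(2) by (auto simp: invertible_det_nz)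
  qed
qed

text \<open>Invertibility at one point involves finitely many second derivatives there, so a
  neighbourhood over the compact set \<open>{(x, y)}\<close> already keeps it.\<close>

lemma openin_nondegenerate:
  fixes A :: "('m::{t2_space,second_countable_topology}, real^'d) chart set"
    and B :: "('n::{t2_space,second_countable_topology}, real^'d) chart set"
  assumes A: "smooth_atlas A" and B: "smooth_atlas B"
  shows "openin (Ck_topology 2 (prod_atlas A B))
    {c \<in> Ck_functions 2 (prod_atlas A B). \<exists>x y. nondegenerate_at A B c x y}" (is "openin ?T ?S")
proof (subst openin_subopen, rule ballI)
  fix c assume "c \<in> ?S"
  then obtain x y \<kappa> \<eta> where c: "c \<in> Ck_functions 2 (prod_atlas A B)" and k: "\<kappa> \<in> A" "\<eta> \<in> B" "x \<in> fst \<kappa>" "y \<in> fst \<eta>"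
    and inv: "invertible (mixed_partials (c \<circ> chart_inv (prod_chart \<kappa> \<eta>)) (snd \<kappa> x, snd \<eta> y))"
    unfolding nondegenerate_at_def by blast
  let ?\<pi> = "prod_chart \<kappa> \<eta>" and ?z = "(snd \<kappa> x, snd \<eta> y)"
  let ?\<Omega> = "(snd \<kappa> ` fst \<kappa>) \<times> (snd \<eta> ` fst \<eta>)"
  have \<Omega>: "open ?\<Omega>" "?z \<in> ?\<Omega>" using open_prod_chart_image[OF A B k(1,2)] k by auto
  obtain \<epsilon> where \<epsilon>: "0 < \<epsilon>" "\<And>M'. (\<And>i j. \<bar>M' $ i $ j - mixed_partials (c \<circ> chart_inv ?\<pi>) ?z $ i $ j\<bar> < \<epsilon>) \<Longrightarrow> invertible M'"
    using invertible_perturb[OF inv] by blast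
  let ?N = "Ck_nbhd 2 (prod_atlas A B) c ?\<pi> {(x, y)} \<epsilon>"
  have "?\<pi> \<in> prod_atlas A B" using k unfolding prod_atlas_def by blast
  moreover have "{(x, y)} \<subseteq> fst ?\<pi>" using k by (simp add: prod_chart_def)
  ultimately have "openin ?T ?N"
    unfolding Ck_topology_def using c \<epsilon>(1) by (intro topology_generated_by_Basis CollectI exI conjI refl) auto
  moreover have "c \<in> ?N"
    using c Ck_small_zero[OF \<epsilon>(1)] by (simp add: Ck_nbhd_def comp_def)
  moreover have "?N \<subseteq> ?S"
  proof
    fix g assume g: "g \<in> ?N"
    then have gC: "g \<in> Ck_functions 2 (prod_atlas A B)" by (simp add: Ck_nbhd_def)
    let ?g = "g \<circ> chart_inv ?\<pi>" and ?c = "c \<circ> chart_inv ?\<pi>"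
    let ?D = "(\<lambda>z. g z - c z) \<circ> chart_inv ?\<pi>"
    have F: "Ck_on (Suc (Suc 0)) ?\<Omega> ?g" "Ck_on (Suc (Suc 0)) ?\<Omega> ?c"
      using Ck_functions_prodD[OF gC k(1,2)] Ck_functions_prodD[OF c k(1,2)]
      by (simp_all add: numeral_2_eq_2 del: Ck_on.simps)
    have D: "?D = (\<lambda>x. ?g x - ?c x)" by (simp add: comp_def)
    have DC: "Ck_on (Suc (Suc 0)) ?\<Omega> ?D" unfolding D by (rule Ck_on_diff[OF \<Omega>(1) F])
    have small: "Ck_small (Suc (Suc 0)) {?z} \<epsilon> ?D"
      using g by (simp add: Ck_nbhd_def numeral_2_eq_2 prod_chart_def del: Ck_small.simps)
    have "?g = (\<lambda>x. ?c x + 1 * ?D x)" by (simp add: comp_def)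
    then have M: "mixed_partials ?g ?z = mixed_partials ?c ?z + 1 *\<^sub>R mixed_partials ?D ?z"
      using mixed_partials_add_scaled[OF \<Omega> F(2) DC, of 1] by simp
    have "\<bar>mixed_partials ?g ?z $ i $ j - mixed_partials ?c ?z $ i $ j\<bar> < \<epsilon>" for i j
    proof -
      have "(0, axis j 1) \<in> (Basis :: ((real^'d) \<times> (real^'d)) set)" "(axis i 1, 0) \<in> (Basis :: ((real^'d) \<times> (real^'d)) set)"
        by (auto simp: Basis_prod_def Basis_vec_def)
      then have "\<bar>dir_deriv (dir_deriv ?D (0, axis j 1)) (axis i 1, 0) ?z\<bar> < \<epsilon>"
        using small by auto
      then show ?thesis by (simp add: M) (simp add: mixed_partials_def)
    qed
    then have "invertible (mixed_partials ?g ?z)" by (rule \<epsilon>(2))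
    then have "nondegenerate_at A B g x y" using k unfolding nondegenerate_at_def by blast
    then show "g \<in> ?S" using gC by blast
  qed
  ultimately show "\<exists>T. openin ?T T \<and> c \<in> T \<and> T \<subseteq> ?S" by blast
qed

section \<open>Density\<close>

lemma Ck_functions_add_scaled:
  assumes A: "smooth_atlas A" and B: "smooth_atlas B"
    and f: "f \<in> Ck_functions k (prod_atlas A B)" and b: "b \<in> Ck_functions k (prod_atlas A B)"
  shows "(\<lambda>z. f z + t * b z) \<in> Ck_functions k (prod_atlas A B)"
  unfolding Ck_functions_def
proof (rule CollectI, rule ballI)
  fix \<pi> assume "\<pi> \<in> prod_atlas A B"
  then obtain \<kappa> \<eta> where k: "\<kappa> \<in> A" "\<eta> \<in> B" "\<pi> = prod_chart \<kappa> \<eta>" unfolding prod_atlas_def by blast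
  have op: "open ((snd \<kappa> ` fst \<kappa>) \<times> (snd \<eta> ` fst \<eta>))" by (rule open_prod_chart_image[OF A B k(1,2)])
  have "Ck_on k ((snd \<kappa> ` fst \<kappa>) \<times> (snd \<eta> ` fst \<eta>))
      (\<lambda>u. (f \<circ> chart_inv \<pi>) u + t * (b \<circ> chart_inv \<pi>) u)"
    unfolding k(3)
    by (intro Ck_on_add op Ck_on_mult Ck_on_const Ck_functions_prodD[OF f k(1,2)] Ck_functions_prodD[OF b k(1,2)])
  then show "Ck_on k (snd \<pi> ` fst \<pi>) ((\<lambda>z. f z + t * b z) \<circ> chart_inv \<pi>)"
    unfolding k(3) prod_chart_image by (simp add: comp_def)
qed

text \<open>The topology is given by a subbase, hence the induction on the generation of
  \<open>T\<close>. A generating neighbourhood of \<open>f\<close> may be centred at another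
  \<open>f'\<close>, so it is the strict bound on \<open>f - f'\<close> that is perturbed.\<close>

lemma Ck_topology_segment:
  fixes A :: "('m::t2_space, 'e::euclidean_space) chart set" and B :: "('n::t2_space, 'f::euclidean_space) chart set"
  assumes A: "smooth_atlas A" and B: "smooth_atlas B"
    and f: "f \<in> Ck_functions k (prod_atlas A B)" and b: "b \<in> Ck_functions k (prod_atlas A B)"
    and T: "openin (Ck_topology k (prod_atlas A B)) T" "f \<in> T"
  shows "\<exists>\<delta>>0. \<forall>t. \<bar>t\<bar> < \<delta> \<longrightarrow> (\<lambda>z. f z + t * b z) \<in> T"
proof -
  have "generate_topology_on {Ck_nbhd k (prod_atlas A B) f \<kappa> K \<epsilon> | f \<kappa> K \<epsilon>.
      f \<in> Ck_functions k (prod_atlas A B) \<and> \<kappa> \<in> prod_atlas A B \<and> compact K \<and> K \<subseteq> fst \<kappa> \<and> 0 < \<epsilon>} T"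
    using T(1) unfolding Ck_topology_def openin_topology_generated_by_iff .
  then show ?thesis
    using T(2)
  proof induction
    case Empty
    then show ?case by simp
  next
    case (Int a b')
    then obtain d1 d2 where "0 < d1" "0 < d2" "\<forall>t. \<bar>t\<bar> < d1 \<longrightarrow> (\<lambda>z. f z + t * b z) \<in> a"
      "\<forall>t. \<bar>t\<bar> < d2 \<longrightarrow> (\<lambda>z. f z + t * b z) \<in> b'" by auto
    then show ?case by (intro exI[of _ "min d1 d2"]) auto
  next
    case (UN K)
    then show ?case by blast
  next
    case (Basis N)
    then obtain f' \<pi> K \<epsilon> where N: "N = Ck_nbhd k (prod_atlas A B) f' \<pi> K \<epsilon>" "f' \<in> Ck_functions k (prod_atlas A B)"
      "\<pi> \<in> prod_atlas A B" "compact K" "K \<subseteq> fst \<pi>" by blast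
    obtain \<kappa> \<eta> where k: "\<kappa> \<in> A" "\<eta> \<in> B" "\<pi> = prod_chart \<kappa> \<eta>" using N(3) unfolding prod_atlas_def by blast
    note e = smooth_atlas_chartD[OF A k(1)] smooth_atlas_chartD[OF B k(2)]
    let ?\<Omega> = "(snd \<kappa> ` fst \<kappa>) \<times> (snd \<eta> ` fst \<eta>)"
    have op: "open ?\<Omega>" by (rule open_prod_chart_image[OF A B k(1,2)])
    have "continuous_on (fst \<pi>) (snd \<pi>)"
      unfolding k(3) prod_chart_def fst_conv snd_conv map_prod_def case_prod_beta
      by (intro continuous_on_Pair continuous_on_compose2[OF e(3) continuous_on_fst[OF continuous_on_id]]
          continuous_on_compose2[OF e(10) continuous_on_snd[OF continuous_on_id]]) auto
    then have K: "compact (snd \<pi> ` K)"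
      using N(4,5) by (intro compact_continuous_image) (auto intro: continuous_on_subset)
    have Ksub: "snd \<pi> ` K \<subseteq> ?\<Omega>" using N(5) unfolding k(3) prod_chart_image[symmetric] by blast
    have small: "Ck_small k (snd \<pi> ` K) \<epsilon> ((\<lambda>x. f x - f' x) \<circ> chart_inv \<pi>)"
      using Basis.prems unfolding N(1) Ck_nbhd_def by simp
    have FC: "Ck_on k ?\<Omega> ((\<lambda>x. f x - f' x) \<circ> chart_inv \<pi>)"
      using Ck_on_diff[OF op Ck_functions_prodD[OF f k(1,2)] Ck_functions_prodD[OF N(2) k(1,2)]]
      by (simp add: k(3) comp_def)
    have BC: "Ck_on k ?\<Omega> (b \<circ> chart_inv \<pi>)"
      using Ck_functions_prodD[OF b k(1,2)] by (simp add: k(3))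
    obtain d where d: "0 < d" "\<And>t. \<bar>t\<bar> < d \<Longrightarrow> Ck_small k (snd \<pi> ` K) \<epsilon>
        (\<lambda>x. ((\<lambda>x. f x - f' x) \<circ> chart_inv \<pi>) x + t * (b \<circ> chart_inv \<pi>) x)"
      using Ck_small_perturb[OF op K Ksub FC BC small] by blast
    have "(\<lambda>z. f z + t * b z) \<in> N" if "\<bar>t\<bar> < d" for t
      unfolding N(1) Ck_nbhd_def
    proof (rule CollectI, rule conjI)
      show "(\<lambda>z. f z + t * b z) \<in> Ck_functions k (prod_atlas A B)"
        by (rule Ck_functions_add_scaled[OF A B f b])
      show "Ck_small k (snd \<pi> ` K) \<epsilon> ((\<lambda>x. f x + t * b x - f' x) \<circ> chart_inv \<pi>)"
        using d(2)[OF that] by (simp add: comp_def algebra_simps)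
    qed
    with d(1) show ?case by blast
  qed
qed

text \<open>\<open>b\<close> is a sum of products of cut-off coordinates. Near the point it reads
  \<open>(u - u0) \<bullet> (v - v0)\<close> in the charts, whose mixed derivative is the
  identity.\<close>

lemma nondegenerate_direction:
  fixes A :: "('m::{t2_space,second_countable_topology}, real^'d) chart set"
    and B :: "('n::{t2_space,second_countable_topology}, real^'d) chart set"
  assumes A: "smooth_atlas A" and B: "smooth_atlas B" and k: "\<kappa> \<in> A" "\<eta> \<in> B" "x0 \<in> fst \<kappa>" "y0 \<in> fst \<eta>"
  obtains b where "b \<in> Ck_functions 2 (prod_atlas A B)"
    "mixed_partials (b \<circ> chart_inv (prod_chart \<kappa> \<eta>)) (snd \<kappa> x0, snd \<eta> y0) = mat 1"
proof -
  have local: "\<exists>\<alpha> V. open V \<and> snd \<kappa> x \<in> V \<and> V \<subseteq> snd \<kappa> ` fst \<kappa> \<and> (\<forall>i. Ck_map 2 A (\<alpha> i)) \<and>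
      (\<forall>u\<in>V. \<forall>i. \<alpha> i (chart_inv \<kappa> u) = (u - snd \<kappa> x) $ i)"
    if A: "smooth_atlas A" and \<kappa>: "\<kappa> \<in> A" "x \<in> fst \<kappa>"
    for A :: "('z::t2_space, real^'d) chart set" and \<kappa> x
  proof -
    note c = smooth_atlas_chartD[OF A \<kappa>(1)]
    obtain U and \<rho> :: "'z \<Rightarrow> real" and K and \<sigma> :: "'z \<Rightarrow> real" and K' where b:
      "open U" "x \<in> U" "\<And>y. y \<in> U \<Longrightarrow> \<rho> y = 1" "\<And>y. y \<in> K \<Longrightarrow> \<sigma> y = 1"
      "compact K" "K \<subseteq> fst \<kappa>" "\<And>y. y \<notin> K \<Longrightarrow> \<rho> y = 0"
      "compact K'" "K' \<subseteq> fst \<kappa>" "\<And>y. y \<notin> K' \<Longrightarrow> \<sigma> y = 0"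
      "Ck_map (Suc (Suc 0)) A \<rho>" "Ck_map (Suc (Suc 0)) A \<sigma>" "U \<subseteq> K"
      using manifold_bump[OF A \<kappa>] by blast
    note r = b(1-3,5-7,11)
    let ?\<alpha> = "\<lambda>i y. \<rho> y * (snd \<kappa> y - snd \<kappa> x) $ i" and ?V = "snd \<kappa> ` (fst \<kappa> \<inter> U)"
    have "Ck_map (Suc (Suc 0)) A (?\<alpha> i)" for i
    proof (rule Ck_map_extend[OF A \<kappa>(1) r(4,5)])
      show "?\<alpha> i y = 0" if "y \<notin> K" for y using r(6)[OF that] by simp
      have "Ck_on (Suc (Suc 0)) (snd \<kappa> ` fst \<kappa>) (\<lambda>u. \<rho> (chart_inv \<kappa> u) * (u - snd \<kappa> x) $ i)"
        using r(7) \<kappa>(1) by (intro Ck_on_mult c(2) Ck_on_linear_compose[OF c(2) bounded_linear_vec_nth]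
            Ck_on_diff Ck_on_id Ck_on_const) (simp add: Ck_map_def)
      then show "Ck_on (Suc (Suc 0)) (snd \<kappa> ` fst \<kappa>) (\<lambda>u. ?\<alpha> i (chart_inv \<kappa> u))"
        by (rule Ck_on_cong[OF c(2), rotated]) (simp add: c(7))
    qed
    moreover have "open ?V" by (rule open_chart_image[OF A \<kappa>(1) r(1)])
    moreover have "?\<alpha> i (chart_inv \<kappa> u) = (u - snd \<kappa> x) $ i" if u: "u \<in> ?V" for u i
      using u r(3) c(5) by auto
    ultimately show ?thesis
      using \<kappa>(2) r(2) by (intro exI[of _ ?\<alpha>] exI[of _ ?V]) (auto simp: numeral_2_eq_2)
  qed
  obtain \<alpha> V where \<alpha>: "open V" "snd \<kappa> x0 \<in> V" "V \<subseteq> snd \<kappa> ` fst \<kappa>" "\<And>i. Ck_map 2 A (\<alpha> i)"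
    "\<And>u i. u \<in> V \<Longrightarrow> \<alpha> i (chart_inv \<kappa> u) = (u - snd \<kappa> x0) $ i"
    using local[OF A k(1,3)] by blast
  obtain \<beta> W where \<beta>: "open W" "snd \<eta> y0 \<in> W" "W \<subseteq> snd \<eta> ` fst \<eta>" "\<And>i. Ck_map 2 B (\<beta> i)"
    "\<And>v i. v \<in> W \<Longrightarrow> \<beta> i (chart_inv \<eta> v) = (v - snd \<eta> y0) $ i"
    using local[OF B k(2,4)] by blast
  define b where "b z = (\<Sum>i\<in>UNIV. \<alpha> i (fst z) * \<beta> i (snd z))" for z
  let ?u0 = "snd \<kappa> x0" and ?v0 = "snd \<eta> y0"
  have bC: "b \<in> Ck_functions 2 (prod_atlas A B)"
    unfolding Ck_functions_def
  proof (rule CollectI, rule ballI)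
    fix \<pi> assume "\<pi> \<in> prod_atlas A B"
    then obtain \<kappa>' \<eta>' where k': "\<kappa>' \<in> A" "\<eta>' \<in> B" "\<pi> = prod_chart \<kappa>' \<eta>'" unfolding prod_atlas_def by blast
    note a = smooth_atlas_chartD[OF A k'(1)] and e = smooth_atlas_chartD[OF B k'(2)]
    let ?\<Omega> = "(snd \<kappa>' ` fst \<kappa>') \<times> (snd \<eta>' ` fst \<eta>')"
    have op: "open ?\<Omega>" by (rule open_prod_chart_image[OF A B k'(1,2)])
    have 1: "Ck_on 2 ?\<Omega> (\<lambda>z. \<alpha> i (chart_inv \<kappa>' (fst z)))" for i
      by (rule Ck_on_compose[OF op a(2) Ck_on_linear[OF op bounded_linear_fst]])
        (use \<alpha>(4) k' in \<open>auto simp: Ck_map_def\<close>)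
    have 2: "Ck_on 2 ?\<Omega> (\<lambda>z. \<beta> i (chart_inv \<eta>' (snd z)))" for i
      by (rule Ck_on_compose[OF op e(2) Ck_on_linear[OF op bounded_linear_snd]])
        (use \<beta>(4) k' in \<open>auto simp: Ck_map_def\<close>)
    have "Ck_on 2 ?\<Omega> (\<lambda>z. \<Sum>i\<in>UNIV. \<alpha> i (chart_inv \<kappa>' (fst z)) * \<beta> i (chart_inv \<eta>' (snd z)))"
      by (intro Ck_on_sum op Ck_on_mult 1 2)
    then have "Ck_on 2 ?\<Omega> (b \<circ> chart_inv \<pi>)"
      by (rule Ck_on_cong[OF op, rotated])
        (use chart_inv_prod_chart[OF A B k'(1,2)] in \<open>auto simp: b_def k'(3)\<close>)
    then show "Ck_on 2 (snd \<pi> ` fst \<pi>) (b \<circ> chart_inv \<pi>)" unfolding k'(3) prod_chart_image .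
  qed
  let ?F = "b \<circ> chart_inv (prod_chart \<kappa> \<eta>)"
  have opVW: "open (V \<times> W)" using \<alpha>(1) \<beta>(1) by (rule open_Times)
  have Fval: "?F z = (fst z - ?u0) \<bullet> (snd z - ?v0)" if z: "z \<in> V \<times> W" for z
  proof -
    obtain u v where uv: "z = (u, v)" "u \<in> V" "v \<in> W" using z by blast
    then have "u \<in> snd \<kappa> ` fst \<kappa>" "v \<in> snd \<eta> ` fst \<eta>" using \<alpha>(3) \<beta>(3) by blast+
    then show ?thesis
      using chart_inv_prod_chart[OF A B k(1,2)] \<alpha>(5)[OF uv(2)] \<beta>(5)[OF uv(3)] by (simp add: uv(1) b_def inner_vec_def)
  qed
  have D1: "dir_deriv ?F (0, axis j 1) z = (fst z - ?u0) $ j" if z: "z \<in> V \<times> W" for z j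
  proof -
    have "((\<lambda>z. (fst z - ?u0) \<bullet> (snd z - ?v0)) has_derivative
        (\<lambda>w. (fst z - ?u0) \<bullet> snd w + fst w \<bullet> (snd z - ?v0))) (at z)"
      by (auto intro!: derivative_eq_intros)
    then have "dir_deriv (\<lambda>z. (fst z - ?u0) \<bullet> (snd z - ?v0)) (0, axis j 1) z = (fst z - ?u0) \<bullet> axis j 1"
      by (simp add: dir_deriv_eq)
    then show ?thesis
      using dir_deriv_cong_open[OF opVW z, of ?F "\<lambda>z. (fst z - ?u0) \<bullet> (snd z - ?v0)"] Fval by (simp add: inner_axis)
  qed
  have "dir_deriv (dir_deriv ?F (0, axis j 1)) (axis i 1, 0) (?u0, ?v0) = mat 1 $ i $ j" for i j
  proof -
    have mem: "(?u0, ?v0) \<in> V \<times> W" using \<alpha>(2) \<beta>(2) by simp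
    have "((\<lambda>z :: (real^'d) \<times> (real^'d). (fst z - ?u0) $ j) has_derivative (\<lambda>w. fst w $ j)) (at (?u0, ?v0))"
      by (auto intro!: derivative_eq_intros bounded_linear.has_derivative[OF bounded_linear_vec_nth])
    then have "dir_deriv (\<lambda>z :: (real^'d) \<times> (real^'d). (fst z - ?u0) $ j) (axis i 1, 0) (?u0, ?v0) = axis i 1 $ j"
      by (simp add: dir_deriv_eq)
    moreover have "dir_deriv (dir_deriv ?F (0, axis j 1)) (axis i 1, 0) (?u0, ?v0) =
        dir_deriv (\<lambda>z. (fst z - ?u0) $ j) (axis i 1, 0) (?u0, ?v0)"
      by (rule dir_deriv_cong_open[OF opVW mem D1])
    ultimately show ?thesis by (simp add: mat_def axis_def)
  qed
  then have "mixed_partials ?F (?u0, ?v0) = mat 1"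
    by (simp add: mixed_partials_def vec_eq_iff)
  with bC show ?thesis by (rule that)
qed

text \<open>For \<open>t = 1 / s\<close> the determinant is a positive multiple of
  \<open>det (mat 1 + s *\<^sub>R M)\<close>, a polynomial in \<open>s\<close> with value 1 at 0.
  Its finitely many roots cannot exhaust the range \<open>s > 1 / \<delta>\<close>.\<close>

lemma exists_invertible_shift:
  fixes M :: "real^'n^'n"
  assumes "0 < \<delta>"
  obtains t where "\<bar>t\<bar> < \<delta>" "invertible (M + t *\<^sub>R mat 1)"
proof -
  define m where "m S = (\<Sum>p | p permutes UNIV. of_int (sign p) *
      ((\<Prod>i\<in>-S. (mat 1 :: real^'n^'n) $ i $ p i) * (\<Prod>i\<in>S. M $ i $ p i)))" for S
  have m: "det (mat 1 + s *\<^sub>R M) = (\<Sum>S\<in>UNIV. s ^ card S * m S)" for s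
    unfolding m_def by (rule det_one_plus_scaled)
  define c where "c k = (\<Sum>S | card S = k. m S)" for k
  have p: "det (mat 1 + s *\<^sub>R M) = (\<Sum>k\<le>CARD('n). c k * s ^ k)" for s
    unfolding m sum_power_card c_def ..
  have "c 0 = (\<Sum>k\<le>CARD('n). c k * 0 ^ k)" by (simp add: sum.atMost_shift)
  also have "\<dots> = 1" using p[of 0] by (simp add: det_I)
  finally have "c 0 \<noteq> 0" by simp
  then have "finite {s. (\<Sum>k\<le>CARD('n). c k * s ^ k) = 0}"
    using Transcendental.polyfun_rootbound[of c 0 "CARD('n)"] by auto
  then have "\<not> {1 / \<delta><..} \<subseteq> {s. (\<Sum>k\<le>CARD('n). c k * s ^ k) = 0}"
    using infinite_Ioi finite_subset by blast
  then obtain s where s: "1 / \<delta> < s" "det (mat 1 + s *\<^sub>R M) \<noteq> 0" unfolding p by blast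
  have s0: "0 < s" using s(1) assms by (meson divide_pos_pos less_trans zero_less_one)
  have "M + (1 / s) *\<^sub>R mat 1 = (\<chi> i. (1 / s) *s (mat 1 + s *\<^sub>R M) $ i)"
    using s0 by (simp add: vec_eq_iff field_simps)
  then have "det (M + (1 / s) *\<^sub>R mat 1) = (\<Prod>i\<in>(UNIV :: 'n set). 1 / s) * det (mat 1 + s *\<^sub>R M)"
    by (simp only: det_rows_mul vec_lambda_eta)
  then have "invertible (M + (1 / s) *\<^sub>R mat 1)"
    using s(2) s0 by (simp add: invertible_det_nz)
  moreover have "\<bar>1 / s\<bar> < \<delta>" using s(1) s0 assms by (simp add: field_simps)
  ultimately show ?thesis by (rule that[rotated])
qed

lemma closure_of_nondegenerate:
  fixes A :: "('m::{t2_space,second_countable_topology}, real^'d) chart set"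
    and B :: "('n::{t2_space,second_countable_topology}, real^'d) chart set"
  assumes A: "smooth_atlas A" and B: "smooth_atlas B"
  shows "Ck_topology 2 (prod_atlas A B) closure_of
    {c \<in> Ck_functions 2 (prod_atlas A B). \<exists>x y. nondegenerate_at A B c x y} = Ck_functions 2 (prod_atlas A B)"
    (is "?T closure_of ?S = ?C")
proof
  show "?T closure_of ?S \<subseteq> ?C"
    using closure_of_subset_topspace[of ?T ?S]
    unfolding Ck_topology_def topology_generated_by_topspace by (auto simp: Ck_nbhd_def)
  \<comment> \<open>Non-degeneracy has to be created at a single point only, and any point
    serves.\<close>
  fix x0 :: 'm and y0 :: 'n
  obtain \<kappa> where \<kappa>: "\<kappa> \<in> A" "x0 \<in> fst \<kappa>" by (rule smooth_atlas_cover[OF A])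
  obtain \<eta> where \<eta>: "\<eta> \<in> B" "y0 \<in> fst \<eta>" by (rule smooth_atlas_cover[OF B])
  let ?\<pi> = "prod_chart \<kappa> \<eta>" and ?z = "(snd \<kappa> x0, snd \<eta> y0)"
  have \<pi>: "?\<pi> \<in> prod_atlas A B" using \<kappa> \<eta> unfolding prod_atlas_def by blast
  obtain b where b: "b \<in> ?C" "mixed_partials (b \<circ> chart_inv ?\<pi>) ?z = mat 1"
    by (rule nondegenerate_direction[OF A B \<kappa>(1) \<eta>(1) \<kappa>(2) \<eta>(2)])
  have op: "open ((snd \<kappa> ` fst \<kappa>) \<times> (snd \<eta> ` fst \<eta>))" and zmem: "?z \<in> (snd \<kappa> ` fst \<kappa>) \<times> (snd \<eta> ` fst \<eta>)"
    using open_prod_chart_image[OF A B \<kappa>(1) \<eta>(1)] \<kappa>(2) \<eta>(2) by auto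
  show "?C \<subseteq> ?T closure_of ?S"
  proof
    fix f assume f: "f \<in> ?C"
    have "openin ?T (Ck_nbhd 2 (prod_atlas A B) f ?\<pi> {} 1)"
      unfolding Ck_topology_def using f \<pi> by (intro topology_generated_by_Basis CollectI exI conjI refl) auto
    moreover have "f \<in> Ck_nbhd 2 (prod_atlas A B) f ?\<pi> {} 1"
      using f by (simp add: Ck_nbhd_def Ck_small_empty)
    ultimately have top: "f \<in> topspace ?T" by (meson openin_subset subsetD)
    have "\<exists>g\<in>?S. g \<in> N" if N: "f \<in> N" "openin ?T N" for N
    proof -
      obtain \<delta> where \<delta>: "0 < \<delta>" "\<And>t. \<bar>t\<bar> < \<delta> \<Longrightarrow> (\<lambda>z. f z + t * b z) \<in> N"
        using Ck_topology_segment[OF A B f b(1) N(2,1)] by blast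
      obtain t where t: "\<bar>t\<bar> < \<delta>" "invertible (mixed_partials (f \<circ> chart_inv ?\<pi>) ?z + t *\<^sub>R mat 1)"
        by (rule exists_invertible_shift[OF \<delta>(1)])
      let ?g = "\<lambda>z. f z + t * b z"
      have F: "Ck_on (Suc (Suc 0)) ((snd \<kappa> ` fst \<kappa>) \<times> (snd \<eta> ` fst \<eta>)) (f \<circ> chart_inv ?\<pi>)"
        "Ck_on (Suc (Suc 0)) ((snd \<kappa> ` fst \<kappa>) \<times> (snd \<eta> ` fst \<eta>)) (b \<circ> chart_inv ?\<pi>)"
        using Ck_functions_prodD[OF f \<kappa>(1) \<eta>(1)] Ck_functions_prodD[OF b(1) \<kappa>(1) \<eta>(1)]
        by (simp_all add: numeral_2_eq_2 del: Ck_on.simps)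
      have "mixed_partials (?g \<circ> chart_inv ?\<pi>) ?z = mixed_partials (f \<circ> chart_inv ?\<pi>) ?z + t *\<^sub>R mat 1"
        using mixed_partials_add_scaled[OF op zmem F, of t] b(2) by (simp add: comp_def)
      with t(2) have "invertible (mixed_partials (?g \<circ> chart_inv ?\<pi>) ?z)" by (simp only:)
      then have "nondegenerate_at A B ?g x0 y0"
        using \<kappa> \<eta> unfolding nondegenerate_at_def by blast
      then show ?thesis
        using Ck_functions_add_scaled[OF A B f b(1), of t] \<delta>(2)[OF t(1)] by blast
    qed
    then show "f \<in> ?T closure_of ?S" using top unfolding in_closure_of by blast
  qed
qed

theorem theorem1p1:
  fixes A :: "('m::{t2_space,second_countable_topology}, real^'d) chart set"
    and B :: "('n::{t2_space,second_countable_topology}, real^'d) chart set"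
  assumes "closed_manifold A" and "closed_manifold B"
  shows "(\<forall>c \<in> Ck_functions 2 (prod_atlas A B).
           (\<forall>z. 0 \<le> c z) \<and> (\<exists>x y. nondegenerate_at A B c x y) \<longrightarrow>
           (\<exists>\<mu> \<nu>. ac_prob A \<mu> \<and> ac_prob B \<nu> \<and>
              (\<exists>!\<gamma>. optimal_plan c \<mu> \<nu> \<gamma>) \<and>
              (\<forall>\<gamma>. optimal_plan c \<mu> \<nu> \<gamma> \<longrightarrow> \<not> supported_on_graph \<gamma>))) \<and>
         openin (Ck_topology 2 (prod_atlas A B))
           {c \<in> Ck_functions 2 (prod_atlas A B). \<exists>x y. nondegenerate_at A B c x y} \<and>
         Ck_topology 2 (prod_atlas A B) closure_of
           {c \<in> Ck_functions 2 (prod_atlas A B). \<exists>x y. nondegenerate_at A B c x y} =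
           Ck_functions 2 (prod_atlas A B)"
proof (intro conjI ballI impI)
  have atlas: "smooth_atlas A" "smooth_atlas B"
    using assms by (auto simp: closed_manifold_def)
  show "openin (Ck_topology 2 (prod_atlas A B))
      {c \<in> Ck_functions 2 (prod_atlas A B). \<exists>x y. nondegenerate_at A B c x y}"
    by (rule openin_nondegenerate[OF atlas])
  show "Ck_topology 2 (prod_atlas A B) closure_of
      {c \<in> Ck_functions 2 (prod_atlas A B). \<exists>x y. nondegenerate_at A B c x y} =
      Ck_functions 2 (prod_atlas A B)"
    by (rule closure_of_nondegenerate[OF atlas])
  fix c assume c: "c \<in> Ck_functions 2 (prod_atlas A B)"
    and "(\<forall>z. 0 \<le> c z) \<and> (\<exists>x y. nondegenerate_at A B c x y)"
  then obtain x y where "\<And>z. 0 \<le> c z" "nondegenerate_at A B c x y" by blast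
  then show "\<exists>\<mu> \<nu>. ac_prob A \<mu> \<and> ac_prob B \<nu> \<and> (\<exists>!\<gamma>. optimal_plan c \<mu> \<nu> \<gamma>) \<and>
      (\<forall>\<gamma>. optimal_plan c \<mu> \<nu> \<gamma> \<longrightarrow> \<not> supported_on_graph \<gamma>)"
    by (rule nondegenerate_cost_measures[OF assms c])
qed

end
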